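(* Let $0\le\sigma<n/2$ and let $\mu$ be a positive measure on $\mathbb{B}_n$. For $\alpha>-1$ consider the inequality $(R_\alpha)$: there is $C<\infty$ such that for all $g\ge0$, $$\int_{\mathbb{B}_n}\left\{\int_{\mathbb{B}_n}\frac{g(z)\,d\mu(z)}{|1-\overline z\cdot w|^{\frac{n+1+\alpha}{2}+\sigma}}\right\}^2(1+\alpha)(1-|w|^2)^\alpha\,dw\le C\int_{\mathbb{B}_n}g(z)^2d\mu(z).$$ Then the following are equivalent: $(R_\alpha)$ holds for some $\alpha>-1$; $(R_\alpha)$ holds for all $\alpha>-1$; there is $C<\infty$ such that $$\|T_\mu^\sigma g\|_{L^2(\sigma_n)}\le C\|g\|_{L^2(\mu)},\quad g\in L^2(\mu),\qquad\text{where }T_\mu^\sigma g(w)=\int_{\mathbb{B}_n}\frac{g(z)\,d\mu(z)}{|1-\overline z\cdot w|^{\frac n2+\sigma}},\ w\in\partial\mathbb{B}_n;$$ and the tree condition holds: there is $C<\infty$ such that $$\sum_{\beta\ge\eta}\left[2^{\sigma d(\beta)}I^*\mu(\beta)\right]^2\le C\,I^*\mu(\eta)<\infty,\qquad\eta\in\mathcal{T}_n.$$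
   Context: $\sigma_n$ is surface measure on the unit sphere $\partial\mathbb{B}_n$, $dw$ is Lebesgue measure on $\mathbb{B}_n\subset\mathbb{C}^n$. Bergman tree $\mathcal{T}_n$. Let $\varrho$ be the Bergman metric on $\mathbb{B}_n$, normalized so that $\varrho(0,z)=\tanh^{-1}|z|$. Let $\theta=\frac{\ln2}{2}$, $\mathcal{S}_r=\{z:\varrho(0,z)=r\}$, and let $P_rz$ be the radial projection of $z\neq0$ onto $\mathcal{S}_r$. For each integer $N\ge1$ fix finitely many points $z_j^N\in\mathcal{S}_{N\theta}$ and pairwise disjoint Borel sets $Q_j^N$ with $\bigcup_jQ_j^N=\mathcal{S}_{N\theta}$ and $B(z_j^N,1)\subset Q_j^N\subset B(z_j^N,2)$ (balls in $(\mathcal{S}_{N\theta},\varrho)$). The vertices of $\mathcal{T}_n$ are the kubes $K_1^0=\{\varrho(0,z)<\theta\}$ (the root $o$) and $K_j^N=\{N\theta\le\varrho(0,z)<(N+1)\theta,\ P_{N\theta}z\in Q_j^N\}$, $N\ge1$. $K_i^{N+1}$ is a child of $K_j^N$ if $P_{N\theta}(z_i^{N+1})\in Q_j^N$, and every $K_j^1$ is a child of the root. For a vertex $\eta\in\mathcal{T}_n$, $K_\eta$ is the corresponding kube, $d(\eta)$ its tree distance from the root, $\beta\ge\eta$ means $\eta$ lies on the geodesic from $o$ to $\beta$, and $I^*\mu(\eta)=\sum_{\beta\ge\eta}\mu(K_\beta)$.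
   Formalization: The positive measure μ is taken to be a σ-finite Borel measure on the ball; for an arbitrary positive measure such as ∞·δ₀ the inequalities (R_α) and the T bound hold while the tree condition fails. *)

theory Defs
  imports "HOL-Analysis.Analysis"
begin

text \<open>The ambient space is \<open>complex ^ 'n\<close>, with \<open>n = CARD('n)\<close>, and the unit ball is \<open>ball 0 1\<close>.\<close>

text \<open>\<open>cdot z w\<close> is the product written \<open>conj z . w\<close>; it is antilinear in \<open>z\<close>.\<close>

definition cdot :: "complex ^ 'n \<Rightarrow> complex ^ 'n \<Rightarrow> complex" where
  "cdot z w = (\<Sum>i\<in>UNIV. cnj (z $ i) * w $ i)"

text \<open>
  Up to an additive constant, the logarithm of the Bergman kernel of the ball on the diagonal is
  \<open>- (n + 1) ln (1 - |z|^2)\<close>. Its complex Hessian, evaluated on a tangent vector \<open>v\<close> at \<open>z\<close> and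
  divided by \<open>n + 1\<close>, is \<open>bergman_form z v\<close>. The factor \<open>1 / (n + 1)\<close> is the normalization
  that makes the distance from \<open>0\<close> to \<open>z\<close> equal to \<open>artanh |z|\<close>.
\<close>

definition bergman_form :: "complex ^ 'n \<Rightarrow> complex ^ 'n \<Rightarrow> real" where
  "bergman_form z v =
     ((1 - (norm z)\<^sup>2) * (norm v)\<^sup>2 + (cmod (cdot z v))\<^sup>2) / (1 - (norm z)\<^sup>2)\<^sup>2"

text \<open>
  The use of \<open>has_integral\<close> rather than \<open>integral\<close> excludes non-rectifiable paths, which exist
  because \<open>valid_path\<close> does not bound the derivative near the finitely many break points; with
  \<open>integral\<close> such paths would be given length \<open>0\<close>.
\<close>

definition bergman_dist :: "complex ^ 'n \<Rightarrow> complex ^ 'n \<Rightarrow> real" where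
  "bergman_dist z w =
     Inf {L. \<exists>\<gamma>. valid_path \<gamma> \<and> path_image \<gamma> \<subseteq> ball 0 1 \<and> pathstart \<gamma> = z \<and> pathfinish \<gamma> = w \<and>
               ((\<lambda>t. sqrt (bergman_form (\<gamma> t) (vector_derivative \<gamma> (at t)))) has_integral L) {0..1}}"

lemma Re_cdot: "Re (cdot z v) = z \<bullet> v"
  by (simp add: cdot_def inner_vec_def inner_complex_def)

lemma cdot_self: "cdot z z = complex_of_real ((norm z)\<^sup>2)"
proof (rule complex_eqI)
  show "Re (cdot z z) = Re (complex_of_real ((norm z)\<^sup>2))"
    by (simp add: Re_cdot power2_norm_eq_inner)
  show "Im (cdot z z) = Im (complex_of_real ((norm z)\<^sup>2))"
    by (simp add: cdot_def mult.commute)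
qed

lemma cdot_scaleR: "cdot (t *\<^sub>R z) v = complex_of_real t * cdot z v"
  unfolding cdot_def vector_scaleR_component
  by (simp add: sum_distrib_left scaleR_conv_of_real mult_ac)

lemma bergman_form_radial:
  fixes z v :: "complex ^ 'n"
  assumes "norm z < 1" "z \<noteq> 0"
  shows "(z \<bullet> v) / norm z / (1 - (norm z)\<^sup>2) \<le> sqrt (bergman_form z v)"
proof (rule real_le_rsqrt)
  let ?r = "norm z" and ?a = "z \<bullet> v"
  have r: "0 < ?r" "0 < 1 - ?r\<^sup>2"
    using assms by (auto simp: abs_square_less_1)
  have "?a\<^sup>2 \<le> (norm z * norm v)\<^sup>2"
    using Cauchy_Schwarz_ineq2[of z v] by (metis abs_le_square_iff abs_mult abs_norm_cancel)
  then have 1: "?a\<^sup>2 / ?r\<^sup>2 \<le> (norm v)\<^sup>2"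
    using r by (simp add: divide_le_eq power_mult_distrib mult.commute)
  have 2: "?a\<^sup>2 \<le> (cmod (cdot z v))\<^sup>2"
    using abs_Re_le_cmod[of "cdot z v"] by (metis Re_cdot abs_le_square_iff abs_norm_cancel)
  have "?a\<^sup>2 / ?r\<^sup>2 = (1 - ?r\<^sup>2) * (?a\<^sup>2 / ?r\<^sup>2) + ?a\<^sup>2"
    using r by (simp add: field_simps)
  also have "\<dots> \<le> (1 - ?r\<^sup>2) * (norm v)\<^sup>2 + (cmod (cdot z v))\<^sup>2"
    using 1 2 r by (intro add_mono mult_left_mono) auto
  finally have "?a\<^sup>2 / ?r\<^sup>2 / (1 - ?r\<^sup>2)\<^sup>2 \<le> bergman_form z v"
    unfolding bergman_form_def by (rule divide_right_mono) simp
  then show "(?a / ?r / (1 - ?r\<^sup>2))\<^sup>2 \<le> bergman_form z v"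
    by (simp add: power_divide power_mult_distrib)
qed

lemma bergman_form_nonneg: "norm z < 1 \<Longrightarrow> 0 \<le> bergman_form z v"
  unfolding bergman_form_def
  by (intro divide_nonneg_nonneg add_nonneg_nonneg mult_nonneg_nonneg)
     (auto simp: power_le_one)

lemma bergman_dist_0:
  fixes z :: "complex ^ 'n"
  assumes z: "z \<in> ball 0 1"
  shows "bergman_dist 0 z = artanh (norm z)"
  unfolding bergman_dist_def
proof (rule cInf_eq_minimum)
  let ?r = "norm z"
  have r: "?r < 1" using z by simp
  have tr: "norm (t *\<^sub>R z) < 1" if "t \<in> {0..1}" for t
    using that r by (simp add: mult_le_one) (smt (verit) mult_left_le_one_le norm_ge_zero)
  have speed: "sqrt (bergman_form (t *\<^sub>R z) z) = ?r / (1 - (t * ?r)\<^sup>2)" if "t \<in> {0..1}" for t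
  proof -
    have p: "0 < 1 - (t * ?r)\<^sup>2"
      using tr[OF that] that by (simp add: abs_square_less_1)
    have "bergman_form (t *\<^sub>R z) z = (?r / (1 - (t * ?r)\<^sup>2))\<^sup>2"
      unfolding bergman_form_def cdot_scaleR cdot_self using that p
      by (simp add: norm_mult norm_power power_divide power_mult_distrib)
         (simp add: algebra_simps power2_eq_square power4_eq_xxxx)
    then show ?thesis using p by simp
  qed
  have der: "((\<lambda>t. artanh (t * ?r)) has_vector_derivative ?r / (1 - (t * ?r)\<^sup>2)) (at t within {0..1})"
    if "t \<in> {0..1}" for t
    unfolding has_real_derivative_iff_has_vector_derivative[symmetric]
    by (rule DERIV_chain'[where g = artanh and f = "\<lambda>t. t * ?r", THEN DERIV_cong])
       (use tr[OF that] in \<open>auto intro!: derivative_eq_intros artanh_real_has_field_derivative simp: abs_mult\<close>)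
  have "((\<lambda>t. ?r / (1 - (t * ?r)\<^sup>2)) has_integral artanh (1 * ?r) - artanh (0 * ?r)) {0..1}"
    by (rule fundamental_theorem_of_calculus[OF _ der]) auto
  then have int: "((\<lambda>t. ?r / (1 - (t * ?r)\<^sup>2)) has_integral artanh ?r) {0..1}"
    by simp
  have vd: "vector_derivative (\<lambda>t. t *\<^sub>R z) (at t) = z" for t
    by (rule vector_derivative_at) (auto intro!: derivative_eq_intros)
  have "((\<lambda>t. sqrt (bergman_form (t *\<^sub>R z) (vector_derivative (\<lambda>t. t *\<^sub>R z) (at t))))
          has_integral artanh ?r) {0..1}"
    unfolding vd by (rule has_integral_eq[OF _ int]) (simp add: speed)
  moreover have "valid_path (\<lambda>t. t *\<^sub>R z)"
    unfolding valid_path_def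
    by (rule C1_differentiable_imp_piecewise)
       (auto simp: C1_differentiable_on_def intro!: exI[of _ "\<lambda>_. z"] derivative_eq_intros)
  moreover have "path_image (\<lambda>t. t *\<^sub>R z) \<subseteq> ball 0 1"
    using tr by (auto simp: path_image_def)
  ultimately show "artanh ?r \<in> {L. \<exists>\<gamma>. valid_path \<gamma> \<and> path_image \<gamma> \<subseteq> ball 0 1 \<and>
      pathstart \<gamma> = 0 \<and> pathfinish \<gamma> = z \<and>
      ((\<lambda>t. sqrt (bergman_form (\<gamma> t) (vector_derivative \<gamma> (at t)))) has_integral L) {0..1}}"
    by (auto simp: pathstart_def pathfinish_def intro!: exI[of _ "\<lambda>t. t *\<^sub>R z"])
next
  fix L
  assume "L \<in> {L. \<exists>\<gamma>. valid_path \<gamma> \<and> path_image \<gamma> \<subseteq> ball 0 1 \<and> pathstart \<gamma> = 0 \<and> pathfinish \<gamma> = z \<and>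
      ((\<lambda>t. sqrt (bergman_form (\<gamma> t) (vector_derivative \<gamma> (at t)))) has_integral L) {0..1}}"
  then obtain \<gamma> where vp: "valid_path \<gamma>" and im: "path_image \<gamma> \<subseteq> ball 0 1" and s: "\<gamma> 0 = 0" and f: "\<gamma> 1 = z"
    and L: "((\<lambda>t. sqrt (bergman_form (\<gamma> t) (vector_derivative \<gamma> (at t)))) has_integral L) {0..1}"
    by (auto simp: pathstart_def pathfinish_def)
  let ?sp = "\<lambda>t. sqrt (bergman_form (\<gamma> t) (vector_derivative \<gamma> (at t)))"
  have cont: "continuous_on {0..1} \<gamma>"
    using vp by (simp add: valid_path_def piecewise_C1_differentiable_on_def)
  obtain S where S: "finite S" "\<And>t. t \<in> {0..1} - S \<Longrightarrow> \<gamma> differentiable at t"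
    using vp by (auto simp: valid_path_def piecewise_C1_differentiable_on_def C1_differentiable_on_eq)
  have lt1: "norm (\<gamma> t) < 1" if "t \<in> {0..1}" for t
    using im that by (auto simp: path_image_def image_subset_iff)
  let ?Z = "{t \<in> {0..1}. \<gamma> t \<in> {0}}"
  have "closed ?Z"
    using continuous_closed_preimage[OF cont, of "{0}"] by (simp add: vimage_def Int_def)
  moreover have "bounded ?Z"
    by (rule bounded_subset[of "{0..1}"]) auto
  ultimately have "compact ?Z" by (simp add: compact_eq_bounded_closed)
  moreover have "0 \<in> ?Z" using s by simp
  ultimately obtain t0 where t0: "t0 \<in> ?Z" "\<And>t. t \<in> ?Z \<Longrightarrow> t \<le> t0"
    using compact_attains_sup[of ?Z] by blast
  have d: "((\<lambda>t. artanh (norm (\<gamma> t))) has_vector_derivative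
            (\<gamma> t \<bullet> vector_derivative \<gamma> (at t)) / norm (\<gamma> t) / (1 - (norm (\<gamma> t))\<^sup>2)) (at t)"
    if t: "t \<in> {t0<..<1} - S" for t
  proof -
    have t': "t \<in> {0..1} - S" using t t0(1) by auto
    have nz: "\<gamma> t \<noteq> 0" using t t' t0(2)[of t] by auto
    have g: "(\<gamma> has_vector_derivative vector_derivative \<gamma> (at t)) (at t)"
      using S(2)[OF t'] by (simp add: vector_derivative_works)
    have "((\<lambda>t. norm (\<gamma> t)) has_derivative
            (\<lambda>h. (h *\<^sub>R vector_derivative \<gamma> (at t)) \<bullet> sgn (\<gamma> t))) (at t)"
      by (rule has_derivative_compose[OF g[unfolded has_vector_derivative_def] has_derivative_norm[OF nz]])
    then have "((\<lambda>t. norm (\<gamma> t)) has_real_derivative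
            (\<gamma> t \<bullet> vector_derivative \<gamma> (at t)) / norm (\<gamma> t)) (at t)"
      unfolding has_field_derivative_def
      by (rule has_derivative_eq_rhs) (auto simp: sgn_div_norm inner_commute divide_inverse mult_ac)
    from DERIV_chain2[OF artanh_real_has_field_derivative this] show ?thesis
      using lt1[of t] t' by (simp add: has_real_derivative_iff_has_vector_derivative mult.commute)
  qed
  have c: "continuous_on {t0..1} (\<lambda>t. artanh (norm (\<gamma> t)))"
  proof -
    have "continuous_on {t0..1} (\<lambda>t. norm (\<gamma> t))"
      using t0 by (intro continuous_on_norm continuous_on_subset[OF cont]) auto
    then show ?thesis
      by (rule continuous_on_artanh') (use lt1 t0 in \<open>auto intro: less_le_trans[of _ 0]\<close>)
  qed
  have I: "((\<lambda>t. (\<gamma> t \<bullet> vector_derivative \<gamma> (at t)) / norm (\<gamma> t) / (1 - (norm (\<gamma> t))\<^sup>2))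
          has_integral artanh (norm (\<gamma> 1)) - artanh (norm (\<gamma> t0))) {t0..1}"
    by (rule fundamental_theorem_of_calculus_interior_strong[OF S(1) _ d c]) (use t0 in auto)
  have "?sp integrable_on {0..1}" using L by (rule has_integral_integrable)
  then have "?sp integrable_on {t0..1}"
    by (rule integrable_subinterval_real) (use t0(1) in auto)
  then have J: "(?sp has_integral integral {t0..1} ?sp) {t0..1}"
    by (rule integrable_integral)
  have "artanh (norm (\<gamma> 1)) - artanh (norm (\<gamma> t0)) \<le> integral {t0..1} ?sp"
  proof (rule has_integral_le[OF I J])
    fix t assume t: "t \<in> {t0..1}"
    then have n: "norm (\<gamma> t) < 1" using lt1 t0(1) by simp
    show "(\<gamma> t \<bullet> vector_derivative \<gamma> (at t)) / norm (\<gamma> t) / (1 - (norm (\<gamma> t))\<^sup>2) \<le> ?sp t"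
    proof (cases "\<gamma> t = 0")
      case True
      then show ?thesis by (simp add: bergman_form_nonneg)
    next
      case False
      then show ?thesis by (rule bergman_form_radial[OF n])
    qed
  qed
  also have "\<dots> \<le> integral {0..1} ?sp"
  proof (rule integral_subset_le)
    show "{t0..1} \<subseteq> {0..1}" using t0(1) by simp
    show "\<forall>t\<in>{0..1}. 0 \<le> ?sp t" using lt1 by (simp add: bergman_form_nonneg)
  qed fact+
  also have "\<dots> = L" using L by (rule integral_unique)
  finally show "artanh (norm z) \<le> L" using t0(1) f by simp
qed

text \<open>
  Polar coordinates: the surface measure of \<open>A\<close> is the real dimension \<open>2 n\<close> times the volume of
  the part of the unit ball lying in the cone over \<open>A\<close>.
\<close>

definition surface_measure :: "(complex ^ 'n) measure" where
  "surface_measure =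
     scale_measure (of_nat (2 * CARD('n)))
       (distr (restrict_space lborel (ball 0 1 - {0})) (restrict_space borel (sphere 0 1)) sgn)"


definition theta :: real where
  "theta = ln 2 / 2"

definition bergman_sphere :: "real \<Rightarrow> (complex ^ 'n) set" where
  "bergman_sphere r = {z \<in> ball 0 1. bergman_dist 0 z = r}"

text \<open>By \<open>bergman_dist_0\<close>, \<open>bergman_sphere r\<close> has Euclidean radius \<open>tanh r\<close>.\<close>

definition radial_proj :: "real \<Rightarrow> complex ^ 'n \<Rightarrow> complex ^ 'n" where
  "radial_proj r z = tanh r *\<^sub>R sgn z"

text \<open>
  The points and Borel sets on \<open>bergman_sphere (N * theta)\<close> are \<open>c N j\<close> and \<open>Q N j\<close> for
  \<open>j \<in> {1..J N}\<close>. Only \<open>N \<ge> 1\<close> matters.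
\<close>

locale bergman_tree =
  fixes J :: "nat \<Rightarrow> nat"
    and c :: "nat \<Rightarrow> nat \<Rightarrow> complex ^ 'n"
    and Q :: "nat \<Rightarrow> nat \<Rightarrow> (complex ^ 'n) set"
  assumes center: "\<And>N j. 1 \<le> N \<Longrightarrow> j \<in> {1..J N} \<Longrightarrow> c N j \<in> bergman_sphere (real N * theta)"
    and borel: "\<And>N j. 1 \<le> N \<Longrightarrow> j \<in> {1..J N} \<Longrightarrow> Q N j \<in> sets borel"
    and disjoint: "\<And>N. 1 \<le> N \<Longrightarrow> disjoint_family_on (Q N) {1..J N}"
    and cover: "\<And>N. 1 \<le> N \<Longrightarrow> (\<Union>j\<in>{1..J N}. Q N j) = bergman_sphere (real N * theta)"
    and inner_ball: "\<And>N j. 1 \<le> N \<Longrightarrow> j \<in> {1..J N} \<Longrightarrow>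
           {w \<in> bergman_sphere (real N * theta). bergman_dist (c N j) w < 1} \<subseteq> Q N j"
    and outer_ball: "\<And>N j. 1 \<le> N \<Longrightarrow> j \<in> {1..J N} \<Longrightarrow>
           Q N j \<subseteq> {w \<in> bergman_sphere (real N * theta). bergman_dist (c N j) w < 2}"

text \<open>
  The vertex \<open>(N, j)\<close> stands for the kube with upper index \<open>N\<close> and lower index \<open>j\<close>. Kubes with
  different indices are disjoint and nonempty, so the vertices may be identified with the kubes.
\<close>

type_synonym vertex = "nat \<times> nat"

definition root :: vertex where
  "root = (0, 1)"

definition vertices :: "(nat \<Rightarrow> nat) \<Rightarrow> vertex set" where
  "vertices J = insert root {(N, j). 1 \<le> N \<and> j \<in> {1..J N}}"

definition kube :: "(nat \<Rightarrow> nat \<Rightarrow> (complex ^ 'n) set) \<Rightarrow> vertex \<Rightarrow> (complex ^ 'n) set" where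
  "kube Q \<eta> = (case \<eta> of (N, j) \<Rightarrow>
     if N = 0 then {z \<in> ball 0 1. bergman_dist 0 z < theta}
     else {z \<in> ball 0 1. real N * theta \<le> bergman_dist 0 z \<and> bergman_dist 0 z < (real N + 1) * theta \<and>
                         radial_proj (real N * theta) z \<in> Q N j})"

text \<open>Pairs (parent, child).\<close>

definition children ::
  "(nat \<Rightarrow> nat) \<Rightarrow> (nat \<Rightarrow> nat \<Rightarrow> complex ^ 'n) \<Rightarrow> (nat \<Rightarrow> nat \<Rightarrow> (complex ^ 'n) set) \<Rightarrow> vertex rel" where
  "children J c Q =
     {(root, (1, j)) | j. j \<in> {1..J 1}} \<union>
     {((N, j), (N + 1, i)) | N j i. 1 \<le> N \<and> j \<in> {1..J N} \<and> i \<in> {1..J (N + 1)} \<and>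
                                    radial_proj (real N * theta) (c (N + 1) i) \<in> Q N j}"

definition depth ::
  "(nat \<Rightarrow> nat) \<Rightarrow> (nat \<Rightarrow> nat \<Rightarrow> complex ^ 'n) \<Rightarrow> (nat \<Rightarrow> nat \<Rightarrow> (complex ^ 'n) set) \<Rightarrow> vertex \<Rightarrow> nat" where
  "depth J c Q \<eta> = (LEAST k. (root, \<eta>) \<in> (children J c Q \<union> (children J c Q)\<inverse>) ^^ k)"

text \<open>\<open>\<beta> \<ge> \<eta>\<close>, where \<open>p\<close> is the geodesic from the root to \<open>\<beta>\<close>.\<close>

definition above ::
  "(nat \<Rightarrow> nat) \<Rightarrow> (nat \<Rightarrow> nat \<Rightarrow> complex ^ 'n) \<Rightarrow> (nat \<Rightarrow> nat \<Rightarrow> (complex ^ 'n) set) \<Rightarrow>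
   vertex \<Rightarrow> vertex set" where
  "above J c Q \<eta> =
     {\<beta> \<in> vertices J. \<exists>p. p 0 = root \<and> p (depth J c Q \<beta>) = \<beta> \<and>
        (\<forall>i < depth J c Q \<beta>. (p i, p (Suc i)) \<in> children J c Q \<union> (children J c Q)\<inverse>) \<and>
        \<eta> \<in> p ` {..depth J c Q \<beta>}}"

definition I_star ::
  "(nat \<Rightarrow> nat) \<Rightarrow> (nat \<Rightarrow> nat \<Rightarrow> complex ^ 'n) \<Rightarrow> (nat \<Rightarrow> nat \<Rightarrow> (complex ^ 'n) set) \<Rightarrow>
   (complex ^ 'n) measure \<Rightarrow> vertex \<Rightarrow> ennreal" where
  "I_star J c Q \<mu> \<eta> = (\<integral>\<^sup>+ \<beta>. emeasure \<mu> (kube Q \<beta>) \<partial>count_space (above J c Q \<eta>))"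

definition tree_condition ::
  "(nat \<Rightarrow> nat) \<Rightarrow> (nat \<Rightarrow> nat \<Rightarrow> complex ^ 'n) \<Rightarrow> (nat \<Rightarrow> nat \<Rightarrow> (complex ^ 'n) set) \<Rightarrow>
   real \<Rightarrow> (complex ^ 'n) measure \<Rightarrow> bool" where
  "tree_condition J c Q \<sigma> \<mu> \<longleftrightarrow>
     (\<exists>C::ennreal. C < \<infinity> \<and> (\<forall>\<eta>\<in>vertices J.
        (\<integral>\<^sup>+ \<beta>. (ennreal (2 powr (\<sigma> * real (depth J c Q \<beta>))) * I_star J c Q \<mu> \<beta>)\<^sup>2
           \<partial>count_space (above J c Q \<eta>)) \<le> C * I_star J c Q \<mu> \<eta> \<and>
        C * I_star J c Q \<mu> \<eta> < \<infinity>))"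


definition R_ineq :: "real \<Rightarrow> (complex ^ 'n) measure \<Rightarrow> real \<Rightarrow> bool" where
  "R_ineq \<sigma> \<mu> \<alpha> \<longleftrightarrow>
     (\<exists>C::ennreal. C < \<infinity> \<and> (\<forall>g \<in> borel_measurable \<mu>.
        (\<integral>\<^sup>+ w \<in> ball 0 1.
           (\<integral>\<^sup>+ z. g z / ennreal (cmod (1 - cdot z w) powr ((real CARD('n) + 1 + \<alpha>) / 2 + \<sigma>)) \<partial>\<mu>)\<^sup>2 *
           ennreal ((1 + \<alpha>) * (1 - (norm w)\<^sup>2) powr \<alpha>) \<partial>lborel)
        \<le> C * (\<integral>\<^sup>+ z. (g z)\<^sup>2 \<partial>\<mu>)))"

definition in_L2 :: "'a measure \<Rightarrow> ('a \<Rightarrow> complex) \<Rightarrow> bool" where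
  "in_L2 M f \<longleftrightarrow> f \<in> borel_measurable M \<and> integrable M (\<lambda>x. (cmod (f x))\<^sup>2)"

definition L2_norm :: "'a measure \<Rightarrow> ('a \<Rightarrow> complex) \<Rightarrow> real" where
  "L2_norm M f = sqrt (\<integral>x. (cmod (f x))\<^sup>2 \<partial>M)"

definition T_kernel :: "real \<Rightarrow> complex ^ 'n \<Rightarrow> complex ^ 'n \<Rightarrow> real" where
  "T_kernel \<sigma> w z = 1 / cmod (1 - cdot z w) powr (real CARD('n) / 2 + \<sigma>)"

definition T_op :: "real \<Rightarrow> (complex ^ 'n) measure \<Rightarrow> (complex ^ 'n \<Rightarrow> complex) \<Rightarrow> complex ^ 'n \<Rightarrow> complex" where
  "T_op \<sigma> \<mu> g w = (\<integral>z. T_kernel \<sigma> w z *\<^sub>R g z \<partial>\<mu>)"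

text \<open>
  The first clause is needed because the Bochner integral in \<open>T_op\<close> is \<open>0\<close> by convention
  when it does not converge absolutely.
\<close>

definition T_bounded :: "real \<Rightarrow> (complex ^ 'n) measure \<Rightarrow> bool" where
  "T_bounded \<sigma> \<mu> \<longleftrightarrow>
     (\<exists>C::real. \<forall>g. in_L2 \<mu> g \<longrightarrow>
        (AE w in surface_measure. integrable \<mu> (\<lambda>z. T_kernel \<sigma> w z *\<^sub>R g z)) \<and>
        in_L2 surface_measure (T_op \<sigma> \<mu> g) \<and>
        L2_norm surface_measure (T_op \<sigma> \<mu> g) \<le> C * L2_norm \<mu> g)"

end

theory Submission
  imports Defs
begin

text \<open>
  The kernels are powers of \<open>|1 - cdot z w|\<close>, whose square root \<open>koranyi\<close> satisfies the triangle
  inequality on the closed ball (\<open>koranyi_triangle\<close>). All four conditions turn out to say that one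
  quadratic form is bounded on \<open>L^2(\<mu>)\<close>, namely
  \<open>tree_energy \<sigma> \<mu> g = (\<Sum>\<eta>. 2^(2 \<sigma> d(\<eta>)) (\<integral> g d\<mu> over the tent of \<eta>)^2)\<close>,
  where the tent of \<open>\<eta>\<close> is the union of the kubes \<open>\<beta> \<ge> \<eta>\<close>, so that its measure is \<open>I^* \<mu>(\<eta>)\<close>.

  Let \<open>\<nu>\<close> be a measure on the closed ball for which the set of all \<open>w\<close> with \<open>|1 - cdot z w| \<le> \<delta>\<close> has mass
  comparable to \<open>\<delta>^\<kappa>\<close> if \<open>z\<close> is at distance less than \<open>\<delta>\<close> from the sphere: surface measure with \<open>\<kappa> = n\<close>,
  or \<open>(1 - |w|^2)^\<alpha> dw\<close> with \<open>\<kappa> = n + 1 + \<alpha>\<close>. Let \<open>a = \<kappa> / 2 + \<sigma>\<close>. The square of the norm in \<open>L^2(\<nu>)\<close> of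
  \<open>\<integral> g(z) |1 - cdot z w|^(-a) d\<mu>(z)\<close> is comparable to \<open>tree_energy \<sigma> \<mu> g\<close>.
  For the upper bound (\<open>square_kernel_le_tree_energy\<close>) the square is written as a double integral in \<open>\<mu>\<close>.
  Integrating the product of two kernels in \<open>w\<close> gives the dyadic sum of \<open>2^((2 a - \<kappa>) i)\<close> over the \<open>i\<close> with
  \<open>|1 - cdot z z'| \<le> 8 / 2^i\<close>, and \<open>2 a - \<kappa> = 2 \<sigma>\<close> no longer involves \<open>\<kappa>\<close>; this is why all the operators have the
  same boundedness condition. The hypothesis \<open>\<sigma> < n / 2\<close> makes \<open>a < \<kappa>\<close>, so that these integrals converge.
  Points at distance about \<open>2^-i\<close> may be separated by the tree, but they lie in tents of that size with
  neighbouring centres, and each tent has boundedly many neighbours. For the lower bound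
  (\<open>tree_energy_le_square_kernel\<close>) the kernel dominates a sum over the tree of products of indicators, and the
  square of a sum of nonnegative terms dominates the sum of their squares.

  The tree condition is the inequality \<open>tree_energy \<sigma> \<mu> g \<le> C \<integral> g^2 d\<mu>\<close> for the indicators of
  tents, with only the terms \<open>\<beta> \<ge> \<eta>\<close> kept for the tent of \<open>\<eta>\<close>. That it implies the inequality for all \<open>g\<close> is the Carleson
  embedding theorem (\<open>carleson_embedding\<close>), proved here with a Bellman function. Finiteness of \<open>\<mu>\<close> follows by
  testing sets of finite measure.

  Kubes are defined by the Bergman metric. Along a curve \<open>ln |1 - cdot a z|\<close> grows at most four
  times as fast as the Bergman length, which places the tents in Koranyi balls; conversely straight segments show
  that points which are close in a suitable anisotropic sense have Bergman distance below \<open>1\<close>, so that the centres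
  of one level are separated and can be counted. Volumes of Koranyi caps are found by packing and covering
  Euclidean balls with translates, followed by dilation in the radial direction.
\<close>

section \<open>The Koranyi distance on the closed ball\<close>

text \<open>
  On the unit sphere this is the nonisotropic metric. It is not a metric inside the ball, where
  \<open>koranyi z z = sqrt (1 - |z|^2)\<close>.
\<close>
definition koranyi :: "complex ^ 'n \<Rightarrow> complex ^ 'n \<Rightarrow> real" where
  "koranyi z w = sqrt (cmod (1 - cdot z w))"

lemma cdot_diff_right: "cdot z (v - w) = cdot z v - cdot z w"
  by (simp add: cdot_def algebra_simps sum_subtractf)

lemma cdot_diff_left: "cdot (z - u) w = cdot z w - cdot u w"
  by (simp add: cdot_def algebra_simps sum_subtractf)

lemma cdot_add_right: "cdot z (v + w) = cdot z v + cdot z w"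
  by (simp add: cdot_def algebra_simps sum.distrib)

lemma cdot_0 [simp]: "cdot 0 w = 0" "cdot z 0 = 0"
  by (simp_all add: cdot_def)

lemma cdot_scaleR_right: "cdot z (t *\<^sub>R v) = complex_of_real t * cdot z v"
  unfolding cdot_def vector_scaleR_component
  by (simp add: sum_distrib_left scaleR_conv_of_real mult_ac)

lemma cdot_scale_right: "cdot z (t *s v) = t * cdot z v"
  by (simp add: cdot_def sum_distrib_left mult_ac)

lemma cnj_cdot: "cnj (cdot z w) = cdot w z"
  by (simp add: cdot_def mult.commute)

lemma cmod_cdot_le: "cmod (cdot z w) \<le> norm z * norm w"
proof -
  have "cmod (cdot z w) \<le> (\<Sum>i\<in>UNIV. norm (z $ i) * norm (w $ i))"
    unfolding cdot_def by (rule sum_norm_le) (simp add: norm_mult)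
  also have "\<dots> \<le> norm z * norm w"
    unfolding norm_vec_def using L2_set_mult_ineq[of "\<lambda>i. norm (z $ i)" "\<lambda>i. norm (w $ i)" UNIV] by simp
  finally show ?thesis .
qed

lemma norm_vector_scale: "norm (t *s (v :: complex ^ 'n)) = cmod t * norm v"
  unfolding norm_vec_def by (simp add: norm_mult L2_set_right_distrib)

lemma koranyi_nonneg [simp]: "0 \<le> koranyi z w"
  by (simp add: koranyi_def)

lemma koranyi_power2: "(koranyi z w)\<^sup>2 = cmod (1 - cdot z w)"
  by (simp add: koranyi_def)

lemma koranyi_commute: "koranyi z w = koranyi w z"
  unfolding koranyi_def by (metis cnj_cdot complex_cnj_diff complex_cnj_one complex_mod_cnj)

lemma koranyi_0 [simp]: "koranyi 0 w = 1" "koranyi w 0 = 1"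
  by (simp_all add: koranyi_def)

lemma norm_diff_power2: "(norm (z - w))\<^sup>2 = (norm z)\<^sup>2 + (norm w)\<^sup>2 - 2 * Re (cdot z w)"
  by (simp add: Re_cdot power2_norm_eq_inner inner_diff_left inner_diff_right inner_commute)

lemma norm_diff_plus_defect_le:
  assumes "norm z \<le> 1"
  shows "(norm (z - u))\<^sup>2 + (1 - (norm u)\<^sup>2) \<le> 2 * (koranyi z u)\<^sup>2"
proof -
  have "Re (1 - cdot z u) \<le> cmod (1 - cdot z u)" by (rule complex_Re_le_cmod)
  moreover have "(norm z)\<^sup>2 \<le> 1" using assms by (simp add: power_le_one)
  ultimately show ?thesis unfolding norm_diff_power2 koranyi_power2 by simp
qed

lemma defect_le_koranyi:
  assumes "norm z \<le> 1"
  shows "1 - (norm u)\<^sup>2 \<le> 2 * (koranyi z u)\<^sup>2"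
  using norm_diff_plus_defect_le[OF assms, of u] zero_le_power2[of "norm (z - u)"] by linarith

lemma norm_diff_le_koranyi:
  assumes "norm z \<le> 1" "norm u \<le> 1"
  shows "(norm (z - u))\<^sup>2 \<le> 2 * (koranyi z u)\<^sup>2"
  using norm_diff_plus_defect_le[OF assms(1), of u] assms(2) power_le_one[of "norm u" 2] by simp

lemma one_minus_norm_le_koranyi:
  assumes "norm z \<le> 1" "norm u \<le> 1"
  shows "1 - norm z \<le> (koranyi z u)\<^sup>2"
proof -
  have "cmod (cdot z u) \<le> norm z"
    using cmod_cdot_le[of z u] assms by (meson mult_left_le norm_ge_zero order_trans)
  then show ?thesis
    unfolding koranyi_power2 using norm_triangle_ineq2[of 1 "cdot z u"] by simp
qed

lemma cmod_one_minus_of_real: "cmod (1 - complex_of_real x) = \<bar>1 - x\<bar>"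
  by (metis norm_of_real of_real_1 of_real_diff)

lemma koranyi_self: "norm z \<le> 1 \<Longrightarrow> (koranyi z z)\<^sup>2 = 1 - (norm z)\<^sup>2"
proof -
  assume "norm z \<le> 1"
  then have "(norm z)\<^sup>2 \<le> 1" by (simp add: power_le_one)
  then show ?thesis
    unfolding koranyi_power2 cdot_self by (simp only: cmod_one_minus_of_real)
qed

lemma koranyi_le_2:
  assumes "norm z \<le> 1" "norm w \<le> 1"
  shows "(koranyi z w)\<^sup>2 \<le> 2"
proof -
  have "cmod (cdot z w) \<le> 1"
    using cmod_cdot_le[of z w] mult_le_one[OF assms(1) norm_ge_zero assms(2)] by linarith
  then show ?thesis
    unfolding koranyi_power2 using norm_triangle_ineq4[of 1 "cdot z w"] by simp
qed

lemma koranyi_pos: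
  assumes "norm z < 1" "norm w \<le> 1"
  shows "0 < koranyi z w"
  using one_minus_norm_le_koranyi[of z w] assms by (smt (verit) koranyi_nonneg power2_less_eq_zero_iff power_zero_numeral)

text \<open>
  For \<open>norm u = 1\<close> the identity
  \<open>1 - cdot z w = (1 - cdot z u) + (1 - cdot u w) + (cdot (z - u) (u - w) - (1 - |u|^2))\<close>
  and the Cauchy-Schwarz inequality suffice, since \<open>|z - u|^2 \<le> 2 |1 - cdot z u|\<close>. The general
  case is that one for the unit vector \<open>(u, sqrt (1 - |u|^2))\<close> in one more dimension.
\<close>
lemma koranyi_triangle:
  assumes z: "norm z \<le> 1" and w: "norm w \<le> 1" and u: "norm u \<le> 1"
  shows "koranyi z w \<le> koranyi z u + koranyi u w"
proof -
  let ?s = "1 - (norm u)\<^sup>2" and ?x = "norm (z - u)" and ?y = "norm (u - w)"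
  have s: "0 \<le> ?s" using u by (simp add: power_le_one)
  have eq: "1 - cdot z w = (1 - cdot z u) + (1 - cdot u w) + (cdot (z - u) (u - w) - complex_of_real ?s)"
    by (simp add: cdot_diff_left cdot_diff_right cdot_self)
  have "cmod (cdot (z - u) (u - w) - complex_of_real ?s) \<le> ?x * ?y + ?s"
    using norm_triangle_ineq4[of "cdot (z - u) (u - w)" "complex_of_real ?s"]
      cmod_cdot_le[of "z - u" "u - w"] s by (simp only: norm_of_real)
  also have "\<dots> \<le> 2 * (koranyi z u * koranyi u w)"
  proof (rule power2_le_imp_le)
    have "2 * ?x * ?y \<le> ?x\<^sup>2 + ?y\<^sup>2" by (rule sum_squares_bound)
    from mult_left_mono[OF this s]
    have "(?x * ?y + ?s)\<^sup>2 \<le> (?x\<^sup>2 + ?s) * (?y\<^sup>2 + ?s)"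
      by (simp add: power2_eq_square algebra_simps)
    also have "\<dots> \<le> (2 * (koranyi z u)\<^sup>2) * (2 * (koranyi u w)\<^sup>2)"
      using norm_diff_plus_defect_le[OF z, of u] norm_diff_plus_defect_le[OF w, of u] s
      by (intro mult_mono) (auto simp: norm_minus_commute koranyi_commute)
    finally show "(?x * ?y + ?s)\<^sup>2 \<le> (2 * (koranyi z u * koranyi u w))\<^sup>2"
      by (simp add: power_mult_distrib)
  qed simp
  finally have "cmod (1 - cdot z w) \<le> (koranyi z u)\<^sup>2 + (koranyi u w)\<^sup>2 + 2 * (koranyi z u * koranyi u w)"
    unfolding eq koranyi_power2
    using norm_triangle_ineq[of "(1 - cdot z u) + (1 - cdot u w)" "cdot (z - u) (u - w) - complex_of_real ?s"]
      norm_triangle_ineq[of "1 - cdot z u" "1 - cdot u w"] by linarith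
  then have "(koranyi z w)\<^sup>2 \<le> (koranyi z u + koranyi u w)\<^sup>2"
    by (simp add: koranyi_power2 power2_sum)
  then show ?thesis by (rule power2_le_imp_le) simp
qed

lemma continuous_on_cdot [continuous_intros]:
  "continuous_on A f \<Longrightarrow> continuous_on A g \<Longrightarrow> continuous_on A (\<lambda>x. cdot (f x) (g x))"
  unfolding cdot_def by (intro continuous_intros) auto

lemma borel_measurable_koranyi [measurable (raw)]:
  fixes f g :: "'a \<Rightarrow> complex ^ 'n"
  assumes [measurable]: "f \<in> borel_measurable M" "g \<in> borel_measurable M"
  shows "(\<lambda>x. koranyi (f x) (g x)) \<in> borel_measurable M"
proof -
  have "(\<lambda>p. koranyi (fst p) (snd p)) \<in> borel_measurable (borel :: ((complex ^ 'n) \<times> (complex ^ 'n)) measure)"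
    unfolding koranyi_def by (intro borel_measurable_continuous_onI continuous_intros)
  then have "(\<lambda>p. koranyi (fst p) (snd p)) \<in> borel_measurable (borel \<Otimes>\<^sub>M (borel :: (complex ^ 'n) measure))"
    by (simp add: borel_prod)
  from measurable_compose[OF measurable_Pair[OF assms] this] show ?thesis by simp
qed

lemma koranyi_sgn_le:
  fixes w :: "complex ^ 'n"
  assumes "norm \<zeta> = 1" "0 \<le> r" "r \<le> s" "s \<le> 1"
  shows "koranyi (s *\<^sub>R \<zeta>) (r *\<^sub>R \<zeta>) \<le> sqrt (1 - r\<^sup>2)"
proof -
  have "cdot (s *\<^sub>R \<zeta>) (r *\<^sub>R \<zeta>) = complex_of_real (s * r)"
    using assms by (simp add: cdot_scaleR cdot_scaleR_right cdot_self)
  moreover have "s * r \<le> 1" "r * r \<le> s * r"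
    using assms by (auto simp: mult_le_one mult_right_mono)
  ultimately show ?thesis
    unfolding koranyi_def by (simp add: cmod_one_minus_of_real power2_eq_square del: of_real_mult)
qed

section \<open>Comparing the Bergman metric with the Koranyi distance\<close>

lemma bounded_linear_cdot: "bounded_linear (cdot a)"
proof (rule bounded_linear_intro[where K = "norm a"])
  show "cdot a (r *\<^sub>R x) = r *\<^sub>R cdot a x" for r x
    unfolding cdot_scaleR_right scaleR_conv_of_real[of r "cdot a x"] ..
  show "norm (cdot a x) \<le> norm x * norm a" for x
    using cmod_cdot_le[of a x] by (simp add: mult.commute)
qed (rule cdot_add_right)

text \<open>
  Splitting \<open>cdot a v = cdot (a - z) v + cdot z v\<close>, the first term is controlled by the
  \<open>|v|^2\<close> part of the metric and the second by its \<open>|cdot z v|^2\<close> part. Hence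
  \<open>ln |1 - cdot a z|\<close> is Lipschitz for the Bergman metric.
\<close>
lemma cmod_cdot_le_bergman_form:
  assumes a: "norm a \<le> 1" and z: "norm z < 1"
  shows "cmod (cdot a v) \<le> 4 * (koranyi a z)\<^sup>2 * sqrt (bergman_form z v)"
proof -
  let ?d = "1 - (norm z)\<^sup>2" and ?k = "koranyi a z" and ?s = "sqrt (bergman_form z v)"
  have d: "0 < ?d" using z by (simp add: abs_square_less_1)
  have s2: "?s\<^sup>2 = bergman_form z v" using bergman_form_nonneg[OF z] by simp
  have form: "?d\<^sup>2 * ?s\<^sup>2 = ?d * (norm v)\<^sup>2 + (cmod (cdot z v))\<^sup>2"
    unfolding s2 bergman_form_def using d by simp
  have s0: "0 \<le> ?s" using bergman_form_nonneg[OF z] by simp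
  have dk: "?d \<le> 2 * ?k\<^sup>2" by (rule defect_le_koranyi[OF a])
  have 1: "cmod (cdot z v) \<le> ?d * ?s"
  proof (rule power2_le_imp_le)
    show "(cmod (cdot z v))\<^sup>2 \<le> (?d * ?s)\<^sup>2"
      unfolding power_mult_distrib form using d by simp
  qed (use d s0 in simp)
  also have "\<dots> \<le> 2 * ?k\<^sup>2 * ?s" using dk s0 by (rule mult_right_mono)
  finally have 1: "cmod (cdot z v) \<le> 2 * ?k\<^sup>2 * ?s" .
  have "?d * (norm v)\<^sup>2 \<le> ?d * (?d * ?s\<^sup>2)"
    using form by (simp add: power2_eq_square mult.assoc)
  then have v: "(norm v)\<^sup>2 \<le> ?d * ?s\<^sup>2" using d by simp
  have "norm (a - z) * norm v \<le> 2 * ?k\<^sup>2 * ?s"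
  proof (rule power2_le_imp_le)
    have "(norm (a - z) * norm v)\<^sup>2 \<le> (2 * ?k\<^sup>2) * (?d * ?s\<^sup>2)"
      unfolding power_mult_distrib using norm_diff_le_koranyi[OF a] z v by (intro mult_mono) auto
    also have "\<dots> \<le> (2 * ?k\<^sup>2) * ((2 * ?k\<^sup>2) * ?s\<^sup>2)"
      using dk by (intro mult_left_mono mult_right_mono) auto
    finally show "(norm (a - z) * norm v)\<^sup>2 \<le> (2 * ?k\<^sup>2 * ?s)\<^sup>2"
      by (simp add: power2_eq_square mult_ac)
  qed (use s0 in simp)
  then have "cmod (cdot (a - z) v) \<le> 2 * ?k\<^sup>2 * ?s"
    using cmod_cdot_le[of "a - z" v] by linarith
  then show ?thesis
    using 1 norm_triangle_ineq[of "cdot (a - z) v" "cdot z v"] by (simp add: cdot_diff_left)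
qed

text \<open>
  The function \<open>ln |1 - cdot a (\<gamma> t)|\<close> is differentiable off the break points of \<open>\<gamma>\<close>, and its derivative is
  bounded by four times the speed.
\<close>
lemma koranyi_le_path_length:
  assumes a: "norm a \<le> 1" and vp: "valid_path \<gamma>" and im: "path_image \<gamma> \<subseteq> ball 0 1"
    and L: "((\<lambda>t. sqrt (bergman_form (\<gamma> t) (vector_derivative \<gamma> (at t)))) has_integral L) {0..1}"
  shows "(koranyi a (\<gamma> 1))\<^sup>2 \<le> exp (4 * L) * (koranyi a (\<gamma> 0))\<^sup>2"
proof -
  let ?sp = "\<lambda>t. sqrt (bergman_form (\<gamma> t) (vector_derivative \<gamma> (at t)))"
  define u where "u t = 1 - cdot a (\<gamma> t)" for t
  have cont: "continuous_on {0..1} \<gamma>"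
    using vp by (simp add: valid_path_def piecewise_C1_differentiable_on_def)
  obtain S where S: "finite S" "\<And>t. t \<in> {0..1} - S \<Longrightarrow> \<gamma> differentiable at t"
    using vp by (auto simp: valid_path_def piecewise_C1_differentiable_on_def C1_differentiable_on_eq)
  have lt1: "norm (\<gamma> t) < 1" if "t \<in> {0..1}" for t
    using im that by (auto simp: path_image_def image_subset_iff)
  have u: "cmod (u t) = (koranyi a (\<gamma> t))\<^sup>2" "u t \<noteq> 0" if "t \<in> {0..1}" for t
  proof -
    show "cmod (u t) = (koranyi a (\<gamma> t))\<^sup>2" by (simp add: u_def koranyi_power2)
    then show "u t \<noteq> 0" using koranyi_pos[OF lt1[OF that] a] by (auto simp: koranyi_commute)
  qed
  define f' where "f' t = (- cdot a (vector_derivative \<gamma> (at t)) \<bullet> sgn (u t)) / cmod (u t)" for t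
  have d: "((\<lambda>t. ln (cmod (u t))) has_vector_derivative f' t) (at t)" if t: "t \<in> {0<..<1} - S" for t
  proof -
    have t': "t \<in> {0..1} - S" using t by auto
    have "(\<gamma> has_vector_derivative vector_derivative \<gamma> (at t)) (at t)"
      using S(2)[OF t'] by (simp add: vector_derivative_works)
    from bounded_linear.has_vector_derivative[OF bounded_linear_cdot this, of a]
    have "(u has_vector_derivative - cdot a (vector_derivative \<gamma> (at t))) (at t)"
      unfolding u_def by (auto intro!: derivative_eq_intros)
    then have "((\<lambda>t. norm (u t)) has_derivative
            (\<lambda>h. (h *\<^sub>R - cdot a (vector_derivative \<gamma> (at t))) \<bullet> sgn (u t))) (at t)"
      unfolding has_vector_derivative_def
      by (rule has_derivative_compose[OF _ has_derivative_norm]) (use u(2) t' in auto)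
    then have "((\<lambda>t. norm (u t)) has_real_derivative
            (- cdot a (vector_derivative \<gamma> (at t)) \<bullet> sgn (u t))) (at t)"
      unfolding has_field_derivative_def by (rule has_derivative_eq_rhs) (auto simp: mult_ac)
    from DERIV_chain2[OF DERIV_ln_divide this] show ?thesis
      using u(2)[of t] t' by (simp add: has_real_derivative_iff_has_vector_derivative f'_def)
  qed
  have c: "continuous_on {0..1} (\<lambda>t. ln (cmod (u t)))"
    unfolding u_def
    by (intro continuous_intros cont) (use u(2) in \<open>auto simp: u_def\<close>)
  have I: "(f' has_integral ln (cmod (u 1)) - ln (cmod (u 0))) {0..1}"
    by (rule fundamental_theorem_of_calculus_interior_strong[OF S(1) _ d c]) auto
  have "ln (cmod (u 1)) - ln (cmod (u 0)) \<le> 4 * L"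
  proof (rule has_integral_le[OF I has_integral_mult_right[OF L]])
    fix t :: real assume t: "t \<in> {0..1}"
    let ?v = "vector_derivative \<gamma> (at t)"
    have "- cdot a ?v \<bullet> sgn (u t) \<le> cmod (cdot a ?v) * cmod (sgn (u t))"
      using norm_cauchy_schwarz[of "- cdot a ?v" "sgn (u t)"] by simp
    also have "\<dots> \<le> 4 * ?sp t * cmod (u t)"
      using cmod_cdot_le_bergman_form[OF a lt1[OF t], of ?v] u[OF t] by (simp add: norm_sgn mult_ac)
    finally show "f' t \<le> 4 * ?sp t"
      unfolding f'_def by (rule mult_imp_div_pos_le[rotated]) (simp add: u(2)[OF t])
  qed
  then have "ln (cmod (u 1)) \<le> ln (exp (4 * L) * cmod (u 0))"
    using u(2)[of 0] by (simp add: ln_mult)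
  then have "cmod (u 1) \<le> exp (4 * L) * cmod (u 0)"
    using u(2)[of 0] u(2)[of 1] by (subst (asm) ln_le_cancel_iff) auto
  then show ?thesis using u(1)[of 0] u(1)[of 1] by simp
qed

abbreviation path_lengths :: "complex ^ 'n \<Rightarrow> complex ^ 'n \<Rightarrow> real set" where
  "path_lengths z w \<equiv> {L. \<exists>\<gamma>. valid_path \<gamma> \<and> path_image \<gamma> \<subseteq> ball 0 1 \<and> pathstart \<gamma> = z \<and> pathfinish \<gamma> = w \<and>
     ((\<lambda>t. sqrt (bergman_form (\<gamma> t) (vector_derivative \<gamma> (at t)))) has_integral L) {0..1}}"

lemma bdd_below_path_lengths:
  fixes z w :: "complex ^ 'n"
  shows "bdd_below (path_lengths z w)"
proof (rule bdd_belowI[of _ 0])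
  fix L assume "L \<in> path_lengths z w"
  then obtain \<gamma> :: "real \<Rightarrow> complex ^ 'n" where "path_image \<gamma> \<subseteq> ball 0 1"
    "((\<lambda>t. sqrt (bergman_form (\<gamma> t) (vector_derivative \<gamma> (at t)))) has_integral L) {0..1}"
    unfolding mem_Collect_eq by blast
  then show "0 \<le> L"
    by (elim has_integral_nonneg) (auto simp: path_image_def image_subset_iff intro!: bergman_form_nonneg)
qed

text \<open>
  This also shows that every two points of the ball are joined by a path with a length, so that the infimum defining
  \<open>bergman_dist\<close> is not the infimum of the empty set.
\<close>
lemma segment_path_length:
  fixes c v :: "complex ^ 'n"
  assumes c: "c \<in> ball 0 1" and w: "c + v \<in> ball 0 1"
  shows "integral {0..1} (\<lambda>t. sqrt (bergman_form (c + t *\<^sub>R v) v)) \<in> path_lengths c (c + v)"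
    and "(\<lambda>t. sqrt (bergman_form (c + t *\<^sub>R v) v)) integrable_on {0..1}"
    and "\<And>t. t \<in> {0..1} \<Longrightarrow> norm (c + t *\<^sub>R v) < 1"
proof -
  let ?\<gamma> = "\<lambda>t. c + t *\<^sub>R v"
  have seg: "?\<gamma> t \<in> ball 0 1" if "t \<in> {0..1}" for t
  proof -
    have "(1 - t) *\<^sub>R c + t *\<^sub>R (c + v) \<in> ball 0 1"
      using c w that by (intro convexD[OF convex_ball]) auto
    then show ?thesis by (simp add: algebra_simps)
  qed
  then show "\<And>t. t \<in> {0..1} \<Longrightarrow> norm (?\<gamma> t) < 1" by simp
  have nz: "(1 - (norm (?\<gamma> t))\<^sup>2)\<^sup>2 \<noteq> 0" if "t \<in> {0..1}" for t
    using seg[OF that] by (auto simp: power2_eq_1_iff) (smt (verit) norm_ge_zero)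
  show int: "(\<lambda>t. sqrt (bergman_form (?\<gamma> t) v)) integrable_on {0..1}"
    unfolding bergman_form_def
    by (intro integrable_continuous_real continuous_intros ballI nz)
  have vd: "vector_derivative ?\<gamma> (at t) = v" for t
    by (rule vector_derivative_at) (auto intro!: derivative_eq_intros)
  have "valid_path ?\<gamma>"
    unfolding valid_path_def
    by (rule C1_differentiable_imp_piecewise)
       (auto simp: C1_differentiable_on_def intro!: exI[of _ "\<lambda>_. v"] derivative_eq_intros)
  moreover have "path_image ?\<gamma> \<subseteq> ball 0 1"
    using seg by (auto simp: path_image_def)
  ultimately show "integral {0..1} (\<lambda>t. sqrt (bergman_form (?\<gamma> t) v)) \<in> path_lengths c (c + v)"
    using integrable_integral[OF int]
    by (auto simp: pathstart_def pathfinish_def vd intro!: exI[of _ ?\<gamma>])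
qed

text \<open>
  Integrating the Lipschitz bound along curves. The point \<open>a\<close> may lie on the sphere, at infinite
  Bergman distance.
\<close>
lemma koranyi_le_bergman_dist:
  assumes a: "norm a \<le> 1" and z: "z \<in> ball 0 1" and w: "w \<in> ball 0 1" and d: "bergman_dist z w < r"
  shows "(koranyi a w)\<^sup>2 \<le> exp (4 * r) * (koranyi a z)\<^sup>2"
proof -
  have "path_lengths z w \<noteq> {}"
    using segment_path_length(1)[of z "w - z"] z w by auto
  then obtain L where L: "L \<in> path_lengths z w" "L < r"
    using cInf_lessD[OF _ d[unfolded bergman_dist_def]] by blast
  then have "(koranyi a w)\<^sup>2 \<le> exp (4 * L) * (koranyi a z)\<^sup>2"
    using koranyi_le_path_length[OF a] by (auto simp: pathstart_def pathfinish_def)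
  also have "\<dots> \<le> exp (4 * r) * (koranyi a z)\<^sup>2"
    using L(2) by (intro mult_right_mono) auto
  finally show ?thesis .
qed

text \<open>
  Conversely a Euclidean polydisc of radius \<open>sqrt d / 10\<close> in the complex tangential directions and
  \<open>d / 10\<close> in the direction of \<open>c\<close>, where \<open>d = 1 - |c|^2\<close>, lies in the Bergman ball of
  radius \<open>1\<close>: straight segments in it are short.
\<close>
lemma bergman_dist_less_1:
  fixes c v :: "complex ^ 'n"
  assumes c: "c \<in> ball 0 1" and w: "c + v \<in> ball 0 1"
    and v: "(norm v)\<^sup>2 \<le> (1 - (norm c)\<^sup>2) / 100" and cv: "cmod (cdot c v) \<le> (1 - (norm c)\<^sup>2) / 10"
  shows "bergman_dist c (c + v) < 1"
proof -
  let ?d = "1 - (norm c)\<^sup>2"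
  have d: "0 < ?d" using c by (simp add: abs_square_less_1)
  note seg = segment_path_length[OF c w]
  have "bergman_form (c + t *\<^sub>R v) v \<le> (1 / 2)\<^sup>2" if t: "t \<in> {0..1}" for t
  proof -
    let ?z = "c + t *\<^sub>R v"
    have tt: "t * t \<le> 1" using t by (simp add: mult_le_one)
    have "\<bar>c \<bullet> v\<bar> \<le> ?d / 10"
      using abs_Re_le_cmod[of "cdot c v"] cv by (simp add: Re_cdot)
    then have tcv: "t * (c \<bullet> v) \<le> ?d / 10"
      using t by (smt (verit) atLeastAtMost_iff mult_left_le_one_le mult_nonneg_nonpos)
    have tv: "t * t * (norm v)\<^sup>2 \<le> (norm v)\<^sup>2" using tt by (simp add: mult_left_le_one_le)
    have "(norm ?z)\<^sup>2 = (norm c)\<^sup>2 + 2 * (t * (c \<bullet> v)) + t * t * (norm v)\<^sup>2"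
      unfolding power2_norm_eq_inner
      by (simp add: inner_add_left inner_add_right inner_commute algebra_simps)
    then have e: "79 / 100 * ?d \<le> 1 - (norm ?z)\<^sup>2" using tcv tv v by simp
    have "cdot ?z v = cdot c v + complex_of_real (t * (norm v)\<^sup>2)"
      using cdot_diff_left[of ?z c v] by (simp add: cdot_scaleR cdot_self)
    then have "cmod (cdot ?z v) \<le> cmod (cdot c v) + \<bar>t * (norm v)\<^sup>2\<bar>"
      using norm_triangle_ineq[of "cdot c v" "complex_of_real (t * (norm v)\<^sup>2)"] by (simp only: norm_of_real)
    moreover have "\<bar>t * (norm v)\<^sup>2\<bar> \<le> (norm v)\<^sup>2"
      using t by (simp add: abs_mult mult_left_le_one_le)
    ultimately have "cmod (cdot ?z v) \<le> 11 / 100 * ?d" using v cv by simp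
    then have cz: "(cmod (cdot ?z v))\<^sup>2 \<le> (11 / 100 * ?d)\<^sup>2" by (rule power_mono) simp
    let ?e = "1 - (norm ?z)\<^sup>2"
    have e0: "0 < ?e" using e d by simp
    have "?e * (norm v)\<^sup>2 + (cmod (cdot ?z v))\<^sup>2 \<le> ?e * (?d / 100) + (11 / 100 * ?d)\<^sup>2"
      using v cz e0 by (intro add_mono mult_left_mono) auto
    also have "\<dots> \<le> ?e * (?e / 79) + (11 / 79 * ?e)\<^sup>2"
      using e d e0 by (intro add_mono mult_left_mono power_mono) auto
    also have "\<dots> \<le> (1 / 2)\<^sup>2 * ?e\<^sup>2"
    proof -
      have "x * (x / 79) + (11 / 79 * x)\<^sup>2 \<le> (1 / 2)\<^sup>2 * x\<^sup>2" for x :: real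
        using zero_le_square[of x] unfolding power2_eq_square by (simp add: algebra_simps)
      then show ?thesis .
    qed
    finally show ?thesis
      unfolding bergman_form_def using e0 by (simp add: divide_le_eq)
  qed
  then have "sqrt (bergman_form (c + t *\<^sub>R v) v) \<le> 1 / 2" if "t \<in> {0..1}" for t
    using that real_sqrt_le_mono[of _ "(1/2)\<^sup>2"] by fastforce
  then have "integral {0..1} (\<lambda>t. sqrt (bergman_form (c + t *\<^sub>R v) v)) \<le> integral {0..1} (\<lambda>t::real. 1 / 2 :: real)"
    by (intro integral_le seg(2)) auto
  moreover have "bergman_dist c (c + v) \<le> integral {0..1} (\<lambda>t. sqrt (bergman_form (c + t *\<^sub>R v) v))"
    unfolding bergman_dist_def by (rule cInf_lower[OF seg(1) bdd_below_path_lengths])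
  ultimately show ?thesis by simp
qed

lemma separated_card_bound:
  fixes R e :: real
  assumes "0 < e"
  shows "\<exists>M. \<forall>X :: 'a::euclidean_space set.
    X \<subseteq> cball 0 R \<and> (\<forall>x\<in>X. \<forall>y\<in>X. x \<noteq> y \<longrightarrow> e \<le> dist x y) \<longrightarrow> card X \<le> M"
proof -
  have "compact (cball (0::'a) R)" by simp
  then obtain K where K: "finite K" "cball (0::'a) R \<subseteq> (\<Union>x\<in>K. ball x (e / 2))"
    using assms compact_eq_totally_bounded[of "cball (0::'a) R"] half_gt_zero by metis
  show ?thesis
  proof (intro exI[of _ "card K"] allI impI)
    fix X :: "'a set"
    assume X: "X \<subseteq> cball 0 R \<and> (\<forall>x\<in>X. \<forall>y\<in>X. x \<noteq> y \<longrightarrow> e \<le> dist x y)"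
    then have "\<forall>x\<in>X. \<exists>k\<in>K. dist k x < e / 2" using K(2) by fastforce
    then obtain f where f: "\<And>x. x \<in> X \<Longrightarrow> f x \<in> K \<and> dist (f x) x < e / 2" by metis
    have "inj_on f X"
    proof (rule inj_onI, rule ccontr)
      fix x y assume "x \<in> X" "y \<in> X" "f x = f y" "x \<noteq> y"
      moreover have "dist x y \<le> dist (f x) x + dist (f x) y" by (metis dist_commute dist_triangle)
      ultimately show False using X f[of x] f[of y] by force
    qed
    then show "card X \<le> card K" by (rule card_inj_on_le) (use f K(1) in auto)
  qed
qed

text \<open>
  After the anisotropic scaling \<open>x \<mapsto> ((x - c) / sqrt d, cdot c (x - c) / d)\<close> the points become
  uniformly separated points of a bounded set of fixed size.
\<close>
lemma bergman_separated_card_bound: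
  assumes "0 \<le> A"
  shows "\<exists>M. \<forall>(c :: complex ^ 'n) X. c \<in> ball 0 1 \<and> X \<subseteq> ball 0 1 \<and>
     (\<forall>x\<in>X. 1 - (norm x)\<^sup>2 = 1 - (norm c)\<^sup>2 \<and> (koranyi c x)\<^sup>2 \<le> A\<^sup>2 * (1 - (norm c)\<^sup>2)) \<and>
     (\<forall>x\<in>X. \<forall>y\<in>X. x \<noteq> y \<longrightarrow> 1 \<le> bergman_dist x y) \<longrightarrow> card X \<le> M"
proof -
  (* The separation of the scaled points: moving the base point from c to x costs at most the factor
     1 + 2 A in the complex normal direction, and the bound to be contradicted is a tenth. *)
  define e where "e = 1 / (10 * (1 + 2 * A))"
  have e: "0 < e" "e \<le> 1 / 10" "e * (1 + 2 * A) = 1 / 10"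
    using assms by (auto simp: e_def field_simps)
  define R where "R = 2 * A + (A\<^sup>2 + 1)"
  obtain M where M: "\<And>X :: ((complex ^ 'n) \<times> complex) set.
      X \<subseteq> cball 0 R \<Longrightarrow> (\<And>x y. x \<in> X \<Longrightarrow> y \<in> X \<Longrightarrow> x \<noteq> y \<Longrightarrow> e \<le> dist x y) \<Longrightarrow> card X \<le> M"
    using separated_card_bound[OF e(1), of R] by meson
  show ?thesis
  proof (intro exI[of _ M] allI impI, elim conjE)
    fix c :: "complex ^ 'n" and X
    assume c: "c \<in> ball 0 1" and X: "X \<subseteq> ball 0 1"
      and near: "\<forall>x\<in>X. 1 - (norm x)\<^sup>2 = 1 - (norm c)\<^sup>2 \<and> (koranyi c x)\<^sup>2 \<le> A\<^sup>2 * (1 - (norm c)\<^sup>2)"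
      and sep: "\<forall>x\<in>X. \<forall>y\<in>X. x \<noteq> y \<longrightarrow> 1 \<le> bergman_dist x y"
    define d where "d = 1 - (norm c)\<^sup>2"
    have d: "0 < d" using c by (simp add: abs_square_less_1 d_def)
    define \<Phi> where "\<Phi> x = ((1 / sqrt d) *\<^sub>R (x - c), (1 / d) *\<^sub>R cdot c (x - c))" for x
    have normX: "norm x < 1" if "x \<in> X" for x using X that by auto
    have near': "norm (x - c) \<le> 2 * A * sqrt d" if x: "x \<in> X" for x
    proof (rule power2_le_imp_le)
      have "(norm (x - c))\<^sup>2 \<le> 2 * (koranyi x c)\<^sup>2"
        using norm_diff_le_koranyi[of x c] normX[OF x] c by simp
      also have "\<dots> \<le> 2 * (A\<^sup>2 * d)"
        using near x by (simp add: koranyi_commute[of x] d_def)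
      also have "\<dots> \<le> 4 * (A\<^sup>2 * d)" using d by simp
      finally show "(norm (x - c))\<^sup>2 \<le> (2 * A * sqrt d)\<^sup>2"
        using d by (simp add: power_mult_distrib)
    qed (use assms d in simp)
    have \<Phi>: "\<Phi> x - \<Phi> y = ((1 / sqrt d) *\<^sub>R (x - y), (1 / d) *\<^sub>R cdot c (x - y))" for x y
      by (simp add: \<Phi>_def cdot_diff_right algebra_simps)
    have far: "e \<le> dist (\<Phi> x) (\<Phi> y)" if x: "x \<in> X" and y: "y \<in> X" and xy: "x \<noteq> y" for x y
    proof (rule ccontr)
      assume "\<not> e \<le> dist (\<Phi> x) (\<Phi> y)"
      then have n: "norm (\<Phi> y - \<Phi> x) \<le> e" by (simp add: dist_norm norm_minus_commute)
      have "norm ((1 / sqrt d) *\<^sub>R (y - x)) \<le> e" "norm ((1 / d) *\<^sub>R cdot c (y - x)) \<le> e"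
        using order_trans[OF norm_fst_le n[unfolded \<Phi>]] order_trans[OF norm_snd_le n[unfolded \<Phi>]] .
      then have 1: "norm (y - x) \<le> e * sqrt d" and 2: "cmod (cdot c (y - x)) \<le> e * d"
        using d by (simp_all add: divide_le_eq)
      have "cmod (cdot (x - c) (y - x)) \<le> (2 * A * sqrt d) * (e * sqrt d)"
        by (rule order_trans[OF cmod_cdot_le mult_mono]) (use near'[OF x] 1 assms d in auto)
      also have "\<dots> = 2 * A * e * d" using d by simp
      finally have "cmod (cdot x (y - x)) \<le> 2 * A * e * d + e * d"
        using 2 norm_triangle_ineq[of "cdot (x - c) (y - x)" "cdot c (y - x)"] by (simp add: cdot_diff_left)
      also have "\<dots> = (e * (1 + 2 * A)) * d" by (simp add: algebra_simps)
      finally have 3: "cmod (cdot x (y - x)) \<le> d / 10" unfolding e(3) by simp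
      have "(norm (y - x))\<^sup>2 \<le> (e * sqrt d)\<^sup>2" using 1 by (rule power_mono) simp
      also have "\<dots> = e\<^sup>2 * d" using d by (simp add: power_mult_distrib)
      also have "\<dots> \<le> (1 / 10)\<^sup>2 * d" using e(1,2) d by (intro mult_right_mono power_mono) auto
      finally have "(norm (y - x))\<^sup>2 \<le> d / 100" by (simp add: power2_eq_square)
      then have "bergman_dist x (x + (y - x)) < 1"
        using 3 near x y X by (intro bergman_dist_less_1) (auto simp: d_def)
      then show False using sep x y xy by force
    qed
    have "norm (\<Phi> x) \<le> R" if x: "x \<in> X" for x
    proof -
      have "norm (\<Phi> x) \<le> norm ((1 / sqrt d) *\<^sub>R (x - c)) + norm ((1 / d) *\<^sub>R cdot c (x - c))"
        unfolding \<Phi>_def norm_Pair by (rule sqrt_add_le_add_sqrt[THEN order_trans]) simp_all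
      moreover have "norm ((1 / sqrt d) *\<^sub>R (x - c)) \<le> 2 * A"
        using near'[OF x] d by (simp add: divide_le_eq)
      moreover have "norm ((1 / d) *\<^sub>R cdot c (x - c)) \<le> A\<^sup>2 + 1"
      proof -
        have "cdot c (x - c) = complex_of_real d - (1 - cdot c x)"
          by (simp add: cdot_diff_right cdot_self d_def)
        then have "cmod (cdot c (x - c)) \<le> \<bar>d\<bar> + (koranyi c x)\<^sup>2"
          using norm_triangle_ineq4[of "complex_of_real d" "1 - cdot c x"]
          by (simp only: norm_of_real koranyi_power2)
        also have "\<dots> \<le> (A\<^sup>2 + 1) * d"
          using near x d by (auto simp: d_def algebra_simps)
        finally show ?thesis using d by (simp add: divide_le_eq)
      qed
      ultimately show ?thesis unfolding R_def by linarith
    qed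
    moreover have "e \<le> dist p q" if "p \<in> \<Phi> ` X" "q \<in> \<Phi> ` X" "p \<noteq> q" for p q
      using that far by blast
    ultimately have "card (\<Phi> ` X) \<le> M" by (intro M) auto
    moreover have "inj_on \<Phi> X"
      using far e(1) by (intro inj_onI) (metis dist_self linorder_not_le)
    ultimately show "card X \<le> M" by (simp add: card_image)
  qed
qed

section \<open>Volumes of cones over Koranyi caps\<close>

definition cone_shell :: "real \<Rightarrow> real \<Rightarrow> (complex ^ 'n) set \<Rightarrow> (complex ^ 'n) set" where
  "cone_shell r s E = {w. w \<noteq> 0 \<and> r \<le> norm w \<and> norm w < s \<and> sgn w \<in> E}"

definition koranyi_cap :: "complex ^ 'n \<Rightarrow> real \<Rightarrow> (complex ^ 'n) set" where
  "koranyi_cap \<zeta> \<delta> = {u. norm u = 1 \<and> (koranyi \<zeta> u)\<^sup>2 \<le> \<delta>}"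

abbreviation cone_volume :: "(complex ^ 'n) set \<Rightarrow> real" where
  "cone_volume E \<equiv> measure lborel (cone_shell 0 1 E)"

lemma koranyi_cap_sets [measurable]: "koranyi_cap \<zeta> \<delta> \<in> sets borel"
  unfolding koranyi_cap_def by measurable

lemma measurable_sgn_vec [measurable]: "(sgn :: complex ^ 'n \<Rightarrow> complex ^ 'n) \<in> borel_measurable borel"
  unfolding sgn_div_norm by measurable

lemma cone_shell_sets [measurable]:
  assumes [measurable]: "E \<in> sets borel"
  shows "cone_shell r s E \<in> sets borel"
  unfolding cone_shell_def by measurable

lemma emeasure_cone_shell_finite:
  fixes E :: "(complex ^ 'n) set"
  assumes "E \<in> sets borel"
  shows "emeasure lborel (cone_shell r s E) < \<infinity>"
proof -
  have "emeasure lborel (cone_shell r s E) \<le> emeasure lborel (ball (0 :: complex ^ 'n) s)"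
    using assms by (intro emeasure_mono) (auto simp: cone_shell_def)
  also have "\<dots> < \<infinity>" by (rule emeasure_bounded_finite) simp
  finally show ?thesis .
qed

lemma fmeasurable_cone_shell:
  assumes "E \<in> sets borel" shows "cone_shell r s E \<in> fmeasurable lborel"
  using emeasure_cone_shell_finite[OF assms] assms by (intro fmeasurableI) auto

lemma DIM_complex_vec: "DIM(complex ^ 'n) = 2 * CARD('n)"
  by simp

text \<open>
  Dilation by \<open>s\<close> multiplies the volume by \<open>s^(2 n)\<close>; this replaces integration in polar coordinates.
\<close>
lemma measure_cone_shell_0:
  fixes E :: "(complex ^ 'n) set"
  assumes [measurable]: "E \<in> sets borel" and s: "0 < s"
  shows "measure lborel (cone_shell 0 s E) = s ^ (2 * CARD('n)) * cone_volume E"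
proof -
  have "cone_shell 0 s E = (\<lambda>x. s *\<^sub>R x + 0) ` cone_shell 0 1 E"
  proof (intro subset_antisym subsetI)
    fix w assume w: "w \<in> cone_shell 0 s E"
    then have "(1 / s) *\<^sub>R w \<in> cone_shell 0 1 E" using s
      by (auto simp: cone_shell_def sgn_scaleR)
    moreover have "w = s *\<^sub>R ((1 / s) *\<^sub>R w) + 0" using s by simp
    ultimately show "w \<in> (\<lambda>x. s *\<^sub>R x + 0) ` cone_shell 0 1 E" by (rule image_eqI[rotated])
  qed (use s in \<open>auto simp: cone_shell_def sgn_scaleR\<close>)
  then have "measure lebesgue (cone_shell 0 s E) = \<bar>s\<bar> ^ DIM(complex ^ 'n) * measure lebesgue (cone_shell 0 1 E)"
    by (simp only: measure_lebesgue_affine)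
  then show ?thesis using s by (simp add: measure_completion mult.commute)
qed

lemma measure_cone_shell:
  fixes E :: "(complex ^ 'n) set"
  assumes [measurable]: "E \<in> sets borel" and rs: "0 \<le> r" "r \<le> s" "0 < s"
  shows "measure lborel (cone_shell r s E) = (s ^ (2 * CARD('n)) - r ^ (2 * CARD('n))) * cone_volume E"
proof (cases "r = 0")
  case False
  then have "measure lborel (cone_shell 0 s E - cone_shell 0 r E) =
      measure lborel (cone_shell 0 s E) - measure lborel (cone_shell 0 r E)"
    using rs by (intro measure_Diff emeasure_cone_shell_finite[THEN less_imp_neq]) (auto simp: cone_shell_def, measurable)
  moreover have "cone_shell 0 s E - cone_shell 0 r E = cone_shell r s E"
    by (auto simp: cone_shell_def)
  ultimately show ?thesis
    using measure_cone_shell_0[of E s] measure_cone_shell_0[of E r] rs False by (simp add: algebra_simps)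
qed (use measure_cone_shell_0[of E s] rs in \<open>simp add: power_0_left\<close>)

lemma measure_translate:
  fixes X :: "'a::euclidean_space set"
  assumes "X \<in> sets borel"
  shows "(+) t ` X \<in> sets borel" and "emeasure lborel ((+) t ` X) = emeasure lborel X"
proof -
  have eq: "(+) t ` X = (+) (- t) -` X \<inter> space borel" by (force simp: image_iff)
  show "(+) t ` X \<in> sets borel" unfolding eq by (rule measurable_sets[OF _ assms]) simp
  have "emeasure lborel X = emeasure (distr lborel borel ((+) (- t))) X" by (simp only: lborel_distr_plus)
  also have "\<dots> = emeasure lborel ((+) t ` X)" unfolding eq using assms by (subst emeasure_distr) auto
  finally show "emeasure lborel ((+) t ` X) = emeasure lborel X" ..
qed

lemma card_times_measure_le_ball:
  fixes X :: "'a::euclidean_space set"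
  assumes X: "X \<in> sets borel" and T: "finite T" "disjoint_family_on (\<lambda>t. (+) (v t) ` X) T"
    and R: "\<And>t x. t \<in> T \<Longrightarrow> x \<in> X \<Longrightarrow> v t + x \<in> cball p R" "0 \<le> R"
  shows "real (card T) * measure lborel X \<le> R ^ DIM('a) * measure lborel (ball (0::'a) 1)"
proof (cases "T = {}")
  case False
  then obtain t where t: "t \<in> T" by auto
  have "bounded ((+) (v t) ` X)" by (rule bounded_subset[OF bounded_cball]) (use R(1)[OF t] in auto)
  from bounded_translation[OF this, of "- v t"] have "bounded X" by (simp add: image_image)
  then have fin: "emeasure lborel X < \<infinity>" by (rule emeasure_bounded_finite)
  have "of_nat (card T) * emeasure lborel X = (\<Sum>t\<in>T. emeasure lborel ((+) (v t) ` X))"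
    using X by (simp add: measure_translate)
  also have "\<dots> = emeasure lborel (\<Union>t\<in>T. (+) (v t) ` X)"
    using T X by (intro sum_emeasure) (auto simp: measure_translate)
  also have "\<dots> \<le> emeasure lborel (cball p R)"
    using R by (intro emeasure_mono) auto
  finally have "of_nat (card T) * emeasure lborel X \<le> emeasure lborel (cball p R)" .
  then have "real (card T) * measure lborel X \<le> measure lborel (cball p R)"
    using fin emeasure_bounded_finite[OF bounded_cball, of p R]
    by (simp add: emeasure_eq_ennreal_measure ennreal_of_nat_eq_real_of_nat flip: ennreal_mult)
  also have "\<dots> = R ^ DIM('a) * measure lborel (ball (0::'a) 1)"
    using R(2) by (simp add: content_cball content_ball)
  finally show ?thesis .
qed (use R in simp)

lemma ball_le_card_times_measure:
  fixes X :: "'a::euclidean_space set"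
  assumes X: "X \<in> sets borel" "bounded X" and T: "finite T"
    and cover: "ball p R \<subseteq> (\<Union>t\<in>T. (+) (v t) ` X)" and R: "0 \<le> R"
  shows "R ^ DIM('a) * measure lborel (ball (0::'a) 1) \<le> real (card T) * measure lborel X"
proof -
  have fin: "emeasure lborel X < \<infinity>" using X(2) by (rule emeasure_bounded_finite)
  have "emeasure lborel (ball p R) \<le> emeasure lborel (\<Union>t\<in>T. (+) (v t) ` X)"
    using cover T X by (intro emeasure_mono) (auto simp: measure_translate intro!: sets.finite_UN)
  also have "\<dots> \<le> (\<Sum>t\<in>T. emeasure lborel ((+) (v t) ` X))"
    using T X by (intro emeasure_subadditive_finite) (auto simp: measure_translate)
  also have "\<dots> = of_nat (card T) * emeasure lborel X"
    using X by (simp add: measure_translate)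
  finally have "measure lborel (ball p R) \<le> real (card T) * measure lborel X"
    using fin emeasure_bounded_finite[OF bounded_ball, of p R]
    by (simp add: emeasure_eq_ennreal_measure ennreal_of_nat_eq_real_of_nat flip: ennreal_mult)
  then show ?thesis using R by (simp add: content_ball mult.commute)
qed

text \<open>
  About \<open>1 / \<delta>\<close> disjoint translates of the set in the complex direction \<open>\<zeta>\<close> fit into a Euclidean
  ball of radius comparable to \<open>sqrt \<delta>\<close>, whose volume is comparable to \<open>\<delta>^n\<close>.
\<close>
lemma measure_koranyi_ball_le:
  fixes \<zeta> :: "complex ^ 'n"
  assumes \<zeta>: "norm \<zeta> = 1" and \<delta>: "0 < \<delta>" "\<delta> \<le> 1"
  shows "measure lborel {w \<in> ball 0 1. (koranyi \<zeta> w)\<^sup>2 \<le> \<delta>} \<le>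
    34 ^ (2 * CARD('n)) * measure lborel (ball (0 :: complex ^ 'n) 1) * \<delta> ^ (CARD('n) + 1)"
proof -
  let ?X = "{w \<in> ball 0 1. (koranyi \<zeta> w)\<^sup>2 \<le> \<delta>}" and ?q = "sqrt \<delta>"
  have q: "0 < ?q" "?q \<le> 1" "?q * ?q = \<delta>" using \<delta> by auto
  define m where "m = nat \<lceil>1 / ?q\<rceil>"
  have m: "1 / ?q \<le> real m" "real m \<le> 2 / ?q"
  proof -
    have "1 \<le> 1 / ?q" using q by simp
    then show "1 / ?q \<le> real m" "real m \<le> 2 / ?q" unfolding m_def by linarith+
  qed
  (* The map x -> cdot zeta x sends the set into a disc of diameter at most 2 delta, and the translates
     move this disc by multiples of 8 delta. *)
  define v where "v = (\<lambda>(j::nat, k::nat). (8 * \<delta> * Complex (real j) (real k)) *s \<zeta>)"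
  have v: "cdot \<zeta> (v t + x) = 8 * \<delta> * Complex (real (fst t)) (real (snd t)) + cdot \<zeta> x" for t x
    using \<zeta> by (simp add: v_def case_prod_beta cdot_add_right cdot_scale_right cdot_self)
  have X: "?X \<in> sets borel" by measurable
  have "real (card ({..<m} \<times> {..<m})) * measure lborel ?X \<le>
    (34 * ?q) ^ DIM(complex ^ 'n) * measure lborel (ball (0 :: complex ^ 'n) 1)"
  proof (rule card_times_measure_le_ball[OF X])
    show "disjoint_family_on (\<lambda>t. (+) (v t) ` ?X) ({..<m} \<times> {..<m})"
    proof (unfold disjoint_family_on_def, intro ballI impI, rule ccontr)
      fix s t :: "nat \<times> nat" assume st: "s \<noteq> t" "(+) (v s) ` ?X \<inter> (+) (v t) ` ?X \<noteq> {}"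
      then obtain x y where x: "x \<in> ?X" and y: "y \<in> ?X" and xy: "v s + x = v t + y" by auto
      let ?d = "Complex (real (fst s)) (real (snd s)) - Complex (real (fst t)) (real (snd t))"
      have "8 * \<delta> * ?d = (1 - cdot \<zeta> x) - (1 - cdot \<zeta> y)"
        using arg_cong[OF xy, of "cdot \<zeta>"] unfolding v by (simp add: algebra_simps)
      then have "cmod (8 * \<delta> * ?d) \<le> \<delta> + \<delta>"
        using x y norm_triangle_ineq4[of "1 - cdot \<zeta> x" "1 - cdot \<zeta> y"] by (simp add: koranyi_power2)
      then have "cmod ?d \<le> 1 / 4" using \<delta> by (simp add: norm_mult)
      then have "\<bar>real (fst s) - real (fst t)\<bar> < 1" "\<bar>real (snd s) - real (snd t)\<bar> < 1"
        using abs_Re_le_cmod[of ?d] abs_Im_le_cmod[of ?d] by auto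
      then have "s = t" by (auto intro!: prod_eqI)
      with st show False by simp
    qed
  next
    fix t x assume t: "t \<in> {..<m} \<times> {..<m}" and x: "x \<in> ?X"
    have "(norm (\<zeta> - x))\<^sup>2 \<le> 2 * (koranyi \<zeta> x)\<^sup>2" using \<zeta> x by (intro norm_diff_le_koranyi) auto
    also have "\<dots> \<le> (2 * ?q)\<^sup>2" using x \<delta> by (simp add: power_mult_distrib)
    finally have 1: "norm (\<zeta> - x) \<le> 2 * ?q" by (rule power2_le_imp_le) (use q in simp)
    have "cmod (Complex (real (fst t)) (real (snd t))) \<le> real (fst t) + real (snd t)"
      using cmod_le[of "Complex (real (fst t)) (real (snd t))"] by simp
    also have "\<dots> \<le> 4 / ?q" using t m by auto
    finally have "8 * \<delta> * cmod (Complex (real (fst t)) (real (snd t))) \<le> 8 * \<delta> * (4 / ?q)"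
      using \<delta> by (intro mult_left_mono) auto
    moreover have "norm (v t) = 8 * \<delta> * cmod (Complex (real (fst t)) (real (snd t)))"
      using \<zeta> \<delta> by (simp add: v_def case_prod_beta norm_vector_scale norm_mult)
    ultimately have "norm (v t) \<le> 8 * \<delta> * (4 / ?q)" by simp
    also have "\<dots> = 32 * ?q" using q by (simp add: field_simps)
    finally have 2: "norm (v t) \<le> 32 * ?q" .
    have "norm (v t - (\<zeta> - x)) \<le> 34 * ?q"
      using norm_triangle_ineq4[of "v t" "\<zeta> - x"] 1 2 by linarith
    then show "v t + x \<in> cball \<zeta> (34 * ?q)"
      by (simp add: dist_norm norm_minus_commute algebra_simps)
  qed (use q in auto)
  moreover have "1 / \<delta> \<le> real (card ({..<m} \<times> {..<m}))"
    using mult_mono[OF m(1) m(1)] q by simp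
  then have "1 / \<delta> * measure lborel ?X \<le> real (card ({..<m} \<times> {..<m})) * measure lborel ?X"
    by (rule mult_right_mono) simp
  ultimately have "1 / \<delta> * measure lborel ?X \<le> (34 * ?q) ^ DIM(complex ^ 'n) * measure lborel (ball (0 :: complex ^ 'n) 1)"
    by linarith
  from mult_left_mono[OF this, of \<delta>] have "measure lborel ?X \<le> \<delta> * ((34 * ?q) ^ DIM(complex ^ 'n) * measure lborel (ball (0 :: complex ^ 'n) 1))"
    using \<delta> by simp
  also have "(34 * ?q) ^ DIM(complex ^ 'n) = 34 ^ (2 * CARD('n)) * \<delta> ^ CARD('n)"
    using \<delta> unfolding DIM_complex_vec power_mult_distrib power_mult[of _ 2] by simp
  finally show ?thesis by (simp add: mult_ac)
qed

lemma cone_shell_cap_koranyi: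
  assumes \<zeta>: "norm \<zeta> = 1" and w: "w \<in> cone_shell (1 - \<delta>) 1 (koranyi_cap \<zeta> \<delta>)" and \<delta>: "0 \<le> \<delta>" "\<delta> \<le> 1"
  shows "(koranyi \<zeta> w)\<^sup>2 \<le> 6 * \<delta>"
proof -
  have w: "w \<noteq> 0" "1 - \<delta> \<le> norm w" "norm w < 1" "(koranyi \<zeta> (sgn w))\<^sup>2 \<le> \<delta>"
    using w by (auto simp: cone_shell_def koranyi_cap_def)
  have wn: "w = norm w *\<^sub>R sgn w" using w(1) by (simp add: sgn_div_norm)
  have s: "norm (sgn w) = 1" using w by (simp add: norm_sgn)
  have "cdot (sgn w) w = complex_of_real (norm w)"
    by (subst (2) wn) (simp add: cdot_scaleR_right cdot_self s)
  then have "(koranyi (sgn w) w)\<^sup>2 \<le> \<delta>" using w by (simp add: koranyi_power2 cmod_one_minus_of_real)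
  then have "koranyi (sgn w) w \<le> sqrt \<delta>" "koranyi \<zeta> (sgn w) \<le> sqrt \<delta>" using w by (auto intro: real_le_rsqrt)
  then have "koranyi \<zeta> w \<le> 2 * sqrt \<delta>"
    using koranyi_triangle[of \<zeta> w "sgn w"] \<zeta> w s by simp
  from power_mono[OF this, of 2] show ?thesis using \<delta> by (simp add: power_mult_distrib)
qed

lemma power_diff_bounds:
  fixes r s :: real
  assumes "0 \<le> r" "r \<le> s" "s \<le> 1"
  shows "s ^ m - r ^ m \<le> real m * (s - r)" and "0 < m \<Longrightarrow> s ^ (m - 1) * (s - r) \<le> s ^ m - r ^ m"
proof -
  show "s ^ m - r ^ m \<le> real m * (s - r)"
  proof (induction m)
    case (Suc m)
    have "s ^ Suc m - r ^ Suc m = s * (s ^ m - r ^ m) + r ^ m * (s - r)" by (simp add: algebra_simps)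
    also have "\<dots> \<le> 1 * (s ^ m - r ^ m) + 1 * (s - r)"
      using assms by (intro add_mono mult_right_mono) (auto intro: power_mono power_le_one)
    finally show ?case using Suc by (simp add: algebra_simps)
  qed simp
  show "s ^ (m - 1) * (s - r) \<le> s ^ m - r ^ m" if "0 < m"
  proof -
    have "r * r ^ (m - 1) \<le> r * s ^ (m - 1)" using assms by (intro mult_left_mono power_mono) auto
    then have "r ^ m \<le> r * s ^ (m - 1)" using that by (metis power_eq_if neq0_conv)
    moreover have "s ^ m = s * s ^ (m - 1)" using that by (metis power_eq_if neq0_conv)
    ultimately show ?thesis by (simp add: algebra_simps)
  qed
qed

lemma fmeasurable_bounded: "bounded S \<Longrightarrow> S \<in> sets borel \<Longrightarrow> S \<in> fmeasurable lborel"
  using emeasure_bounded_finite by (intro fmeasurableI) auto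

lemma cone_volume_le_ball:
  fixes E :: "(complex ^ 'n) set"
  assumes "E \<in> sets borel"
  shows "cone_volume E \<le> measure lborel (ball (0 :: complex ^ 'n) 1)"
  by (rule measure_mono_fmeasurable) (use assms in \<open>auto simp: cone_shell_def intro: fmeasurable_bounded\<close>)

text \<open>
  The part of the cone over the cap within \<open>\<delta>\<close> of the sphere has a share of at least \<open>\<delta>\<close> of the volume of the
  cone and lies in a Koranyi ball of size \<open>6 * \<delta>\<close>, whose volume is at most about \<open>\<delta>^(n + 1)\<close>. For large
  \<open>\<delta>\<close> the volume of the unit ball is a sufficient bound.
\<close>
lemma cone_volume_cap_le:
  "\<exists>C>0. \<forall>(\<zeta> :: complex ^ 'n) \<delta>. norm \<zeta> = 1 \<longrightarrow> 0 < \<delta> \<longrightarrow>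
     cone_volume (koranyi_cap \<zeta> \<delta>) \<le> C * \<delta> ^ CARD('n)"
proof -
  define V where "V = measure lborel (ball (0 :: complex ^ 'n) 1)"
  define C where "C = 34 ^ (2 * CARD('n)) * V * 6 ^ (CARD('n) + 1) + V * 6 ^ CARD('n)"
  have V: "0 < V" unfolding V_def by simp
  have "cone_volume (koranyi_cap \<zeta> \<delta>) \<le> C * \<delta> ^ CARD('n)"
    if \<zeta>: "norm \<zeta> = 1" and \<delta>: "0 < \<delta>" for \<zeta> :: "complex ^ 'n" and \<delta>
  proof (cases "\<delta> \<le> 1 / 6")
    case True
    let ?S = "cone_shell (1 - \<delta>) 1 (koranyi_cap \<zeta> \<delta>)"
    have "\<delta> * cone_volume (koranyi_cap \<zeta> \<delta>) \<le> measure lborel ?S"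
    proof -
      have "(1 - \<delta>) ^ (2 * CARD('n)) \<le> (1 - \<delta>) ^ 1"
        using True \<delta> by (intro power_decreasing) auto
      then show ?thesis
        using True \<delta> by (subst measure_cone_shell) (auto intro!: mult_right_mono)
    qed
    also have "measure lborel ?S \<le> measure lborel {w \<in> ball 0 1. (koranyi \<zeta> w)\<^sup>2 \<le> 6 * \<delta>}"
    proof (rule measure_mono_fmeasurable)
      show "?S \<subseteq> {w \<in> ball 0 1. (koranyi \<zeta> w)\<^sup>2 \<le> 6 * \<delta>}"
        using cone_shell_cap_koranyi[OF \<zeta>] True \<delta> by (auto simp: cone_shell_def)
      show "{w \<in> ball 0 1. (koranyi \<zeta> w)\<^sup>2 \<le> 6 * \<delta>} \<in> fmeasurable lborel"
        by (rule fmeasurable_bounded[OF bounded_subset[OF bounded_ball[of 0 1]]]) (auto, measurable)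
    qed measurable
    also have "\<dots> \<le> 34 ^ (2 * CARD('n)) * V * (6 * \<delta>) ^ (CARD('n) + 1)"
      unfolding V_def using True \<delta> by (intro measure_koranyi_ball_le[OF \<zeta>]) auto
    also have "\<dots> = \<delta> * (34 ^ (2 * CARD('n)) * V * 6 ^ (CARD('n) + 1) * \<delta> ^ CARD('n))"
      by (simp add: power_mult_distrib)
    also have "\<dots> \<le> \<delta> * (C * \<delta> ^ CARD('n))"
      unfolding C_def using V \<delta> by (intro mult_left_mono mult_right_mono) auto
    finally show ?thesis using \<delta> by simp
  next
    case False
    then have "1 \<le> (6 * \<delta>) ^ CARD('n)" by (intro one_le_power) auto
    then have "V \<le> V * (6 * \<delta>) ^ CARD('n)" using V by simp
    also have "\<dots> \<le> C * \<delta> ^ CARD('n)"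
      unfolding C_def power_mult_distrib using V \<delta> by (simp add: distrib_right)
    finally show ?thesis using cone_volume_le_ball[OF koranyi_cap_sets, of \<zeta> \<delta>] by (simp add: V_def)
  qed
  moreover have "0 < C" unfolding C_def using V by (intro add_pos_pos mult_pos_pos) auto
  ultimately show ?thesis by blast
qed

text \<open>
  A polydisc with radius \<open>sqrt \<delta> / 8\<close> in the complex tangential directions and \<open>\<delta> / 8\<close> in the direction of \<open>\<zeta>\<close>
  stays inside the ball when it is centred at distance \<open>\<delta> / 2\<close> from the sphere.
\<close>
lemma polydisc_subset_cone_shell:
  fixes \<zeta> v :: "complex ^ 'n"
  assumes \<zeta>: "norm \<zeta> = 1" and \<delta>: "0 < \<delta>" "\<delta> \<le> 1"
    and v: "norm v \<le> sqrt \<delta> / 8" "cmod (cdot \<zeta> v) \<le> \<delta> / 8"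
  shows "(1 - \<delta> / 2) *\<^sub>R \<zeta> + v \<in> cone_shell (1 - \<delta>) 1 (koranyi_cap \<zeta> (4 * \<delta>))"
proof -
  let ?w = "(1 - \<delta> / 2) *\<^sub>R \<zeta> + v"
  have cw: "cdot \<zeta> ?w = complex_of_real (1 - \<delta> / 2) + cdot \<zeta> v"
    using \<zeta> by (simp add: cdot_add_right cdot_scaleR_right cdot_self)
  have re: "\<bar>Re (cdot \<zeta> v)\<bar> \<le> \<delta> / 8" using abs_Re_le_cmod[of "cdot \<zeta> v"] v(2) by linarith
  have "1 - \<delta> < Re (cdot \<zeta> ?w)" unfolding cw using re \<delta> by simp
  also have "\<dots> \<le> norm ?w"
    using complex_Re_le_cmod[of "cdot \<zeta> ?w"] cmod_cdot_le[of \<zeta> ?w] \<zeta> by simp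
  finally have lo: "1 - \<delta> < norm ?w" .
  have v2: "(norm v)\<^sup>2 \<le> \<delta> / 64"
    using power_mono[OF v(1) norm_ge_zero, of 2] \<delta> by (simp add: power_divide)
  have "(norm ?w)\<^sup>2 = (1 - \<delta> / 2)\<^sup>2 + 2 * (1 - \<delta> / 2) * Re (cdot \<zeta> v) + (norm v)\<^sup>2"
  proof -
    have "\<zeta> \<bullet> \<zeta> = 1" using \<zeta> by (simp add: dot_square_norm)
    then show ?thesis
      unfolding power2_norm_eq_inner Re_cdot
      by (simp add: inner_add_left inner_add_right inner_commute power2_eq_square algebra_simps)
  qed
  also have "\<dots> \<le> (1 - \<delta> / 2)\<^sup>2 + 2 * (\<delta> / 8) + \<delta> / 64"
  proof -
    have "(1 - \<delta> / 2) * Re (cdot \<zeta> v) \<le> (1 - \<delta> / 2) * (\<delta> / 8)"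
      using re \<delta> by (intro mult_left_mono) auto
    also have "\<dots> \<le> 1 * (\<delta> / 8)" using \<delta> by (intro mult_right_mono) auto
    finally have "(1 - \<delta> / 2) * Re (cdot \<zeta> v) \<le> \<delta> / 8" by simp
    then show ?thesis using v2 by linarith
  qed
  also have "\<dots> < 1"
  proof -
    have "\<delta> * \<delta> \<le> \<delta> * 1" using \<delta> by (intro mult_left_mono) auto
    then show ?thesis using \<delta> by (simp add: power2_eq_square algebra_simps)
  qed
  finally have hi: "norm ?w < 1" by (simp add: abs_square_less_1)
  have nz: "?w \<noteq> 0" using lo \<delta> by auto
  have s: "norm (sgn ?w) = 1" using nz by (simp add: norm_sgn)
  have "1 - cdot \<zeta> ?w = complex_of_real (\<delta> / 2) - cdot \<zeta> v" unfolding cw by simp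
  then have "(koranyi \<zeta> ?w)\<^sup>2 \<le> \<bar>\<delta> / 2\<bar> + \<delta> / 8"
    unfolding koranyi_power2 using norm_triangle_ineq4[of "complex_of_real (\<delta> / 2)" "cdot \<zeta> v"] v(2)
    by (simp only: norm_of_real)
  then have 1: "koranyi \<zeta> ?w \<le> sqrt \<delta>" using \<delta> by (intro real_le_rsqrt) simp
  have "?w = norm ?w *\<^sub>R sgn ?w" using nz by (simp add: sgn_div_norm)
  then have "cdot (sgn ?w) ?w = complex_of_real (norm ?w)"
    by (metis (no_types) cdot_scaleR_right cdot_self s mult.right_neutral of_real_1 power_one)
  then have "(koranyi ?w (sgn ?w))\<^sup>2 \<le> \<delta>"
    using hi lo by (subst koranyi_commute) (simp add: koranyi_power2 cmod_one_minus_of_real)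
  then have 2: "koranyi ?w (sgn ?w) \<le> sqrt \<delta>" by (rule real_le_rsqrt)
  have "koranyi \<zeta> (sgn ?w) \<le> 2 * sqrt \<delta>"
    using koranyi_triangle[of \<zeta> "sgn ?w" ?w] 1 2 \<zeta> s hi by simp
  from power_mono[OF this, of 2] have "(koranyi \<zeta> (sgn ?w))\<^sup>2 \<le> 4 * \<delta>"
    using \<delta> by (simp add: power_mult_distrib)
  then show ?thesis using lo hi nz s by (simp add: cone_shell_def koranyi_cap_def)
qed

text \<open>
  Conversely to the upper bound, about \<open>1 / \<delta>\<close> translates of the polydisc in the complex direction
  \<open>\<zeta>\<close> cover a ball of radius comparable to \<open>sqrt \<delta>\<close>. The grid has mesh \<open>\<delta> / 64\<close>.
\<close>
lemma measure_polydisc_ge: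
  fixes \<zeta> :: "complex ^ 'n"
  assumes \<zeta>: "norm \<zeta> = 1" and \<delta>: "0 < \<delta>" "\<delta> \<le> 1"
  shows "measure lborel (ball (0 :: complex ^ 'n) 1) * \<delta> ^ (CARD('n) + 1) \<le>
    81 * 32 ^ (2 * CARD('n)) * measure lborel {v. norm v \<le> sqrt \<delta> / 8 \<and> cmod (cdot \<zeta> v) \<le> \<delta> / 8}"
proof -
  let ?X = "{v. norm v \<le> sqrt \<delta> / 8 \<and> cmod (cdot \<zeta> v) \<le> \<delta> / 8}" and ?q = "sqrt \<delta>"
  have q: "0 < ?q" "?q \<le> 1" "?q * ?q = \<delta>" using \<delta> by auto
  have dq: "\<delta> \<le> ?q" using q mult_left_le[of ?q ?q] by simp
  define h where "h = \<delta> / 64"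
  have h: "0 < h" using \<delta> by (simp add: h_def)
  define K where "K = \<lceil>3 / ?q\<rceil>"
  have K: "3 / ?q \<le> real_of_int K" "real_of_int K \<le> 4 / ?q" "0 \<le> K"
  proof -
    have "1 \<le> 1 / ?q" "4 / ?q = 3 / ?q + 1 / ?q" using q by (simp_all add: add_divide_distrib[symmetric])
    then show "3 / ?q \<le> real_of_int K" "real_of_int K \<le> 4 / ?q" "0 \<le> K" unfolding K_def by linarith+
  qed
  let ?T = "{-K..K} \<times> {-K..K}"
  define v where "v = (\<lambda>(j::int, k::int). (complex_of_real h * Complex (of_int j) (of_int k)) *s \<zeta>)"
  have X: "?X \<in> sets borel"
    by (intro borel_closed closed_Collect_conj closed_Collect_le continuous_intros)
  have bX: "bounded ?X"
    by (rule bounded_subset[OF bounded_cball[of 0 "sqrt \<delta> / 8"]]) auto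
  have cover: "ball 0 (?q / 32) \<subseteq> (\<Union>t\<in>?T. (+) (v t) ` ?X)"
  proof
    fix x :: "complex ^ 'n" assume "x \<in> ball 0 (?q / 32)"
    then have x: "norm x \<le> ?q / 32" by simp
    define a where "a = cdot \<zeta> x"
    have a: "cmod a \<le> ?q / 32" using cmod_cdot_le[of \<zeta> x] \<zeta> x by (simp add: a_def)
    define j where "j = \<lfloor>Re a / h\<rfloor>"
    define k where "k = \<lfloor>Im a / h\<rfloor>"
    have rounding: "real_of_int \<lfloor>y / h\<rfloor> * h \<le> y \<and> y \<le> real_of_int \<lfloor>y / h\<rfloor> * h + h" for y
    proof -
      have "real_of_int \<lfloor>y / h\<rfloor> * h \<le> y / h * h" "y / h * h \<le> (real_of_int \<lfloor>y / h\<rfloor> + 1) * h"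
        using h by (intro mult_right_mono; linarith)+
      then show ?thesis using h by (simp add: distrib_right)
    qed
    have bound: "\<lfloor>y / h\<rfloor> \<in> {-K..K}" if "\<bar>y\<bar> \<le> ?q / 32" for y
    proof -
      have "\<bar>y / h\<bar> \<le> (?q / 32) / h" unfolding abs_divide abs_of_pos[OF h] using that h by (intro divide_right_mono) auto
      also have "\<dots> = 2 / ?q" unfolding h_def using q by (simp add: field_simps)
      finally have "\<bar>y / h\<bar> \<le> 2 / ?q" .
      moreover have "1 \<le> 1 / ?q" "3 / ?q = 2 / ?q + 1 / ?q"
        using q by (simp_all add: add_divide_distrib[symmetric])
      ultimately have "- real_of_int K - 1 < real_of_int \<lfloor>y / h\<rfloor>" "real_of_int \<lfloor>y / h\<rfloor> \<le> real_of_int K"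
        using K(1) by linarith+
      then show ?thesis by auto
    qed
    have jk: "(j, k) \<in> ?T"
      unfolding j_def k_def using bound[of "Re a"] bound[of "Im a"] abs_Re_le_cmod[of a] abs_Im_le_cmod[of a] a by auto
    let ?c = "complex_of_real h * Complex (of_int j) (of_int k)"
    have "cmod (a - ?c) \<le> \<bar>Re (a - ?c)\<bar> + \<bar>Im (a - ?c)\<bar>" by (rule cmod_le)
    also have "\<dots> \<le> h + h"
      using rounding[of "Re a"] rounding[of "Im a"] by (simp add: j_def k_def mult.commute)
    finally have ac: "cmod (a - ?c) \<le> \<delta> / 32" by (simp add: h_def)
    have "cdot \<zeta> (x - v (j, k)) = a - ?c"
      using \<zeta> by (simp add: v_def a_def cdot_diff_right cdot_scale_right cdot_self)
    then have 1: "cmod (cdot \<zeta> (x - v (j, k))) \<le> \<delta> / 8" using ac \<delta> by simp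
    have "cmod ?c \<le> cmod a + cmod (a - ?c)" using norm_triangle_ineq4[of a "a - ?c"] by simp
    then have "norm (v (j, k)) \<le> ?q / 16"
      using a ac dq \<zeta> unfolding v_def by (simp add: norm_vector_scale)
    then have 2: "norm (x - v (j, k)) \<le> ?q / 8"
      using x norm_triangle_ineq4[of x "v (j, k)"] q by linarith
    show "x \<in> (\<Union>t\<in>?T. (+) (v t) ` ?X)"
      using 1 2 by (intro UN_I[OF jk] image_eqI[of _ _ "x - v (j, k)"]) auto
  qed
  have "(?q / 32) ^ DIM(complex ^ 'n) * measure lborel (ball (0 :: complex ^ 'n) 1)
      \<le> real (card ?T) * measure lborel ?X"
    by (rule ball_le_card_times_measure[OF X bX _ cover]) (use q in simp_all)
  also have "real (card ?T) = (2 * real_of_int K + 1) * (2 * real_of_int K + 1)"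
    using K(3) by (simp add: of_nat_nat)
  also have "\<dots> \<le> (9 / ?q) * (9 / ?q)"
  proof -
    have "1 \<le> 1 / ?q" "9 / ?q = 2 * (4 / ?q) + 1 / ?q" using q by (simp_all add: add_divide_distrib[symmetric])
    then show ?thesis using K by (intro mult_mono) linarith+
  qed
  also have "\<dots> = 81 / \<delta>" using q by simp
  finally have "(?q / 32) ^ DIM(complex ^ 'n) * measure lborel (ball (0 :: complex ^ 'n) 1)
      \<le> 81 / \<delta> * measure lborel ?X"
    by (simp add: mult_right_mono)
  moreover have "(?q / 32) ^ DIM(complex ^ 'n) = \<delta> ^ CARD('n) / 32 ^ (2 * CARD('n))"
    using \<delta> unfolding DIM_complex_vec power_divide by (simp add: power_mult)
  ultimately show ?thesis using \<delta> by (simp add: field_simps)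
qed

text \<open>
  The cone over the cap, cut off at distance \<open>d\<close> from the sphere, contains a polydisc of volume about
  \<open>d^(n + 1)\<close> and has a share of at most \<open>2 n d\<close> of the volume of the cone.
\<close>
lemma cone_volume_cap_ge:
  "\<exists>c>0. \<forall>(\<zeta> :: complex ^ 'n) \<delta>. norm \<zeta> = 1 \<longrightarrow> 0 < \<delta> \<longrightarrow> \<delta> \<le> 1 \<longrightarrow>
     c * \<delta> ^ CARD('n) \<le> cone_volume (koranyi_cap \<zeta> \<delta>)"
proof -
  define V where "V = measure lborel (ball (0 :: complex ^ 'n) 1)"
  have V: "0 < V" unfolding V_def by simp
  define D where "D = 81 * 32 ^ (2 * CARD('n)) * real (2 * CARD('n)) * 4 ^ CARD('n)"
  have D: "0 < D" unfolding D_def by simp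
  have "V / D * \<delta> ^ CARD('n) \<le> cone_volume (koranyi_cap \<zeta> \<delta>)"
    if \<zeta>: "norm \<zeta> = 1" and \<delta>': "0 < \<delta>" "\<delta> \<le> 1" for \<zeta> :: "complex ^ 'n" and \<delta>
  proof -
    define d where "d = \<delta> / 4"
    have d: "0 < d" "d \<le> 1" using \<delta>' by (auto simp: d_def)
    let ?X = "{v. norm v \<le> sqrt d / 8 \<and> cmod (cdot \<zeta> v) \<le> d / 8}"
    let ?S = "cone_shell (1 - d) 1 (koranyi_cap \<zeta> (4 * d))"
    have X: "?X \<in> sets borel"
      by (intro borel_closed closed_Collect_conj closed_Collect_le continuous_intros)
    have "measure lborel ?X = measure lborel ((+) ((1 - d / 2) *\<^sub>R \<zeta>) ` ?X)"
      using measure_translate(2)[OF X] by (simp add: measure_def)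
    also have "\<dots> \<le> measure lborel ?S"
      by (rule measure_mono_fmeasurable)
        (use polydisc_subset_cone_shell[OF \<zeta> d] measure_translate(1)[OF X] fmeasurable_cone_shell[OF koranyi_cap_sets] in auto)
    also have "\<dots> \<le> (real (2 * CARD('n)) * d) * cone_volume (koranyi_cap \<zeta> (4 * d))"
      using d power_diff_bounds(1)[of "1 - d" 1 "2 * CARD('n)"]
      by (subst measure_cone_shell) (auto intro!: mult_right_mono)
    finally have X_le: "measure lborel ?X \<le> (real (2 * CARD('n)) * d) * cone_volume (koranyi_cap \<zeta> (4 * d))" .
    have "V * d ^ (CARD('n) + 1) \<le> 81 * 32 ^ (2 * CARD('n)) * measure lborel ?X"
      using measure_polydisc_ge[OF \<zeta> d] unfolding V_def .
    also have "\<dots> \<le> 81 * 32 ^ (2 * CARD('n)) *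
        ((real (2 * CARD('n)) * d) * cone_volume (koranyi_cap \<zeta> (4 * d)))"
      using X_le by (rule mult_left_mono) simp
    finally have "V * d ^ (CARD('n) + 1) \<le> 81 * 32 ^ (2 * CARD('n)) *
        ((real (2 * CARD('n)) * d) * cone_volume (koranyi_cap \<zeta> (4 * d)))" .
    then have "V * d ^ CARD('n) * d \<le> (81 * 32 ^ (2 * CARD('n)) * real (2 * CARD('n)) *
        cone_volume (koranyi_cap \<zeta> \<delta>)) * d"
      by (simp add: d_def mult_ac)
    then have "V * d ^ CARD('n) \<le> 81 * 32 ^ (2 * CARD('n)) * real (2 * CARD('n)) *
        cone_volume (koranyi_cap \<zeta> \<delta>)"
      using d(1) by (rule mult_right_le_imp_le)
    then have "V * \<delta> ^ CARD('n) \<le> D * cone_volume (koranyi_cap \<zeta> \<delta>)"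
      unfolding d_def D_def power_divide by (simp add: field_simps)
    then show ?thesis using D by (simp add: field_simps)
  qed
  moreover have "0 < V / D" using V D by simp
  ultimately show ?thesis by blast
qed

section \<open>Measures with the volume growth of Koranyi balls\<close>

definition cap_region :: "complex ^ 'n \<Rightarrow> real \<Rightarrow> (complex ^ 'n) set" where
  "cap_region \<zeta> \<delta> = {w \<in> cball 0 1. w \<noteq> 0 \<and> 1 - \<delta> \<le> norm w \<and> sgn w \<in> koranyi_cap \<zeta> \<delta>}"

text \<open>
  Regularity is formulated with regions over spherical caps since these are what dilation controls; the
  bounds for Koranyi balls are derived below. The upper bound is required for all \<open>\<delta>\<close>, the lower one only up
  to the size of the whole ball.
\<close>
definition koranyi_regular :: "real \<Rightarrow> (complex ^ 'n) measure \<Rightarrow> bool" where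
  "koranyi_regular \<kappa> \<nu> \<longleftrightarrow> sets \<nu> = sets borel \<and> (AE w in \<nu>. w \<noteq> 0 \<and> norm w \<le> 1) \<and>
     (\<exists>C>0. \<forall>\<zeta> \<delta>. norm \<zeta> = 1 \<longrightarrow> 0 < \<delta> \<longrightarrow> emeasure \<nu> (cap_region \<zeta> \<delta>) \<le> ennreal (C * \<delta> powr \<kappa>)) \<and>
     (\<exists>c>0. \<forall>\<zeta> \<delta>. norm \<zeta> = 1 \<longrightarrow> 0 < \<delta> \<longrightarrow> \<delta> \<le> 1 \<longrightarrow> ennreal (c * \<delta> powr \<kappa>) \<le> emeasure \<nu> (cap_region \<zeta> \<delta>))"

definition koranyi_ball :: "complex ^ 'n \<Rightarrow> real \<Rightarrow> (complex ^ 'n) set" where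
  "koranyi_ball z \<delta> = {w \<in> cball 0 1. (koranyi z w)\<^sup>2 \<le> \<delta>}"

lemma cap_region_sets [measurable]: "cap_region \<zeta> \<delta> \<in> sets borel"
  unfolding cap_region_def by measurable

lemma koranyi_ball_sets [measurable]: "koranyi_ball z \<delta> \<in> sets borel"
  unfolding koranyi_ball_def by measurable

lemma koranyi_radial:
  assumes "norm u = 1" "r \<le> 1"
  shows "(koranyi (r *\<^sub>R u) u)\<^sup>2 = 1 - r"
  using assms by (simp add: koranyi_power2 cdot_scaleR cdot_self cmod_one_minus_of_real)

lemma koranyi_sgn:
  assumes "w \<noteq> 0" "norm w \<le> 1"
  shows "koranyi w (sgn w) = sqrt (1 - norm w)" "norm (sgn w) = 1"
proof -
  show s: "norm (sgn w) = 1" using assms by (simp add: norm_sgn)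
  have "w = norm w *\<^sub>R sgn w" using assms by (simp add: sgn_div_norm)
  then have "(koranyi w (sgn w))\<^sup>2 = 1 - norm w" using koranyi_radial[OF s assms(2)] by simp
  then show "koranyi w (sgn w) = sqrt (1 - norm w)" by (metis koranyi_nonneg real_sqrt_abs abs_of_nonneg)
qed

lemma koranyi_direction:
  fixes z :: "complex ^ 'n"
  assumes "norm z \<le> 1"
  obtains \<zeta> where "norm \<zeta> = 1" "koranyi z \<zeta> = sqrt (1 - norm z)"
proof (cases "z = 0")
  case True
  then show ?thesis using that vector_choose_size[of 1, where 'a = "complex ^ 'n"] by auto
qed (use that koranyi_sgn[of z] assms in auto)

lemma koranyi_ball_subset_cap_region:
  assumes z: "norm z \<le> 1" and \<zeta>: "norm \<zeta> = 1" "koranyi z \<zeta> = sqrt (1 - norm z)"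
    and w: "w \<in> koranyi_ball z \<delta>" "w \<noteq> 0"
  shows "w \<in> cap_region \<zeta> (9 * \<delta>)"
proof -
  have w1: "norm w \<le> 1" and zw: "(koranyi z w)\<^sup>2 \<le> \<delta>" using w by (auto simp: koranyi_ball_def)
  have \<delta>: "0 \<le> \<delta>" using zw zero_le_power2[of "koranyi z w"] by linarith
  have zd: "1 - norm z \<le> \<delta>" using one_minus_norm_le_koranyi[OF z w1] zw by linarith
  have wd: "1 - norm w \<le> \<delta>" using one_minus_norm_le_koranyi[OF w1 z] zw by (simp add: koranyi_commute)
  have s: "norm (sgn w) = 1" using w by (simp add: norm_sgn)
  have "koranyi \<zeta> (sgn w) \<le> koranyi \<zeta> z + (koranyi z w + koranyi w (sgn w))"
    using koranyi_triangle[of \<zeta> "sgn w" z] koranyi_triangle[of z "sgn w" w] \<zeta> z w1 s by simp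
  also have "\<dots> \<le> sqrt \<delta> + (sqrt \<delta> + sqrt \<delta>)"
    using zd wd real_le_rsqrt[OF zw] \<zeta>(2) koranyi_sgn(1)[OF w(2) w1]
    by (intro add_mono) (auto simp: koranyi_commute[of \<zeta>])
  finally have "(koranyi \<zeta> (sgn w))\<^sup>2 \<le> (3 * sqrt \<delta>)\<^sup>2" by (intro power_mono) auto
  then have "(koranyi \<zeta> (sgn w))\<^sup>2 \<le> 9 * \<delta>" using \<delta> by (simp add: power_mult_distrib)
  then show ?thesis using w(2) w1 wd \<delta> s by (simp add: cap_region_def koranyi_cap_def)
qed

lemma cap_region_subset_koranyi_ball:
  assumes z: "norm z \<le> 1" "1 - norm z \<le> \<delta>" and \<zeta>: "norm \<zeta> = 1" "koranyi z \<zeta> = sqrt (1 - norm z)"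
    and \<delta>: "0 \<le> \<delta>"
  shows "cap_region \<zeta> \<delta> \<subseteq> koranyi_ball z (9 * \<delta>)"
proof
  fix w assume "w \<in> cap_region \<zeta> \<delta>"
  then have w: "w \<noteq> 0" "norm w \<le> 1" "1 - norm w \<le> \<delta>" and zw: "(koranyi \<zeta> (sgn w))\<^sup>2 \<le> \<delta>" "norm (sgn w) = 1"
    by (auto simp: cap_region_def koranyi_cap_def)
  have "koranyi z w \<le> koranyi z \<zeta> + (koranyi \<zeta> (sgn w) + koranyi (sgn w) w)"
    using koranyi_triangle[of z w \<zeta>] koranyi_triangle[of \<zeta> w "sgn w"] \<zeta> z w zw by simp
  also have "\<dots> \<le> sqrt \<delta> + (sqrt \<delta> + sqrt \<delta>)"
    using z w real_le_rsqrt[OF zw(1)] \<zeta>(2) koranyi_sgn(1)[OF w(1,2)]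
    by (intro add_mono) (auto simp: koranyi_commute[of _ w])
  finally have "(koranyi z w)\<^sup>2 \<le> (3 * sqrt \<delta>)\<^sup>2" by (intro power_mono) auto
  then show "w \<in> koranyi_ball z (9 * \<delta>)" using w \<delta> by (simp add: koranyi_ball_def power_mult_distrib)
qed

lemma koranyi_regular_le:
  fixes \<nu> :: "(complex ^ 'n) measure"
  assumes "koranyi_regular \<kappa> \<nu>"
  shows "\<exists>C>0. \<forall>z \<delta>. norm z \<le> 1 \<longrightarrow> 0 < \<delta> \<longrightarrow> emeasure \<nu> (koranyi_ball z \<delta>) \<le> ennreal (C * \<delta> powr \<kappa>)"
proof -
  have [measurable_cong, simp]: "sets \<nu> = sets borel" and AE: "AE w in \<nu>. w \<noteq> 0 \<and> norm w \<le> 1"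
    using assms by (auto simp: koranyi_regular_def)
  obtain C where C: "C > 0" "\<And>\<zeta> \<delta>. norm \<zeta> = 1 \<Longrightarrow> 0 < \<delta> \<Longrightarrow> emeasure \<nu> (cap_region \<zeta> \<delta>) \<le> ennreal (C * \<delta> powr \<kappa>)"
    using assms unfolding koranyi_regular_def by blast
  have "emeasure \<nu> (koranyi_ball z \<delta>) \<le> ennreal (C * 9 powr \<kappa> * \<delta> powr \<kappa>)"
    if z: "norm z \<le> 1" and \<delta>: "0 < \<delta>" for z \<delta>
  proof -
    obtain \<zeta> where \<zeta>: "norm \<zeta> = 1" "koranyi z \<zeta> = sqrt (1 - norm z)" using koranyi_direction[OF z] .
    have "emeasure \<nu> (koranyi_ball z \<delta>) \<le> emeasure \<nu> (cap_region \<zeta> (9 * \<delta>))"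
      using AE koranyi_ball_subset_cap_region[OF z \<zeta>] by (intro emeasure_mono_AE) auto
    also have "\<dots> \<le> ennreal (C * (9 * \<delta>) powr \<kappa>)" using \<delta> by (intro C(2) \<zeta>) simp
    finally show ?thesis using \<delta> by (simp add: powr_mult mult.assoc)
  qed
  then show ?thesis using C(1) by (intro exI[of _ "C * 9 powr \<kappa>"]) auto
qed

lemma koranyi_regular_ge:
  fixes \<nu> :: "(complex ^ 'n) measure"
  assumes "koranyi_regular \<kappa> \<nu>"
  shows "\<exists>c>0. \<forall>z \<delta>. norm z \<le> 1 \<longrightarrow> 0 < \<delta> \<longrightarrow> \<delta> \<le> 1 \<longrightarrow> 1 - norm z \<le> \<delta> \<longrightarrow>
    ennreal (c * \<delta> powr \<kappa>) \<le> emeasure \<nu> (koranyi_ball z (9 * \<delta>))"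
proof -
  have [measurable_cong, simp]: "sets \<nu> = sets borel"
    using assms by (auto simp: koranyi_regular_def)
  obtain c where c: "c > 0" "\<And>\<zeta> \<delta>. norm \<zeta> = 1 \<Longrightarrow> 0 < \<delta> \<Longrightarrow> \<delta> \<le> 1 \<Longrightarrow> ennreal (c * \<delta> powr \<kappa>) \<le> emeasure \<nu> (cap_region \<zeta> \<delta>)"
    using assms unfolding koranyi_regular_def by blast
  have "ennreal (c * \<delta> powr \<kappa>) \<le> emeasure \<nu> (koranyi_ball z (9 * \<delta>))"
    if z: "norm z \<le> 1" and \<delta>: "0 < \<delta>" "\<delta> \<le> 1" "1 - norm z \<le> \<delta>" for z \<delta>
  proof -
    obtain \<zeta> where \<zeta>: "norm \<zeta> = 1" "koranyi z \<zeta> = sqrt (1 - norm z)" using koranyi_direction[OF z] .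
    have "ennreal (c * \<delta> powr \<kappa>) \<le> emeasure \<nu> (cap_region \<zeta> \<delta>)" by (intro c(2) \<zeta> \<delta>)
    also have "\<dots> \<le> emeasure \<nu> (koranyi_ball z (9 * \<delta>))"
      using \<delta> by (intro emeasure_mono cap_region_subset_koranyi_ball[OF z \<delta>(3) \<zeta>]) auto
    finally show ?thesis .
  qed
  then show ?thesis using c(1) by blast
qed

definition sphere_measure :: "(complex ^ 'n) measure" where
  "sphere_measure = distr surface_measure borel (\<lambda>w. w)"

abbreviation bergman_density :: "real \<Rightarrow> complex ^ 'n \<Rightarrow> real" where
  "bergman_density \<alpha> w \<equiv> (1 + \<alpha>) * (1 - (norm w)\<^sup>2) powr \<alpha>"

definition bergman_measure :: "real \<Rightarrow> (complex ^ 'n) measure" where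
  "bergman_measure \<alpha> = density lborel (\<lambda>w. ennreal (bergman_density \<alpha> w) * indicator (ball 0 1) w)"

text \<open>
  \<open>surface_measure\<close> lives on the \<open>\<sigma>\<close>-algebra of the sphere, whereas regular measures are Borel measures on the
  whole space; \<open>sphere_measure\<close> is its image under the inclusion.
\<close>
lemma measurable_sgn_sphere [measurable]:
  "sgn \<in> measurable (restrict_space lborel (ball 0 1 - {0})) (restrict_space borel (sphere (0 :: complex ^ 'n) 1))"
  by (rule measurable_restrict_space2) (auto simp: space_restrict_space norm_sgn intro!: measurable_restrict_space1)

lemma sets_surface_measure: "sets (surface_measure :: (complex ^ 'n) measure) = sets (restrict_space borel (sphere 0 1))"
  by (simp add: surface_measure_def)

lemma space_surface_measure: "space (surface_measure :: (complex ^ 'n) measure) = sphere 0 1"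
  using sets_eq_imp_space_eq[OF sets_surface_measure] by (simp add: space_restrict_space)

lemma measurable_ident_surface: "(\<lambda>w. w) \<in> measurable (surface_measure :: (complex ^ 'n) measure) borel"
proof -
  have "(\<lambda>w. w) \<in> measurable (restrict_space borel (sphere 0 1)) (borel :: (complex ^ 'n) measure)"
    by (rule measurable_restrict_space1) simp
  then show ?thesis by (simp cong: measurable_cong_sets add: measurable_cong_sets[OF sets_surface_measure refl])
qed

lemma emeasure_sphere_measure:
  fixes A :: "(complex ^ 'n) set"
  assumes A [measurable]: "A \<in> sets borel"
  shows "emeasure sphere_measure A = of_nat (2 * CARD('n)) * emeasure lborel (cone_shell 0 1 A)"
proof -
  let ?R = "restrict_space lborel (ball 0 1 - {0 :: complex ^ 'n})" and ?S = "restrict_space borel (sphere (0 :: complex ^ 'n) 1)"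
  have AS: "A \<inter> sphere 0 1 \<in> sets ?S" by (auto simp: sets_restrict_space)
  have "emeasure sphere_measure A = emeasure surface_measure (A \<inter> sphere 0 1)"
    unfolding sphere_measure_def by (subst emeasure_distr[OF measurable_ident_surface]) (auto simp: space_surface_measure)
  also have "\<dots> = of_nat (2 * CARD('n)) * emeasure ?R (sgn -` (A \<inter> sphere 0 1) \<inter> space ?R)"
    unfolding surface_measure_def using AS by (simp add: emeasure_distr)
  also have "sgn -` (A \<inter> sphere 0 1) \<inter> space ?R = cone_shell 0 1 A"
    by (auto simp: space_restrict_space cone_shell_def norm_sgn)
  also have "emeasure ?R (cone_shell 0 1 A) = emeasure lborel (cone_shell 0 1 A)"
    by (rule emeasure_restrict_space) (auto simp: cone_shell_def)
  finally show ?thesis .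
qed

lemma emeasure_cone_shell:
  fixes E :: "(complex ^ 'n) set"
  assumes "E \<in> sets borel"
  shows "emeasure lborel (cone_shell r s E) = ennreal (measure lborel (cone_shell r s E))"
  using emeasure_cone_shell_finite[OF assms, of r s] by (intro emeasure_eq_ennreal_measure) auto

lemma koranyi_regular_sphere_measure:
  "koranyi_regular (real CARD('n)) (sphere_measure :: (complex ^ 'n) measure)"
proof -
  let ?\<nu> = "sphere_measure :: (complex ^ 'n) measure"
  have eq: "emeasure ?\<nu> (cap_region \<zeta> \<delta>) = ennreal (real (2 * CARD('n)) * cone_volume (koranyi_cap \<zeta> \<delta>))"
    if "0 < \<delta>" for \<zeta> :: "complex ^ 'n" and \<delta>
  proof -
    have "sgn (sgn w) = sgn w" for w :: "complex ^ 'n"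
      by (cases "w = 0") (simp_all add: sgn_div_norm[of "sgn w"] norm_sgn)
    then have "cone_shell 0 1 (cap_region \<zeta> \<delta>) = cone_shell 0 1 (koranyi_cap \<zeta> \<delta>)"
      using that by (auto simp: cone_shell_def cap_region_def norm_sgn koranyi_cap_def sgn_zero_iff)
    then show ?thesis
      by (simp add: emeasure_sphere_measure emeasure_cone_shell ennreal_mult' ennreal_of_nat_eq_real_of_nat)
  qed
  obtain C where C: "C > 0" "\<And>(\<zeta> :: complex ^ 'n) \<delta>. norm \<zeta> = 1 \<Longrightarrow> 0 < \<delta> \<Longrightarrow>
      cone_volume (koranyi_cap \<zeta> \<delta>) \<le> C * \<delta> ^ CARD('n)"
    using cone_volume_cap_le[where 'n = 'n] by blast
  obtain c where c: "c > 0" "\<And>(\<zeta> :: complex ^ 'n) \<delta>. norm \<zeta> = 1 \<Longrightarrow> 0 < \<delta> \<Longrightarrow> \<delta> \<le> 1 \<Longrightarrow>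
      c * \<delta> ^ CARD('n) \<le> cone_volume (koranyi_cap \<zeta> \<delta>)"
    using cone_volume_cap_ge[where 'n = 'n] by blast
  show ?thesis
    unfolding koranyi_regular_def
  proof (intro conjI)
    show "sets ?\<nu> = sets borel" by (simp add: sphere_measure_def)
    show "AE w in ?\<nu>. w \<noteq> 0 \<and> norm w \<le> 1"
      unfolding sphere_measure_def
      by (subst AE_distr_iff[OF measurable_ident_surface]) (auto simp: space_surface_measure intro!: AE_I2)
    show "\<exists>C>0. \<forall>\<zeta> \<delta>. norm \<zeta> = 1 \<longrightarrow> 0 < \<delta> \<longrightarrow>
        emeasure ?\<nu> (cap_region \<zeta> \<delta>) \<le> ennreal (C * \<delta> powr real CARD('n))"
    proof (intro exI[of _ "real (2 * CARD('n)) * C"] conjI allI impI)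
      fix \<zeta> :: "complex ^ 'n" and \<delta> :: real assume "norm \<zeta> = 1" "0 < \<delta>"
      then show "emeasure ?\<nu> (cap_region \<zeta> \<delta>) \<le> ennreal (real (2 * CARD('n)) * C * \<delta> powr real CARD('n))"
        unfolding eq[OF \<open>0 < \<delta>\<close>] mult.assoc using C(2)[of \<zeta> \<delta>]
        by (intro ennreal_leI mult_left_mono) (auto simp: powr_realpow)
    qed (use C in simp)
    show "\<exists>c>0. \<forall>\<zeta> \<delta>. norm \<zeta> = 1 \<longrightarrow> 0 < \<delta> \<longrightarrow> \<delta> \<le> 1 \<longrightarrow>
        ennreal (c * \<delta> powr real CARD('n)) \<le> emeasure ?\<nu> (cap_region \<zeta> \<delta>)"
    proof (intro exI[of _ "real (2 * CARD('n)) * c"] conjI allI impI)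
      fix \<zeta> :: "complex ^ 'n" and \<delta> :: real assume "norm \<zeta> = 1" "0 < \<delta>" "\<delta> \<le> 1"
      then show "ennreal (real (2 * CARD('n)) * c * \<delta> powr real CARD('n)) \<le> emeasure ?\<nu> (cap_region \<zeta> \<delta>)"
        unfolding eq[OF \<open>0 < \<delta>\<close>] mult.assoc using c(2)[of \<zeta> \<delta>]
        by (intro ennreal_leI mult_left_mono) (auto simp: powr_realpow)
    qed (use c in simp)
  qed
qed

lemma dyadic_scale:
  fixes t \<delta> :: real
  assumes "0 < t" "t \<le> \<delta>"
  obtains k :: nat where "\<delta> / 2 ^ (k + 1) < t" "t \<le> \<delta> / 2 ^ k"
proof -
  have \<delta>: "0 < \<delta>" using assms by linarith
  obtain m where "(1 / 2 :: real) ^ m < t / \<delta>"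
    using real_arch_pow_inv[of "t / \<delta>" "1 / 2"] assms \<delta> by auto
  then have ex: "\<delta> / 2 ^ m < t" using \<delta> by (simp add: power_divide field_simps)
  define k where "k = (LEAST m. \<delta> / 2 ^ m < t)"
  have k: "\<delta> / 2 ^ k < t" unfolding k_def using ex by (rule LeastI)
  have k0: "k \<noteq> 0" using k assms by (metis div_by_1 linorder_not_le power_0)
  have "\<not> \<delta> / 2 ^ (k - 1) < t" using k0 not_less_Least[of "k - 1" "\<lambda>m. \<delta> / 2 ^ m < t"] by (simp add: k_def[symmetric])
  then show ?thesis using that[of "k - 1"] k k0 by simp
qed

lemma powr_comparable:
  fixes s t \<alpha> :: real
  assumes "0 < s" "s / 2 \<le> t" "t \<le> 2 * s"
  shows "t powr \<alpha> \<le> 2 powr \<bar>\<alpha>\<bar> * s powr \<alpha>"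
proof (cases "0 \<le> \<alpha>")
  case True
  have "t powr \<alpha> \<le> (2 * s) powr \<alpha>" using True assms by (intro powr_mono2) auto
  then show ?thesis using True assms by (simp add: powr_mult)
next
  case False
  have "t powr \<alpha> \<le> (s / 2) powr \<alpha>" using False assms by (intro powr_mono2') auto
  also have "\<dots> = s powr \<alpha> / 2 powr \<alpha>" using assms by (simp add: powr_divide)
  also have "\<dots> = 2 powr \<bar>\<alpha>\<bar> * s powr \<alpha>" using False by (simp add: powr_minus_divide)
  finally show ?thesis .
qed

lemma bergman_weight_comparable:
  fixes w :: "complex ^ 'n"
  assumes s: "0 < s" and w: "s / 2 \<le> 1 - norm w" "1 - norm w \<le> s"
  shows "(1 - (norm w)\<^sup>2) powr \<alpha> \<le> 2 powr \<bar>\<alpha>\<bar> * s powr \<alpha>"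
    and "s powr \<alpha> \<le> 2 powr \<bar>\<alpha>\<bar> * (1 - (norm w)\<^sup>2) powr \<alpha>"
proof -
  have eq: "1 - (norm w)\<^sup>2 = (1 - norm w) * (1 + norm w)" by (simp add: power2_eq_square algebra_simps)
  have "(1 - norm w) * 1 \<le> (1 - norm w) * (1 + norm w)"
    using s w by (intro mult_left_mono) auto
  then have lo: "1 - norm w \<le> 1 - (norm w)\<^sup>2" unfolding eq by simp
  have "(1 - norm w) * (1 + norm w) \<le> (1 - norm w) * 2"
    using s w by (intro mult_left_mono) auto
  then have hi: "1 - (norm w)\<^sup>2 \<le> 2 * (1 - norm w)" unfolding eq by simp
  have "s / 2 \<le> 1 - (norm w)\<^sup>2" using lo w by linarith
  moreover have "1 - (norm w)\<^sup>2 \<le> 2 * s" using hi mult_left_mono[OF w(2), of 2] by linarith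
  moreover have "0 < 1 - (norm w)\<^sup>2" using lo s w by linarith
  ultimately show "(1 - (norm w)\<^sup>2) powr \<alpha> \<le> 2 powr \<bar>\<alpha>\<bar> * s powr \<alpha>"
    "s powr \<alpha> \<le> 2 powr \<bar>\<alpha>\<bar> * (1 - (norm w)\<^sup>2) powr \<alpha>"
    using s by (auto intro!: powr_comparable)
qed

lemma borel_measurable_bergman_weight [measurable]:
  "(\<lambda>w :: complex ^ 'n. ennreal (bergman_density \<alpha> w) * indicator (ball 0 1) w)
    \<in> borel_measurable borel"
proof -
  have [measurable]: "ball (0 :: complex ^ 'n) 1 \<in> sets borel" by simp
  show ?thesis by measurable
qed

lemma measure_half_shell_le:
  fixes E :: "(complex ^ 'n) set"
  assumes E: "E \<in> sets borel" and s: "0 < s" "s \<le> 1"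
  shows "measure lborel (cone_shell (1 - s) (1 - s / 2) E) \<le> (real (2 * CARD('n)) * s) * cone_volume E"
proof -
  have "measure lborel (cone_shell (1 - s) (1 - s / 2) E) =
      ((1 - s / 2) ^ (2 * CARD('n)) - (1 - s) ^ (2 * CARD('n))) * cone_volume E"
    using s by (intro measure_cone_shell E) auto
  also have "\<dots> \<le> (real (2 * CARD('n)) * s) * cone_volume E"
  proof (rule mult_right_mono)
    have "(1 - s / 2) ^ (2 * CARD('n)) - (1 - s) ^ (2 * CARD('n)) \<le> real (2 * CARD('n)) * ((1 - s / 2) - (1 - s))"
      using s by (intro power_diff_bounds(1)) auto
    also have "\<dots> \<le> real (2 * CARD('n)) * s"
      using s by (intro mult_left_mono) auto
    finally show "(1 - s / 2) ^ (2 * CARD('n)) - (1 - s) ^ (2 * CARD('n)) \<le> real (2 * CARD('n)) * s" .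
  qed simp
  finally show ?thesis .
qed

text \<open>
  On the dyadic shell where \<open>1 - |w|\<close> is about \<open>s = 2^-k \<delta>\<close> the density is about \<open>s^\<alpha>\<close>, and the volume of the
  shell over the cap is about \<open>s \<delta>^n\<close>. The series of \<open>s^(1 + \<alpha>)\<close> converges since \<open>\<alpha> > -1\<close>.
\<close>
lemma bergman_measure_cap_region_le:
  assumes \<alpha>: "-1 < \<alpha>"
  shows "\<exists>C>0. \<forall>(\<zeta> :: complex ^ 'n) \<delta>. norm \<zeta> = 1 \<longrightarrow> 0 < \<delta> \<longrightarrow>
    emeasure (bergman_measure \<alpha>) (cap_region \<zeta> \<delta>) \<le> ennreal (C * \<delta> powr (real CARD('n) + 1 + \<alpha>))"
proof -
  let ?\<nu> = "bergman_measure \<alpha> :: (complex ^ 'n) measure"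
  obtain C where C: "C > 0" "\<And>(\<zeta> :: complex ^ 'n) \<delta>. norm \<zeta> = 1 \<Longrightarrow> 0 < \<delta> \<Longrightarrow>
      cone_volume (koranyi_cap \<zeta> \<delta>) \<le> C * \<delta> ^ CARD('n)"
    using cone_volume_cap_le[where 'n = 'n] by blast
  define q where "q = 2 powr - (1 + \<alpha>)"
  have q: "0 < q" "q < 1" using \<alpha> powr_less_mono[of "- (1 + \<alpha>)" 0 2] by (auto simp: q_def)
  define D where "D = (1 + \<alpha>) * 2 powr \<bar>\<alpha>\<bar> * real (2 * CARD('n)) * C"
  have D: "0 < D" using \<alpha> C by (simp add: D_def)
  have "emeasure ?\<nu> (cap_region \<zeta> \<delta>) \<le> ennreal (D / (1 - q) * \<delta> powr (real CARD('n) + 1 + \<alpha>))"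
    if \<zeta>: "norm \<zeta> = 1" and \<delta>: "0 < \<delta>" for \<zeta> :: "complex ^ 'n" and \<delta>
  proof -
    define d where "d = min \<delta> 1"
    have d: "0 < d" "d \<le> 1" "d \<le> \<delta>" using \<delta> by (auto simp: d_def)
    define S where "S k = cone_shell (1 - d / 2 ^ k) (1 - d / 2 ^ (k + 1)) (koranyi_cap \<zeta> \<delta>)" for k
    have S [measurable]: "S k \<in> sets borel" for k unfolding S_def by measurable
    have dk: "0 < d / 2 ^ k" "d / 2 ^ (k + 1) = d / 2 ^ k / 2" "d / 2 ^ k \<le> 1" for k
    proof -
      show "d / 2 ^ k \<le> 1" using d by (simp add: divide_le_eq) (meson one_le_numeral one_le_power order_trans)
    qed (use d in auto)
    have sub: "w \<in> (\<Union>k. S k)" if w: "w \<in> cap_region \<zeta> \<delta>" "w \<in> ball 0 1" for w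
    proof -
      have w': "w \<noteq> 0" "norm w < 1" "1 - d \<le> norm w" "sgn w \<in> koranyi_cap \<zeta> \<delta>"
        using w by (auto simp: cap_region_def d_def min_def)
      obtain k where "d / 2 ^ (k + 1) < 1 - norm w" "1 - norm w \<le> d / 2 ^ k"
        using dyadic_scale[of "1 - norm w" d] w' by auto
      then have "w \<in> S k" using w' by (simp add: S_def cone_shell_def)
      then show ?thesis by blast
    qed
    have shell_le: "emeasure ?\<nu> (S k) \<le> ennreal (D * \<delta> ^ CARD('n) * d powr (1 + \<alpha>) * q ^ k)" for k
    proof -
      let ?s = "d / 2 ^ k"
      have "emeasure ?\<nu> (S k) = (\<integral>\<^sup>+w. ennreal (bergman_density \<alpha> w) * indicator (ball 0 1) w * indicator (S k) w \<partial>lborel)"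
        unfolding bergman_measure_def by (subst emeasure_density) auto
      also have "\<dots> \<le> (\<integral>\<^sup>+w. ennreal ((1 + \<alpha>) * (2 powr \<bar>\<alpha>\<bar> * ?s powr \<alpha>)) * indicator (S k) w \<partial>lborel)"
      proof (rule nn_integral_mono)
        fix w :: "complex ^ 'n"
        have "(1 - (norm w)\<^sup>2) powr \<alpha> \<le> 2 powr \<bar>\<alpha>\<bar> * ?s powr \<alpha>" if "w \<in> S k"
          using that dk[of k] by (intro bergman_weight_comparable(1)) (auto simp: S_def cone_shell_def)
        then show "ennreal (bergman_density \<alpha> w) * indicator (ball 0 1) w * indicator (S k) w \<le>
            ennreal ((1 + \<alpha>) * (2 powr \<bar>\<alpha>\<bar> * ?s powr \<alpha>)) * indicator (S k) w"
          using \<alpha> by (auto simp: indicator_def intro!: ennreal_leI mult_left_mono)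
      qed
      also have "\<dots> = ennreal ((1 + \<alpha>) * (2 powr \<bar>\<alpha>\<bar> * ?s powr \<alpha>)) * emeasure lborel (S k)"
        by (simp add: nn_integral_cmult)
      also have "emeasure lborel (S k) = ennreal (measure lborel (S k))"
        unfolding S_def by (rule emeasure_cone_shell) simp
      also have "measure lborel (S k) \<le> real (2 * CARD('n)) * ?s * (C * \<delta> ^ CARD('n))"
      proof -
        have "measure lborel (S k) \<le> (real (2 * CARD('n)) * ?s) * cone_volume (koranyi_cap \<zeta> \<delta>)"
          unfolding S_def dk(2) by (rule measure_half_shell_le[OF koranyi_cap_sets dk(1,3)])
        also have "\<dots> \<le> (real (2 * CARD('n)) * ?s) * (C * \<delta> ^ CARD('n))"
          using C(2)[OF \<zeta> \<delta>] less_imp_le[OF dk(1)[of k]] by (intro mult_left_mono mult_nonneg_nonneg) simp_all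
        finally show ?thesis .
      qed
      finally have "emeasure ?\<nu> (S k) \<le> ennreal ((1 + \<alpha>) * (2 powr \<bar>\<alpha>\<bar> * ?s powr \<alpha>)) *
          ennreal (real (2 * CARD('n)) * ?s * (C * \<delta> ^ CARD('n)))"
        by (simp add: mult_left_mono ennreal_leI)
      also have "\<dots> = ennreal (D * \<delta> ^ CARD('n) * (?s powr \<alpha> * ?s))"
        using \<alpha> by (subst ennreal_mult'[symmetric]) (auto simp: D_def mult_ac)
      also have "?s powr \<alpha> * ?s = ?s powr (1 + \<alpha>)"
        using dk(1)[of k] d(1) by (simp add: powr_add mult.commute)
      also have "\<dots> = d powr (1 + \<alpha>) * q ^ k"
      proof -
        have "q ^ k = 2 powr - (real k * (1 + \<alpha>))" unfolding q_def by (simp add: powr_power algebra_simps)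
        moreover have "((2::real) ^ k) powr (1 + \<alpha>) = 2 powr (real k * (1 + \<alpha>))"
          by (simp add: powr_realpow[symmetric] powr_powr)
        ultimately show ?thesis using d(1) by (simp only: powr_divide powr_minus_divide) simp
      qed
      finally show ?thesis by (simp add: mult.assoc)
    qed
    have "emeasure ?\<nu> (cap_region \<zeta> \<delta>) \<le> emeasure ?\<nu> (\<Union>k. S k)"
    proof (rule emeasure_mono_AE)
      show "AE w in ?\<nu>. w \<in> cap_region \<zeta> \<delta> \<longrightarrow> w \<in> (\<Union>k. S k)"
        unfolding bergman_measure_def using sub by (subst AE_density) (auto intro!: AE_I2 simp: indicator_def)
    qed (simp add: bergman_measure_def)
    also have "\<dots> \<le> (\<Sum>k. emeasure ?\<nu> (S k))"
      by (rule emeasure_subadditive_countably) (auto simp: bergman_measure_def)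
    also have "\<dots> \<le> (\<Sum>k. ennreal (D * \<delta> ^ CARD('n) * d powr (1 + \<alpha>) * q ^ k))"
      by (intro suminf_le shell_le) auto
    also have "\<dots> = ennreal (D * \<delta> ^ CARD('n) * d powr (1 + \<alpha>) * (1 / (1 - q)))"
    proof -
      have "(\<lambda>k. D * \<delta> ^ CARD('n) * d powr (1 + \<alpha>) * q ^ k) sums (D * \<delta> ^ CARD('n) * d powr (1 + \<alpha>) * (1 / (1 - q)))"
        using q by (intro sums_mult geometric_sums) auto
      then show ?thesis using D \<delta> q by (intro suminf_ennreal_eq) auto
    qed
    also have "\<dots> \<le> ennreal (D / (1 - q) * \<delta> powr (real CARD('n) + 1 + \<alpha>))"
    proof (rule ennreal_leI)
      have "\<delta> ^ CARD('n) * d powr (1 + \<alpha>) \<le> \<delta> powr real CARD('n) * \<delta> powr (1 + \<alpha>)"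
        using d \<delta> \<alpha> by (intro mult_mono powr_mono2) (auto simp: powr_realpow)
      also have "\<dots> = \<delta> powr (real CARD('n) + 1 + \<alpha>)" by (simp add: powr_add[symmetric] add.assoc)
      finally have "D / (1 - q) * (\<delta> ^ CARD('n) * d powr (1 + \<alpha>)) \<le> D / (1 - q) * \<delta> powr (real CARD('n) + 1 + \<alpha>)"
        using D q by (intro mult_left_mono) auto
      then show "D * \<delta> ^ CARD('n) * d powr (1 + \<alpha>) * (1 / (1 - q)) \<le> D / (1 - q) * \<delta> powr (real CARD('n) + 1 + \<alpha>)"
        by (simp add: field_simps)
    qed
    finally show ?thesis .
  qed
  moreover have "0 < D / (1 - q)" using D q by simp
  ultimately show ?thesis by blast
qed

text \<open>
  A single shell, where \<open>1 - |w|\<close> lies between \<open>\<delta> / 2\<close> and \<open>\<delta>\<close>, has the required mass.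
\<close>
lemma bergman_measure_cap_region_ge:
  assumes \<alpha>: "-1 < \<alpha>"
  shows "\<exists>c>0. \<forall>(\<zeta> :: complex ^ 'n) \<delta>. norm \<zeta> = 1 \<longrightarrow> 0 < \<delta> \<longrightarrow> \<delta> \<le> 1 \<longrightarrow>
    ennreal (c * \<delta> powr (real CARD('n) + 1 + \<alpha>)) \<le> emeasure (bergman_measure \<alpha>) (cap_region \<zeta> \<delta>)"
proof -
  let ?\<nu> = "bergman_measure \<alpha> :: (complex ^ 'n) measure" and ?m = "2 * CARD('n)"
  obtain c where c: "c > 0" "\<And>(\<zeta> :: complex ^ 'n) \<delta>. norm \<zeta> = 1 \<Longrightarrow> 0 < \<delta> \<Longrightarrow> \<delta> \<le> 1 \<Longrightarrow>
      c * \<delta> ^ CARD('n) \<le> cone_volume (koranyi_cap \<zeta> \<delta>)"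
    using cone_volume_cap_ge[where 'n = 'n] by blast
  define b where "b = (1 + \<alpha>) / 2 powr \<bar>\<alpha>\<bar> * ((1 / 2) ^ (?m - 1) / 2 * c)"
  have b: "0 < b" using \<alpha> c by (simp add: b_def)
  have "ennreal (b * \<delta> powr (real CARD('n) + 1 + \<alpha>)) \<le> emeasure ?\<nu> (cap_region \<zeta> \<delta>)"
    if \<zeta>: "norm \<zeta> = 1" and \<delta>: "0 < \<delta>" "\<delta> \<le> 1" for \<zeta> :: "complex ^ 'n" and \<delta>
  proof -
    let ?S = "cone_shell (1 - \<delta>) (1 - \<delta> / 2) (koranyi_cap \<zeta> \<delta>)"
    have "(1 / 2) ^ (?m - 1) * (\<delta> / 2) * (c * \<delta> ^ CARD('n)) \<le> measure lborel ?S"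
    proof -
      have "(1 / 2) ^ (?m - 1) * (\<delta> / 2) \<le> (1 - \<delta> / 2) ^ (?m - 1) * ((1 - \<delta> / 2) - (1 - \<delta>))"
        using \<delta> by (intro mult_mono power_mono) auto
      also have "\<dots> \<le> (1 - \<delta> / 2) ^ ?m - (1 - \<delta>) ^ ?m"
        using \<delta> by (intro power_diff_bounds(2)) auto
      finally have "(1 / 2) ^ (?m - 1) * (\<delta> / 2) * (c * \<delta> ^ CARD('n)) \<le>
          ((1 - \<delta> / 2) ^ ?m - (1 - \<delta>) ^ ?m) * cone_volume (koranyi_cap \<zeta> \<delta>)"
        using c(2)[OF \<zeta> \<delta>] c(1) \<delta> by (intro mult_mono) (auto intro: order_trans[rotated])
      also have "\<dots> = measure lborel ?S" using \<delta> by (intro measure_cone_shell[symmetric]) auto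
      finally show ?thesis .
    qed
    then have "ennreal ((1 / 2) ^ (?m - 1) * (\<delta> / 2) * (c * \<delta> ^ CARD('n))) \<le> emeasure lborel ?S"
      by (simp add: emeasure_cone_shell ennreal_leI)
    then have "ennreal ((1 + \<alpha>) * (\<delta> powr \<alpha> / 2 powr \<bar>\<alpha>\<bar>)) * ennreal ((1 / 2) ^ (?m - 1) * (\<delta> / 2) * (c * \<delta> ^ CARD('n)))
        \<le> ennreal ((1 + \<alpha>) * (\<delta> powr \<alpha> / 2 powr \<bar>\<alpha>\<bar>)) * emeasure lborel ?S"
      by (rule mult_left_mono) simp
    also have "\<dots> = (\<integral>\<^sup>+w. ennreal ((1 + \<alpha>) * (\<delta> powr \<alpha> / 2 powr \<bar>\<alpha>\<bar>)) * indicator ?S w \<partial>lborel)"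
      by (simp add: nn_integral_cmult)
    also have "\<dots> \<le> (\<integral>\<^sup>+w. ennreal (bergman_density \<alpha> w) * indicator (ball 0 1) w * indicator (cap_region \<zeta> \<delta>) w \<partial>lborel)"
    proof (rule nn_integral_mono)
      fix w :: "complex ^ 'n"
      have "\<delta> powr \<alpha> / 2 powr \<bar>\<alpha>\<bar> \<le> (1 - (norm w)\<^sup>2) powr \<alpha>" if "w \<in> ?S"
        using that \<delta> bergman_weight_comparable(2)[of \<delta> w \<alpha>] by (simp add: cone_shell_def divide_le_eq mult.commute)
      then have "(1 + \<alpha>) * (\<delta> powr \<alpha> / 2 powr \<bar>\<alpha>\<bar>) \<le> (1 + \<alpha>) * (1 - (norm w)\<^sup>2) powr \<alpha>" if "w \<in> ?S"
        using that \<alpha> by (intro mult_left_mono) auto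
      moreover have "w \<in> ball 0 1 \<and> w \<in> cap_region \<zeta> \<delta>" if "w \<in> ?S"
        using that \<delta> by (auto simp: cone_shell_def cap_region_def)
      ultimately show "ennreal ((1 + \<alpha>) * (\<delta> powr \<alpha> / 2 powr \<bar>\<alpha>\<bar>)) * indicator ?S w \<le>
          ennreal (bergman_density \<alpha> w) * indicator (ball 0 1) w * indicator (cap_region \<zeta> \<delta>) w"
        by (cases "w \<in> ?S") (auto intro!: ennreal_leI simp del: times_divide_eq_right)
    qed
    also have "\<dots> = emeasure ?\<nu> (cap_region \<zeta> \<delta>)"
      unfolding bergman_measure_def by (subst emeasure_density) auto
    also have "ennreal ((1 + \<alpha>) * (\<delta> powr \<alpha> / 2 powr \<bar>\<alpha>\<bar>)) * ennreal ((1 / 2) ^ (?m - 1) * (\<delta> / 2) * (c * \<delta> ^ CARD('n)))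
        = ennreal (b * (\<delta> powr \<alpha> * \<delta> * \<delta> ^ CARD('n)))"
      using \<alpha> by (subst ennreal_mult'[symmetric]) (auto simp: b_def mult_ac)
    also have "\<delta> powr \<alpha> * \<delta> * \<delta> ^ CARD('n) = \<delta> powr (real CARD('n) + 1 + \<alpha>)"
      using \<delta> by (simp add: powr_add powr_realpow mult_ac)
    finally show ?thesis .
  qed
  then show ?thesis using b by blast
qed

lemma koranyi_regular_bergman_measure:
  assumes "-1 < \<alpha>"
  shows "koranyi_regular (real CARD('n) + 1 + \<alpha>) (bergman_measure \<alpha> :: (complex ^ 'n) measure)"
proof -
  have "AE w in lborel. w \<noteq> (0 :: complex ^ 'n)" by (rule AE_lborel_singleton)
  then have "AE w in (bergman_measure \<alpha> :: (complex ^ 'n) measure). w \<noteq> 0 \<and> norm w \<le> 1"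
    unfolding bergman_measure_def by (subst AE_density) (auto simp: indicator_def)
  then show ?thesis
    unfolding koranyi_regular_def
    using bergman_measure_cap_region_le[OF assms, where 'n = 'n] bergman_measure_cap_region_ge[OF assms, where 'n = 'n]
    by (simp add: bergman_measure_def)
qed

section \<open>The geometry of the Bergman tree\<close>

definition level_radius :: "nat \<Rightarrow> real" where
  "level_radius N = tanh (real N * theta)"

lemma tanh_artanh:
  fixes x :: real
  assumes "\<bar>x\<bar> < 1"
  shows "tanh (artanh x) = x"
proof -
  have "0 < (1 + x) / (1 - x)" using assms by (intro divide_pos_pos) auto
  then have "exp (- 2 * artanh x) = inverse ((1 + x) / (1 - x))" by (simp add: artanh_def exp_minus)
  then have e: "exp (- 2 * artanh x) = (1 - x) / (1 + x)" by simp
  have "1 + x \<noteq> 0" using assms by auto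
  then show ?thesis unfolding tanh_real_altdef e by (simp add: field_simps)
qed

lemma level_radius_0 [simp]: "level_radius 0 = 0"
  by (simp add: level_radius_def)

lemma level_radius_less_1: "level_radius N < 1" and level_radius_nonneg: "0 \<le> level_radius N"
  by (auto simp: level_radius_def tanh_real_lt_1 theta_def)

lemma level_radius_mono: "M \<le> N \<Longrightarrow> level_radius M \<le> level_radius N"
  by (simp add: level_radius_def theta_def)

text \<open>
  With \<open>E = 2^N\<close> the choice \<open>theta = ln 2 / 2\<close> gives \<open>level_radius N = (E - 1) / (E + 1)\<close>, hence
  \<open>1 - (level_radius N)^2 = 4 E / (E + 1)^2\<close>.
\<close>
lemma level_radius_defect:
  "1 / 2 ^ N \<le> 1 - (level_radius N)\<^sup>2" "1 - (level_radius N)\<^sup>2 \<le> 4 / 2 ^ N"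
proof -
  define E where "E = (2::real) ^ N"
  have E: "1 \<le> E" by (simp add: E_def)
  have "exp (- 2 * (real N * theta)) = exp (- (real N * ln 2))" by (simp add: theta_def)
  also have "\<dots> = 1 / E" by (simp add: exp_minus exp_of_nat_mult E_def field_simps)
  finally have e: "exp (- 2 * (real N * theta)) = 1 / E" .
  have r: "level_radius N = (E - 1) / (E + 1)"
  proof -
    have "1 - 1 / E = (E - 1) / E" "1 + 1 / E = (E + 1) / E"
      using E by (simp_all add: field_simps)
    then show ?thesis unfolding level_radius_def tanh_real_altdef e using E by simp
  qed
  have eq: "1 - (level_radius N)\<^sup>2 = 4 * E / (E + 1)\<^sup>2"
    unfolding r using E by (simp add: power_divide divide_simps) (simp add: power2_eq_square algebra_simps)
  have "(E + 1)\<^sup>2 \<le> (2 * E)\<^sup>2" using E by (intro power_mono) auto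
  then show "1 / 2 ^ N \<le> 1 - (level_radius N)\<^sup>2"
    unfolding eq E_def[symmetric] using E by (simp add: divide_simps power2_eq_square)
  have "E\<^sup>2 \<le> (E + 1)\<^sup>2" using E by (intro power_mono) auto
  then show "1 - (level_radius N)\<^sup>2 \<le> 4 / 2 ^ N"
    unfolding eq E_def[symmetric] using E by (simp add: divide_simps power2_eq_square)
qed

lemma bergman_dist_0_le_iff:
  fixes z :: "complex ^ 'n"
  assumes "z \<in> ball 0 1"
  shows "r \<le> bergman_dist 0 z \<longleftrightarrow> tanh r \<le> norm z" "bergman_dist 0 z < r \<longleftrightarrow> norm z < tanh r"
    "bergman_dist 0 z = r \<longleftrightarrow> norm z = tanh r"
proof -
  have z: "norm z = tanh (bergman_dist 0 z)"
    unfolding bergman_dist_0[OF assms] using assms by (simp add: tanh_artanh)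
  show "r \<le> bergman_dist 0 z \<longleftrightarrow> tanh r \<le> norm z" "bergman_dist 0 z < r \<longleftrightarrow> norm z < tanh r"
    unfolding z by simp_all
  show "bergman_dist 0 z = r \<longleftrightarrow> norm z = tanh r"
    unfolding z by (metis artanh_tanh_real)
qed

lemma bergman_sphere_eq: "bergman_sphere (real N * theta) = {z. norm z = level_radius N}"
  using bergman_dist_0_le_iff(3) level_radius_less_1[of N]
  by (auto simp: bergman_sphere_def level_radius_def)

lemma radial_proj_eq: "radial_proj (real N * theta) z = level_radius N *\<^sub>R sgn z"
  by (simp add: radial_proj_def level_radius_def)

lemma koranyi_radial_proj_le:
  assumes "level_radius N \<le> norm z" "norm z \<le> 1"
  shows "koranyi z (level_radius N *\<^sub>R sgn z) \<le> sqrt (1 - (level_radius N)\<^sup>2)"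
proof (cases "z = 0")
  case True
  then show ?thesis using assms level_radius_nonneg[of N] by simp
next
  case False
  have "z = norm z *\<^sub>R sgn z" using False by (simp add: sgn_div_norm)
  then show ?thesis
    using koranyi_sgn_le[of "sgn z" "level_radius N" "norm z"] False assms level_radius_nonneg[of N]
    by (simp add: norm_sgn)
qed

lemma sqrt_level_defect_le: "sqrt (1 - (level_radius N)\<^sup>2) \<le> 2 * sqrt (1 / 2) ^ N"
proof -
  have "sqrt (1 - (level_radius N)\<^sup>2) \<le> sqrt (4 * (1 / 2) ^ N)"
    using level_radius_defect(2)[of N] by (simp add: power_divide)
  also have "\<dots> = 2 * sqrt (1 / 2) ^ N" by (simp only: real_sqrt_mult real_sqrt_power real_sqrt_four)
  finally show ?thesis .
qed

context bergman_tree
begin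

definition index :: "nat \<Rightarrow> nat set" where
  "index N = (if N = 0 then {1} else {1..J N})"

text \<open>The root is treated like the other vertices, with centre and cell at the origin.\<close>

definition centre :: "vertex \<Rightarrow> complex ^ 'n" where
  "centre \<eta> = (if fst \<eta> = 0 then 0 else c (fst \<eta>) (snd \<eta>))"

definition cell :: "vertex \<Rightarrow> (complex ^ 'n) set" where
  "cell \<eta> = (if fst \<eta> = 0 then {0} else Q (fst \<eta>) (snd \<eta>))"

definition parent :: "vertex \<Rightarrow> vertex" where
  "parent \<eta> = (SOME \<xi>. \<xi> \<in> vertices J \<and> Suc (fst \<xi>) = fst \<eta> \<and> level_radius (fst \<xi>) *\<^sub>R sgn (centre \<eta>) \<in> cell \<xi>)"

text \<open>
  The kubes below \<open>\<eta>\<close>; a tent has the measure \<open>I_star\<close> at its vertex.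
\<close>
definition tent :: "vertex \<Rightarrow> (complex ^ 'n) set" where
  "tent \<eta> = (\<Union>\<beta>\<in>above J c Q \<eta>. kube Q \<beta>)"

lemma vertices_iff: "\<eta> \<in> vertices J \<longleftrightarrow> snd \<eta> \<in> index (fst \<eta>)"
  by (cases \<eta>) (auto simp: vertices_def root_def index_def)

lemma finite_index: "finite (index N)"
  by (simp add: index_def)

lemma countable_vertices: "countable (vertices J)"
  by (rule countable_subset[of _ UNIV]) auto

lemma root_vertex: "root \<in> vertices J"
  by (simp add: vertices_def)

lemma vertex_level_0: "\<eta> \<in> vertices J \<Longrightarrow> fst \<eta> = 0 \<Longrightarrow> \<eta> = root"
  by (cases \<eta>) (auto simp: vertices_def root_def)

lemma norm_centre: "\<eta> \<in> vertices J \<Longrightarrow> norm (centre \<eta>) = level_radius (fst \<eta>)"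
  using center[of "fst \<eta>" "snd \<eta>"] unfolding bergman_sphere_eq
  by (auto simp: centre_def vertices_iff index_def split: if_splits)

lemma centre_ball: "\<eta> \<in> vertices J \<Longrightarrow> centre \<eta> \<in> ball 0 1"
  using level_radius_less_1 by (simp add: norm_centre)

lemma cell_cover:
  assumes "norm w = level_radius N"
  shows "\<exists>\<xi>\<in>vertices J. fst \<xi> = N \<and> w \<in> cell \<xi>"
proof (cases "N = 0")
  case True
  then show ?thesis using assms root_vertex by (intro bexI[of _ root]) (auto simp: cell_def root_def)
next
  case False
  then have "w \<in> (\<Union>j\<in>{1..J N}. Q N j)" using cover[of N] assms unfolding bergman_sphere_eq by auto
  then obtain j where "j \<in> {1..J N}" "w \<in> Q N j" by auto
  then show ?thesis using False by (intro bexI[of _ "(N, j)"]) (auto simp: cell_def vertices_iff index_def)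
qed

lemma cell_unique:
  assumes "\<xi> \<in> vertices J" "\<xi>' \<in> vertices J" "fst \<xi> = fst \<xi>'" "w \<in> cell \<xi>" "w \<in> cell \<xi>'"
  shows "\<xi> = \<xi>'"
proof (cases "fst \<xi> = 0")
  case True
  then show ?thesis using assms vertex_level_0 by metis
next
  case False
  then have "disjoint_family_on (Q (fst \<xi>)) {1..J (fst \<xi>)}" "snd \<xi> \<in> {1..J (fst \<xi>)}" "snd \<xi>' \<in> {1..J (fst \<xi>)}"
      "w \<in> Q (fst \<xi>) (snd \<xi>) \<inter> Q (fst \<xi>) (snd \<xi>')"
    using disjoint[of "fst \<xi>"] assms by (auto simp: cell_def vertices_iff index_def)
  then have "snd \<xi> = snd \<xi>'" using disjoint_family_onD by fastforce
  then show ?thesis using assms(3) by (simp add: prod_eq_iff)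
qed

lemma koranyi_centre_cell:
  assumes \<eta>: "\<eta> \<in> vertices J" and w: "w \<in> cell \<eta>"
  shows "koranyi (centre \<eta>) w \<le> exp 4 * sqrt (1 - (level_radius (fst \<eta>))\<^sup>2)"
proof (cases "fst \<eta> = 0")
  case True
  then show ?thesis using one_le_exp_iff[of "4::real"] by (simp add: centre_def)
next
  case False
  let ?c = "centre \<eta>"
  have w': "w \<in> bergman_sphere (real (fst \<eta>) * theta)" "bergman_dist ?c w < 2"
    using outer_ball[of "fst \<eta>" "snd \<eta>"] \<eta> w False by (auto simp: cell_def centre_def vertices_iff index_def)
  then have "w \<in> ball 0 1" using level_radius_less_1 by (simp add: bergman_sphere_eq)
  then have "(koranyi ?c w)\<^sup>2 \<le> exp (4 * 2) * (koranyi ?c ?c)\<^sup>2"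
    using centre_ball[OF \<eta>] w' by (intro koranyi_le_bergman_dist) auto
  also have "\<dots> = (exp 4)\<^sup>2 * (1 - (level_radius (fst \<eta>))\<^sup>2)"
    using centre_ball[OF \<eta>] by (simp add: koranyi_self norm_centre[OF \<eta>] exp_double[symmetric])
  finally have "(koranyi ?c w)\<^sup>2 \<le> (exp 4)\<^sup>2 * (1 - (level_radius (fst \<eta>))\<^sup>2)" .
  from real_le_rsqrt[OF this] show ?thesis by (simp add: real_sqrt_mult)
qed

lemma parent:
  assumes \<eta>: "\<eta> \<in> vertices J" "fst \<eta> = Suc N"
  shows "parent \<eta> \<in> vertices J" "fst (parent \<eta>) = N" "level_radius N *\<^sub>R sgn (centre \<eta>) \<in> cell (parent \<eta>)"
proof -
  have "0 < level_radius (Suc N)" by (simp add: level_radius_def theta_def)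
  then have "centre \<eta> \<noteq> 0" using norm_centre[OF \<eta>(1)] \<eta>(2) by auto
  then have "norm (level_radius N *\<^sub>R sgn (centre \<eta>)) = level_radius N"
    using level_radius_nonneg[of N] by (simp add: norm_sgn)
  from cell_cover[OF this]
  have "\<exists>\<xi>. \<xi> \<in> vertices J \<and> Suc (fst \<xi>) = fst \<eta> \<and> level_radius (fst \<xi>) *\<^sub>R sgn (centre \<eta>) \<in> cell \<xi>"
    using \<eta>(2) by auto
  from someI_ex[OF this, folded parent_def]
  show "parent \<eta> \<in> vertices J" "fst (parent \<eta>) = N" "level_radius N *\<^sub>R sgn (centre \<eta>) \<in> cell (parent \<eta>)"
    using \<eta>(2) by auto
qed

lemma parent_unique:
  assumes "\<eta> \<in> vertices J" "\<xi> \<in> vertices J" "fst \<eta> = Suc (fst \<xi>)" "level_radius (fst \<xi>) *\<^sub>R sgn (centre \<eta>) \<in> cell \<xi>"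
  shows "parent \<eta> = \<xi>"
  by (rule cell_unique[OF parent(1)[OF assms(1,3)] assms(2) parent(2,3)[OF assms(1,3)] assms(4)])

lemma children_iff: "(\<xi>, \<eta>) \<in> children J c Q \<longleftrightarrow> \<eta> \<in> vertices J \<and> fst \<eta> \<noteq> 0 \<and> \<xi> = parent \<eta>"
proof
  assume "(\<xi>, \<eta>) \<in> children J c Q"
  then have "\<eta> \<in> vertices J \<and> \<xi> \<in> vertices J \<and> fst \<eta> = Suc (fst \<xi>) \<and> level_radius (fst \<xi>) *\<^sub>R sgn (centre \<eta>) \<in> cell \<xi>"
    unfolding children_def radial_proj_eq
    by (auto simp: vertices_iff root_def index_def cell_def centre_def)
  then show "\<eta> \<in> vertices J \<and> fst \<eta> \<noteq> 0 \<and> \<xi> = parent \<eta>"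
    using parent_unique[of \<eta> \<xi>] by auto
next
  assume "\<eta> \<in> vertices J \<and> fst \<eta> \<noteq> 0 \<and> \<xi> = parent \<eta>"
  then have \<eta>: "\<eta> \<in> vertices J" "fst \<eta> \<noteq> 0" "\<xi> = parent \<eta>" by auto
  then obtain N where N: "fst \<eta> = Suc N" using not0_implies_Suc by auto
  note p = parent[OF \<eta>(1) N, folded \<eta>(3)]
  show "(\<xi>, \<eta>) \<in> children J c Q"
  proof (cases "N = 0")
    case True
    then have "\<xi> = root" using p vertex_level_0[of \<xi>] by simp
    then show ?thesis using \<eta>(1) N True unfolding children_def
      by (cases \<eta>) (auto simp: vertices_iff index_def)
  next
    case False
    then show ?thesis using \<eta>(1) N p unfolding children_def radial_proj_eq
      by (cases \<eta>; cases \<xi>) (auto simp: vertices_iff index_def cell_def centre_def)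
  qed
qed

lemma ancestor:
  assumes "\<beta> \<in> vertices J" "k \<le> fst \<beta>"
  shows "(parent ^^ k) \<beta> \<in> vertices J \<and> fst ((parent ^^ k) \<beta>) = fst \<beta> - k"
  using assms(2)
proof (induction k)
  case (Suc k)
  then have "(parent ^^ k) \<beta> \<in> vertices J" "fst ((parent ^^ k) \<beta>) = Suc (fst \<beta> - Suc k)" by auto
  from parent[OF this] show ?case by simp
qed (use assms in simp)

lemma path_to_vertex:
  assumes "\<beta> \<in> vertices J" "i < fst \<beta>"
  shows "((parent ^^ (fst \<beta> - i)) \<beta>, (parent ^^ (fst \<beta> - Suc i)) \<beta>) \<in> children J c Q"
proof -
  let ?\<eta> = "(parent ^^ (fst \<beta> - Suc i)) \<beta>"
  have "?\<eta> \<in> vertices J" "fst ?\<eta> \<noteq> 0" using ancestor[OF assms(1), of "fst \<beta> - Suc i"] assms(2) by auto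
  moreover have "fst \<beta> - i = Suc (fst \<beta> - Suc i)" using assms(2) by simp
  then have "(parent ^^ (fst \<beta> - i)) \<beta> = parent ?\<eta>" by simp
  ultimately show ?thesis unfolding children_iff by auto
qed

lemma children_level: "(\<xi>, \<eta>) \<in> children J c Q \<Longrightarrow> fst \<eta> = Suc (fst \<xi>)"
  unfolding children_iff using parent(2)[of \<eta> "fst \<eta> - 1"] by simp

abbreviation edges :: "vertex rel" where
  "edges \<equiv> children J c Q \<union> (children J c Q)\<inverse>"

lemma level_le_path_length:
  "(\<xi>, \<eta>) \<in> edges ^^ k \<Longrightarrow> fst \<eta> \<le> fst \<xi> + k"
proof (induction k arbitrary: \<eta>)
  case (Suc k)
  then obtain \<zeta> where "fst \<zeta> \<le> fst \<xi> + k" "(\<zeta>, \<eta>) \<in> edges" by auto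
  then have "fst \<eta> = Suc (fst \<zeta>) \<or> fst \<zeta> = Suc (fst \<eta>)"
    using children_level[of \<zeta> \<eta>] children_level[of \<eta> \<zeta>] by blast
  then show ?case using \<open>fst \<zeta> \<le> fst \<xi> + k\<close> by auto
qed simp

lemma depth_eq:
  assumes \<beta>: "\<beta> \<in> vertices J"
  shows "depth J c Q \<beta> = fst \<beta>"
  unfolding depth_def
proof (rule Least_equality)
  have "(parent ^^ fst \<beta>) \<beta> = root"
    using ancestor[OF \<beta> order_refl] vertex_level_0[of "(parent ^^ fst \<beta>) \<beta>"] by simp
  then show "(root, \<beta>) \<in> edges ^^ fst \<beta>"
    unfolding relpow_fun_conv using path_to_vertex[OF \<beta>]
    by (intro exI[of _ "\<lambda>i. (parent ^^ (fst \<beta> - i)) \<beta>"] conjI allI impI UnI1) simp_all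
next
  fix k assume "(root, \<beta>) \<in> edges ^^ k"
  from level_le_path_length[OF this] show "fst \<beta> \<le> k" by (simp add: root_def)
qed

text \<open>
  Each edge changes the level by one, so a path from the root whose length is the level of its
  end point must descend in every step and is the chain of ancestors.
\<close>
lemma geodesic_unique:
  assumes p: "p 0 = root" "p (fst \<beta>) = \<beta>"
    and step: "\<forall>i<fst \<beta>. (p i, p (Suc i)) \<in> edges" and i: "i \<le> fst \<beta>"
  shows "p i = (parent ^^ (fst \<beta> - i)) \<beta>"
proof -
  have st: "(p j, p (Suc j)) \<in> edges" if "j < fst \<beta>" for j
    using step[rule_format, OF that] .
  have lev: "fst (p i) = i" if "i \<le> fst \<beta>" for i
  proof -
    have "(p 0, p i) \<in> edges ^^ i"
      unfolding relpow_fun_conv by (intro exI[of _ p] conjI refl allI impI st) (use that in simp)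
    from level_le_path_length[OF this] have "fst (p i) \<le> i" unfolding p(1) by (simp add: root_def)
    have "(p i, p (fst \<beta>)) \<in> edges ^^ (fst \<beta> - i)"
      unfolding relpow_fun_conv
    proof (intro exI[of _ "\<lambda>k. p (i + k)"] conjI allI impI)
      fix k assume "k < fst \<beta> - i"
      then show "(p (i + k), p (i + Suc k)) \<in> edges" using st[of "i + k"] by simp
    qed (use that in simp_all)
    from level_le_path_length[OF this] have "fst \<beta> \<le> fst (p i) + (fst \<beta> - i)" unfolding p(2) .
    with \<open>fst (p i) \<le> i\<close> show ?thesis using that by simp
  qed
  have par: "p i = parent (p (Suc i))" if "i < fst \<beta>" for i
  proof -
    have "fst (p i) \<noteq> Suc (fst (p (Suc i)))" using lev[of i] lev[of "Suc i"] that by simp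
    then have "(p (Suc i), p i) \<notin> children J c Q" using children_level by blast
    then have "(p i, p (Suc i)) \<in> children J c Q" using st[OF that] by blast
    then show ?thesis by (simp add: children_iff)
  qed
  show ?thesis
    using i
  proof (induction i rule: inc_induct)
    case base
    then show ?case using p by simp
  next
    case (step i)
    then have "fst \<beta> - i = Suc (fst \<beta> - Suc i)" by simp
    then show ?case using par[of i] step by simp
  qed
qed

lemma above_eq: "above J c Q \<eta> = {\<beta> \<in> vertices J. \<exists>k. (parent ^^ k) \<beta> = \<eta> \<and> fst \<eta> + k = fst \<beta>}"
proof (intro subset_antisym subsetI)
  fix \<beta> assume "\<beta> \<in> above J c Q \<eta>"
  then obtain p where \<beta>: "\<beta> \<in> vertices J" and p: "p 0 = root" "p (depth J c Q \<beta>) = \<beta>"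
    "\<forall>i<depth J c Q \<beta>. (p i, p (Suc i)) \<in> edges" "\<eta> \<in> p ` {..depth J c Q \<beta>}"
    unfolding above_def mem_Collect_eq by blast
  note p = p[unfolded depth_eq[OF \<beta>]]
  from p(4) obtain i where i: "i \<le> fst \<beta>" "\<eta> = p i" by auto
  then have "(parent ^^ (fst \<beta> - i)) \<beta> = \<eta>" using geodesic_unique[OF p(1-3)] by simp
  moreover from this have "fst \<eta> + (fst \<beta> - i) = fst \<beta>" using ancestor[OF \<beta>, of "fst \<beta> - i"] i by auto
  ultimately show "\<beta> \<in> {\<beta> \<in> vertices J. \<exists>k. (parent ^^ k) \<beta> = \<eta> \<and> fst \<eta> + k = fst \<beta>}" using \<beta> by blast
next
  fix \<beta> assume "\<beta> \<in> {\<beta> \<in> vertices J. \<exists>k. (parent ^^ k) \<beta> = \<eta> \<and> fst \<eta> + k = fst \<beta>}"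
  then obtain k where \<beta>: "\<beta> \<in> vertices J" and k: "(parent ^^ k) \<beta> = \<eta>" "fst \<eta> + k = fst \<beta>" by auto
  let ?p = "\<lambda>i. (parent ^^ (fst \<beta> - i)) \<beta>"
  have "?p 0 = root" using ancestor[OF \<beta> order_refl] vertex_level_0[of "?p 0"] by simp
  moreover have "\<eta> = ?p (fst \<eta>)" using k by (metis add_diff_cancel_left')
  then have "\<eta> \<in> ?p ` {..fst \<beta>}" using k(2) by (metis (no_types) atMost_iff image_eqI le_add1)
  ultimately show "\<beta> \<in> above J c Q \<eta>"
    unfolding above_def mem_Collect_eq depth_eq[OF \<beta>] using \<beta> path_to_vertex[OF \<beta>]
    by (intro conjI exI[of _ ?p] allI impI UnI1) simp_all
qed

lemma self_above: "\<eta> \<in> vertices J \<Longrightarrow> \<eta> \<in> above J c Q \<eta>"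
  unfolding above_eq by (auto intro!: exI[of _ 0])

lemma above_subset: "above J c Q \<eta> \<subseteq> vertices J"
  unfolding above_eq by auto

lemma aboveD: "\<beta> \<in> above J c Q \<eta> \<Longrightarrow> \<beta> \<in> vertices J"
  using above_subset by blast

lemma above_level: "\<beta> \<in> above J c Q \<eta> \<Longrightarrow> fst \<eta> \<le> fst \<beta>"
  unfolding above_eq by auto

lemma above_mono: "\<beta> \<in> above J c Q \<eta> \<Longrightarrow> above J c Q \<beta> \<subseteq> above J c Q \<eta>"
proof
  fix \<gamma> assume \<beta>: "\<beta> \<in> above J c Q \<eta>" and \<gamma>: "\<gamma> \<in> above J c Q \<beta>"
  obtain k l where "(parent ^^ k) \<beta> = \<eta>" "fst \<eta> + k = fst \<beta>" "(parent ^^ l) \<gamma> = \<beta>" "fst \<beta> + l = fst \<gamma>"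
    using \<beta> \<gamma> unfolding above_eq by blast
  then have "(parent ^^ (k + l)) \<gamma> = \<eta>" "fst \<eta> + (k + l) = fst \<gamma>" by (auto simp: funpow_add)
  then show "\<gamma> \<in> above J c Q \<eta>" using \<gamma> unfolding above_eq by blast
qed

lemma above_same_level:
  assumes "\<beta> \<in> above J c Q \<eta>" "\<beta> \<in> above J c Q \<eta>'" "fst \<eta> = fst \<eta>'"
  shows "\<eta> = \<eta>'"
proof -
  obtain k l where kl: "(parent ^^ k) \<beta> = \<eta>" "fst \<eta> + k = fst \<beta>" "(parent ^^ l) \<beta> = \<eta>'" "fst \<eta>' + l = fst \<beta>"
    using assms(1,2) unfolding above_eq by blast
  then have "k = l" using assms(3) by simp
  then show ?thesis using kl by simp
qed

lemma child_above: "\<eta> \<in> vertices J \<Longrightarrow> fst \<eta> = Suc N \<Longrightarrow> \<eta> \<in> above J c Q (parent \<eta>)"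
  unfolding above_eq using parent(2)[of \<eta> N] by (auto intro!: exI[of _ 1])

lemma above_root: "above J c Q root = vertices J"
proof -
  have "\<beta> \<in> above J c Q root" if "\<beta> \<in> vertices J" for \<beta>
    using ancestor[OF that order_refl] vertex_level_0[of "(parent ^^ fst \<beta>) \<beta>"] that
    unfolding above_eq by (auto simp: root_def)
  then show ?thesis using above_subset by blast
qed

lemma kube_eq:
  assumes "\<eta> \<in> vertices J"
  shows "kube Q \<eta> = {z. norm z < 1 \<and> level_radius (fst \<eta>) \<le> norm z \<and> norm z < level_radius (Suc (fst \<eta>)) \<and>
    level_radius (fst \<eta>) *\<^sub>R sgn z \<in> cell \<eta>}"
proof (cases "fst \<eta> = 0")
  case True
  then show ?thesis using bergman_dist_0_le_iff(2)[where r = theta and 'n = 'n]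
    by (cases \<eta>) (auto simp: kube_def cell_def level_radius_def)
next
  case False
  then show ?thesis
    using bergman_dist_0_le_iff(1)[where r = "real (fst \<eta>) * theta" and 'n = 'n]
      bergman_dist_0_le_iff(2)[where r = "(real (fst \<eta>) + 1) * theta" and 'n = 'n]
    by (cases \<eta>) (auto simp: kube_def cell_def level_radius_def radial_proj_def add.commute)
qed

lemma kube_ball: "\<eta> \<in> vertices J \<Longrightarrow> kube Q \<eta> \<subseteq> ball 0 1"
  by (auto simp: kube_eq)

lemma cell_sets [measurable]: "\<eta> \<in> vertices J \<Longrightarrow> cell \<eta> \<in> sets borel"
  using borel[of "fst \<eta>" "snd \<eta>"] by (auto simp: cell_def vertices_iff index_def)

lemma kube_sets [measurable]: "\<eta> \<in> vertices J \<Longrightarrow> kube Q \<eta> \<in> sets borel"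
  by (subst kube_eq) measurable

lemma tent_sets [measurable]: "tent \<eta> \<in> sets borel"
  unfolding tent_def using countable_subset[OF above_subset countable_vertices] aboveD kube_sets
  by (intro sets.countable_UN') blast+

lemma tent_ball: "tent \<eta> \<subseteq> ball 0 1"
  unfolding tent_def using aboveD kube_ball by blast

lemma kube_unique:
  assumes "\<xi> \<in> vertices J" "\<eta> \<in> vertices J" "z \<in> kube Q \<xi>" "z \<in> kube Q \<eta>"
  shows "\<xi> = \<eta>"
proof -
  have "fst \<xi> \<le> fst \<eta>" if "\<xi> \<in> vertices J" "\<eta> \<in> vertices J" "z \<in> kube Q \<xi>" "z \<in> kube Q \<eta>" for \<xi> \<eta>
    using that level_radius_mono[of "Suc (fst \<eta>)" "fst \<xi>"] by (force simp: kube_eq)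
  then have "fst \<xi> = fst \<eta>" using assms by (intro antisym) blast+
  then show ?thesis using assms by (intro cell_unique[of \<xi> \<eta> "level_radius (fst \<xi>) *\<^sub>R sgn z"]) (auto simp: kube_eq)
qed

lemma kube_cover:
  assumes z: "norm z < 1"
  shows "\<exists>\<beta>\<in>vertices J. z \<in> kube Q \<beta>"
proof -
  define N where "N = nat \<lfloor>artanh (norm z) / theta\<rfloor>"
  have th: "0 < theta" by (simp add: theta_def)
  have a: "norm z = tanh (artanh (norm z))" using z by (simp add: tanh_artanh)
  then have "0 \<le> artanh (norm z)" by (metis norm_ge_zero tanh_real_nonneg_iff)
  then have "real N \<le> artanh (norm z) / theta" "artanh (norm z) / theta < real (Suc N)"
    unfolding N_def using th by (auto simp: of_nat_nat) (linarith)
  then have N: "level_radius N \<le> norm z" "norm z < level_radius (Suc N)"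
    unfolding level_radius_def using th by (subst a, simp add: field_simps)+
  have "norm (level_radius N *\<^sub>R sgn z) = level_radius N"
    using N(1) level_radius_nonneg[of N] by (cases "z = 0") (auto simp: norm_sgn)
  then obtain \<xi> where "\<xi> \<in> vertices J" "fst \<xi> = N" "level_radius N *\<^sub>R sgn z \<in> cell \<xi>"
    using cell_cover by blast
  then show ?thesis using N z by (intro bexI[of _ \<xi>]) (auto simp: kube_eq)
qed

lemma tent_disjoint:
  assumes "z \<in> tent \<eta>" "z \<in> tent \<eta>'" "fst \<eta> = fst \<eta>'"
  shows "\<eta> = \<eta>'"
proof -
  obtain \<beta> \<beta>' where "\<beta> \<in> above J c Q \<eta>" "z \<in> kube Q \<beta>" "\<beta>' \<in> above J c Q \<eta>'" "z \<in> kube Q \<beta>'"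
    using assms by (auto simp: tent_def)
  moreover from this have "\<beta> = \<beta>'" using aboveD kube_unique by blast
  ultimately show ?thesis using above_same_level assms(3) by blast
qed

lemma tent_parent: "\<eta> \<in> vertices J \<Longrightarrow> fst \<eta> = Suc N \<Longrightarrow> tent \<eta> \<subseteq> tent (parent \<eta>)"
  unfolding tent_def using above_mono[OF child_above] by blast

lemma tent_above: "\<beta> \<in> above J c Q \<eta> \<Longrightarrow> tent \<beta> \<subseteq> tent \<eta>"
  unfolding tent_def using above_mono by blast

lemma tent_root: "tent root = ball 0 1"
proof -
  have "ball 0 1 \<subseteq> tent root" unfolding tent_def above_root using kube_cover by auto
  then show ?thesis using tent_ball by blast
qed

text \<open>
  The vertex is the ancestor at level \<open>N\<close> of the kube containing \<open>z\<close>. The hypothesis on \<open>z\<close> ensures that this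
  kube has level at least \<open>N\<close>.
\<close>
lemma tent_cover:
  assumes z: "norm z < 1" and N: "N = 0 \<or> 1 - (norm z)\<^sup>2 < 1 / 2 ^ N"
  shows "\<exists>\<eta>\<in>vertices J. fst \<eta> = N \<and> z \<in> tent \<eta>"
proof -
  obtain \<beta> where \<beta>: "\<beta> \<in> vertices J" "z \<in> kube Q \<beta>" using kube_cover[OF z] by auto
  have "N \<le> fst \<beta>"
  proof (rule ccontr)
    assume "\<not> N \<le> fst \<beta>"
    then have "norm z < level_radius N" "N \<noteq> 0"
      using \<beta> level_radius_mono[of "Suc (fst \<beta>)" N] by (auto simp: kube_eq)
    then have "(norm z)\<^sup>2 \<le> (level_radius N)\<^sup>2" by (intro power_mono) auto
    then show False using N \<open>N \<noteq> 0\<close> level_radius_defect(1)[of N] by auto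
  qed
  then have "(parent ^^ (fst \<beta> - N)) \<beta> \<in> vertices J \<and> fst ((parent ^^ (fst \<beta> - N)) \<beta>) = N"
    using ancestor[OF \<beta>(1), of "fst \<beta> - N"] by auto
  moreover from this have "\<beta> \<in> above J c Q ((parent ^^ (fst \<beta> - N)) \<beta>)"
    using \<beta>(1) \<open>N \<le> fst \<beta>\<close> unfolding above_eq by auto
  then have "z \<in> tent ((parent ^^ (fst \<beta> - N)) \<beta>)" using \<beta>(2) by (auto simp: tent_def)
  ultimately show ?thesis by blast
qed

lemma I_star_eq:
  assumes "sets \<mu> = sets (restrict_space borel (ball 0 1))"
  shows "I_star J c Q \<mu> \<eta> = emeasure \<mu> (tent \<eta>)"
proof -
  have "kube Q \<beta> \<in> sets \<mu>" if "\<beta> \<in> above J c Q \<eta>" for \<beta>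
    unfolding assms sets_restrict_space using kube_sets[OF aboveD[OF that]] kube_ball[OF aboveD[OF that]]
    by (intro image_eqI[of _ _ "kube Q \<beta>"]) auto
  moreover have "disjoint_family_on (kube Q) (above J c Q \<eta>)"
    unfolding disjoint_family_on_def using kube_unique above_subset by blast
  moreover have "countable (above J c Q \<eta>)" using above_subset countable_vertices countable_subset by blast
  ultimately show ?thesis unfolding I_star_def tent_def by (intro emeasure_UN_countable[symmetric])
qed

text \<open>
  The steps from a centre to the centre of its parent decrease geometrically towards the boundary,
  so their sum along a chain of descendants is comparable to the first one.
\<close>

definition tent_const :: real where
  "tent_const = 2 * (1 + exp 4) / (1 - sqrt (1 / 2))"

lemma tent_const_ge: "2 \<le> tent_const" "2 * (1 + exp 4) \<le> tent_const"
proof -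
  define A where "A = 2 * (1 + exp (4::real))"
  define q where "q = sqrt (1 / 2 :: real)"
  have q: "0 < q" "q < 1" by (simp_all add: q_def)
  have A: "2 \<le> A" unfolding A_def by simp
  have "A \<le> A / (1 - q)" using A q by (simp add: pos_le_divide_eq)
  then show "2 * (1 + exp 4) \<le> tent_const" "2 \<le> tent_const"
    using A unfolding tent_const_def A_def q_def by linarith+
qed

lemma koranyi_centre_ancestor:
  assumes \<beta>: "\<beta> \<in> vertices J" and k: "k \<le> fst \<beta>"
  shows "koranyi (centre ((parent ^^ k) \<beta>)) (centre \<beta>) \<le> tent_const * sqrt (1 / 2) ^ (fst \<beta> - k)"
proof -
  define q where "q = sqrt (1 / 2 :: real)"
  have q: "0 < q" "q < 1" by (simp_all add: q_def)
  define A where "A = 2 * (1 + exp (4::real))"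
  have A: "0 < A" unfolding A_def by (simp add: add_pos_pos)
  have T: "tent_const * (1 - q) = A" unfolding tent_const_def A_def q_def[symmetric] using q by simp
  have "koranyi (centre ((parent ^^ k) \<beta>)) (centre \<beta>) \<le>
      koranyi (centre \<beta>) (centre \<beta>) + tent_const * (q ^ (fst \<beta> - k) - q ^ fst \<beta>)"
    using k
  proof (induction k)
    case (Suc k)
    define \<xi> where "\<xi> = (parent ^^ k) \<beta>"
    define N where "N = fst \<beta> - Suc k"
    have N: "fst \<beta> - k = Suc N" using Suc.prems by (simp add: N_def)
    have \<xi>: "\<xi> \<in> vertices J" "fst \<xi> = Suc N"
      using ancestor[OF \<beta>, of k] Suc.prems N by (auto simp: \<xi>_def)
    note p = parent[OF \<xi>]
    let ?w = "level_radius N *\<^sub>R sgn (centre \<xi>)"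
    have w: "norm ?w \<le> 1" using level_radius_less_1[of N] level_radius_nonneg[of N]
      by (cases "centre \<xi> = 0") (auto simp: norm_sgn)
    have n: "norm (centre \<xi>) \<le> 1" "norm (centre (parent \<xi>)) \<le> 1" "norm (centre \<beta>) \<le> 1"
      using level_radius_less_1 less_imp_le by (auto simp: norm_centre \<beta> \<xi> p)
    have "koranyi (centre (parent \<xi>)) (centre \<xi>) \<le> koranyi (centre (parent \<xi>)) ?w + koranyi ?w (centre \<xi>)"
      by (rule koranyi_triangle) (use n w in auto)
    also have "koranyi (centre (parent \<xi>)) ?w \<le> exp 4 * sqrt (1 - (level_radius N)\<^sup>2)"
      using koranyi_centre_cell[OF p(1,3)] p(2) by simp
    also have "koranyi ?w (centre \<xi>) \<le> sqrt (1 - (level_radius N)\<^sup>2)"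
      using koranyi_radial_proj_le[of N "centre \<xi>"] n(1) level_radius_mono[of N "Suc N"]
      by (simp add: koranyi_commute norm_centre[OF \<xi>(1)] \<xi>(2))
    finally have "koranyi (centre (parent \<xi>)) (centre \<xi>) \<le> (1 + exp 4) * sqrt (1 - (level_radius N)\<^sup>2)"
      by (simp add: algebra_simps)
    also have "\<dots> \<le> (1 + exp 4) * (2 * q ^ N)"
      unfolding q_def by (intro mult_left_mono sqrt_level_defect_le) (simp add: add_nonneg_nonneg)
    also have "\<dots> = tent_const * (q ^ N - q ^ Suc N)"
    proof -
      have "tent_const * (q ^ N - q ^ Suc N) = tent_const * (1 - q) * q ^ N" by (simp add: algebra_simps)
      then show ?thesis unfolding T A_def by simp
    qed
    finally have "koranyi (centre (parent \<xi>)) (centre \<beta>) \<le>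
        tent_const * (q ^ N - q ^ Suc N) + koranyi (centre \<xi>) (centre \<beta>)"
      using koranyi_triangle[of "centre (parent \<xi>)" "centre \<beta>" "centre \<xi>"] n by simp
    also have "koranyi (centre \<xi>) (centre \<beta>) \<le> koranyi (centre \<beta>) (centre \<beta>) + tent_const * (q ^ Suc N - q ^ fst \<beta>)"
      using Suc N by (simp add: \<xi>_def)
    finally show ?case by (simp add: \<xi>_def N_def algebra_simps)
  qed simp
  also have "koranyi (centre \<beta>) (centre \<beta>) \<le> tent_const * q ^ fst \<beta>"
  proof -
    have "(koranyi (centre \<beta>) (centre \<beta>))\<^sup>2 = 1 - (level_radius (fst \<beta>))\<^sup>2"
      using centre_ball[OF \<beta>] by (simp add: koranyi_self norm_centre[OF \<beta>])
    then have "koranyi (centre \<beta>) (centre \<beta>) = sqrt (1 - (level_radius (fst \<beta>))\<^sup>2)"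
      by (metis koranyi_nonneg real_sqrt_abs abs_of_nonneg)
    also have "\<dots> \<le> 2 * q ^ fst \<beta>" unfolding q_def by (rule sqrt_level_defect_le)
    also have "\<dots> \<le> tent_const * q ^ fst \<beta>"
      using q tent_const_ge(1) by (intro mult_right_mono) auto
    finally show ?thesis .
  qed
  finally show ?thesis by (simp add: q_def algebra_simps)
qed

lemma koranyi_tent:
  assumes \<eta>: "\<eta> \<in> vertices J" and z: "z \<in> tent \<eta>"
  shows "koranyi (centre \<eta>) z \<le> 2 * tent_const * sqrt (1 / 2) ^ fst \<eta>"
proof -
  define q where "q = sqrt (1 / 2 :: real)"
  have q: "0 < q" "q < 1" by (simp_all add: q_def)
  obtain \<beta> where \<beta>: "\<beta> \<in> above J c Q \<eta>" "z \<in> kube Q \<beta>" using z by (auto simp: tent_def)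
  then obtain k where k: "(parent ^^ k) \<beta> = \<eta>" "fst \<eta> + k = fst \<beta>" and \<beta>V: "\<beta> \<in> vertices J"
    unfolding above_eq by blast
  let ?M = "fst \<beta>"
  let ?w = "level_radius ?M *\<^sub>R sgn z"
  have z': "norm z \<le> 1" "level_radius ?M \<le> norm z" "?w \<in> cell \<beta>" using \<beta>(2) by (auto simp: kube_eq[OF \<beta>V])
  have n: "norm (centre \<eta>) \<le> 1" "norm (centre \<beta>) \<le> 1"
    using level_radius_less_1 less_imp_le by (auto simp: norm_centre \<beta>V \<eta>)
  have w: "norm ?w \<le> 1" using level_radius_less_1[of ?M] level_radius_nonneg[of ?M]
    by (cases "z = 0") (auto simp: norm_sgn)
  have "koranyi (centre \<beta>) z \<le> koranyi (centre \<beta>) ?w + koranyi ?w z"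
    by (rule koranyi_triangle) (use n w z' in auto)
  also have "\<dots> \<le> exp 4 * sqrt (1 - (level_radius ?M)\<^sup>2) + sqrt (1 - (level_radius ?M)\<^sup>2)"
    using koranyi_centre_cell[OF \<beta>V z'(3)] koranyi_radial_proj_le[OF z'(2,1)]
    by (intro add_mono) (auto simp: koranyi_commute)
  also have "\<dots> = (1 + exp 4) * sqrt (1 - (level_radius ?M)\<^sup>2)" by (simp add: algebra_simps)
  also have "\<dots> \<le> (1 + exp 4) * (2 * q ^ ?M)"
    unfolding q_def by (intro mult_left_mono sqrt_level_defect_le) (simp add: add_nonneg_nonneg)
  also have "\<dots> = 2 * (1 + exp 4) * q ^ ?M" by simp
  also have "\<dots> \<le> tent_const * q ^ fst \<eta>"
    using q k(2) tent_const_ge by (intro mult_mono power_decreasing) (auto simp: add_nonneg_nonneg)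
  finally have 1: "koranyi (centre \<beta>) z \<le> tent_const * q ^ fst \<eta>" .
  have "koranyi (centre \<eta>) (centre \<beta>) \<le> tent_const * q ^ fst \<eta>"
    using koranyi_centre_ancestor[OF \<beta>V, of k] unfolding k(1) k(2)[symmetric] by (simp add: q_def)
  with 1 show ?thesis
    using koranyi_triangle[of "centre \<eta>" z "centre \<beta>"] n z'(1) by (simp add: q_def)
qed

lemma bergman_dist_self_less_1:
  assumes "z \<in> ball 0 1"
  shows "bergman_dist z z < 1"
proof -
  have "(norm z)\<^sup>2 \<le> 1" using assms by (simp add: power_le_one)
  then show ?thesis using bergman_dist_less_1[of z 0] assms by simp
qed

text \<open>
  The centre of \<open>\<xi>\<close> lies in its own cell, by the inner ball; if it were within distance \<open>1\<close> of the centre of \<open>\<eta>\<close>,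
  it would also lie in the disjoint cell of \<open>\<eta>\<close>.
\<close>
lemma centres_separated:
  assumes \<eta>: "\<eta> \<in> vertices J" and \<xi>: "\<xi> \<in> vertices J" and lev: "fst \<eta> = fst \<xi>" and ne: "\<eta> \<noteq> \<xi>"
  shows "1 \<le> bergman_dist (centre \<eta>) (centre \<xi>)"
proof (rule ccontr)
  assume "\<not> 1 \<le> bergman_dist (centre \<eta>) (centre \<xi>)"
  then have d: "bergman_dist (centre \<eta>) (centre \<xi>) < 1" by simp
  have nz: "fst \<eta> \<noteq> 0" using vertex_level_0[OF \<eta>] vertex_level_0[OF \<xi>] lev ne by auto
  have inner: "{w \<in> bergman_sphere (real (fst \<eta>) * theta). bergman_dist (centre \<zeta>) w < 1} \<subseteq> cell \<zeta>"
    if "\<zeta> \<in> vertices J" "fst \<zeta> = fst \<eta>" for \<zeta>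
    using inner_ball[of "fst \<zeta>" "snd \<zeta>"] that nz by (auto simp: centre_def cell_def vertices_iff index_def)
  have s: "centre \<xi> \<in> bergman_sphere (real (fst \<eta>) * theta)"
    by (simp add: bergman_sphere_eq norm_centre[OF \<xi>] lev)
  have "centre \<xi> \<in> cell \<eta>" using inner[OF \<eta> refl] s d by blast
  moreover have "centre \<xi> \<in> cell \<xi>"
    using inner[OF \<xi> lev[symmetric]] s bergman_dist_self_less_1[OF centre_ball[OF \<xi>]] by blast
  ultimately show False using cell_unique[OF \<eta> \<xi> lev] ne by blast
qed

lemma neighbours_bounded:
  assumes B: "0 \<le> B"
  shows "\<exists>M. \<forall>\<eta>\<in>vertices J. card {\<xi> \<in> vertices J. fst \<xi> = fst \<eta> \<and>
    koranyi (centre \<eta>) (centre \<xi>) \<le> B * sqrt (1 / 2) ^ fst \<eta>} \<le> M"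
proof -
  obtain M where M: "\<And>(a :: complex ^ 'n) X. a \<in> ball 0 1 \<and> X \<subseteq> ball 0 1 \<and>
     (\<forall>x\<in>X. 1 - (norm x)\<^sup>2 = 1 - (norm a)\<^sup>2 \<and> (koranyi a x)\<^sup>2 \<le> B\<^sup>2 * (1 - (norm a)\<^sup>2)) \<and>
     (\<forall>x\<in>X. \<forall>y\<in>X. x \<noteq> y \<longrightarrow> 1 \<le> bergman_dist x y) \<Longrightarrow> card X \<le> M"
    using bergman_separated_card_bound[OF B, where 'n = 'n] by (elim exE) blast
  have "card {\<xi> \<in> vertices J. fst \<xi> = fst \<eta> \<and> koranyi (centre \<eta>) (centre \<xi>) \<le> B * sqrt (1 / 2) ^ fst \<eta>} \<le> M"
    (is "card ?N \<le> M") if \<eta>: "\<eta> \<in> vertices J" for \<eta>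
  proof -
    have "card (centre ` ?N) \<le> M"
    proof (rule M[of "centre \<eta>"], intro conjI ballI impI)
      fix x assume "x \<in> centre ` ?N"
      then obtain \<xi> where \<xi>: "\<xi> \<in> vertices J" "fst \<xi> = fst \<eta>" "x = centre \<xi>"
        and k: "koranyi (centre \<eta>) x \<le> B * sqrt (1 / 2) ^ fst \<eta>" by auto
      have "(koranyi (centre \<eta>) x)\<^sup>2 \<le> (B * sqrt (1 / 2) ^ fst \<eta>)\<^sup>2" using k by (intro power_mono) auto
      also have "\<dots> = B\<^sup>2 * (1 / 2 ^ fst \<eta>)"
      proof -
        have "(sqrt (1 / 2) ^ fst \<eta>)\<^sup>2 = ((sqrt (1 / 2))\<^sup>2) ^ fst \<eta>" by (simp only: power_mult[symmetric] mult.commute)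
        then show ?thesis by (simp add: power_mult_distrib power_divide)
      qed
      also have "\<dots> \<le> B\<^sup>2 * (1 - (norm (centre \<eta>))\<^sup>2)"
        unfolding norm_centre[OF \<eta>] by (intro mult_left_mono level_radius_defect) simp
      finally show "(koranyi (centre \<eta>) x)\<^sup>2 \<le> B\<^sup>2 * (1 - (norm (centre \<eta>))\<^sup>2)" .
      show "1 - (norm x)\<^sup>2 = 1 - (norm (centre \<eta>))\<^sup>2"
        using \<xi> by (simp add: norm_centre \<eta>)
    next
      fix x y assume "x \<in> centre ` ?N" "y \<in> centre ` ?N" "x \<noteq> y"
      then obtain \<xi> \<zeta> where "\<xi> \<in> ?N" "\<zeta> \<in> ?N" "x = centre \<xi>" "y = centre \<zeta>" "\<xi> \<noteq> \<zeta>" by blast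
      then show "1 \<le> bergman_dist x y" using centres_separated[of \<xi> \<zeta>] by simp
    qed (use centre_ball \<eta> in auto)
    moreover have "inj_on centre ?N"
    proof (rule inj_onI, rule ccontr)
      fix \<xi> \<zeta> assume a: "\<xi> \<in> ?N" "\<zeta> \<in> ?N" "centre \<xi> = centre \<zeta>" "\<xi> \<noteq> \<zeta>"
      then have "1 \<le> bergman_dist (centre \<xi>) (centre \<zeta>)" by (intro centres_separated) auto
      then show False using a bergman_dist_self_less_1[OF centre_ball[of \<xi>]] by simp
    qed
    ultimately show ?thesis by (simp add: card_image)
  qed
  then show ?thesis by blast
qed

end

section \<open>The kernel and its dyadic model\<close>

definition koranyi_kernel :: "real \<Rightarrow> complex ^ 'n \<Rightarrow> complex ^ 'n \<Rightarrow> ennreal" where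
  "koranyi_kernel a z w = ennreal ((koranyi z w)\<^sup>2 powr - a)"

lemma borel_measurable_koranyi_kernel [measurable (raw)]:
  fixes f g :: "'a \<Rightarrow> complex ^ 'n"
  assumes [measurable]: "f \<in> borel_measurable M" "g \<in> borel_measurable M"
  shows "(\<lambda>x. koranyi_kernel a (f x) (g x)) \<in> borel_measurable M"
  unfolding koranyi_kernel_def by measurable

abbreviation near_pair :: "nat \<Rightarrow> complex ^ 'n \<Rightarrow> complex ^ 'n \<Rightarrow> ennreal" where
  "near_pair i z z' \<equiv> indicator {p. (koranyi (fst p) (snd p))\<^sup>2 \<le> 8 / 2 ^ i} (z, z')"

abbreviation near_energy :: "nat \<Rightarrow> (complex ^ 'n) measure \<Rightarrow> (complex ^ 'n \<Rightarrow> ennreal) \<Rightarrow> ennreal" where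
  "near_energy i m g \<equiv> \<integral>\<^sup>+z. \<integral>\<^sup>+z'. g z * g z' * near_pair i z z' \<partial>m \<partial>m"

abbreviation kernel_energy ::
  "real \<Rightarrow> (complex ^ 'n) measure \<Rightarrow> (complex ^ 'n) measure \<Rightarrow> (complex ^ 'n \<Rightarrow> ennreal) \<Rightarrow> ennreal" where
  "kernel_energy a m \<nu> g \<equiv> \<integral>\<^sup>+w. (\<integral>\<^sup>+z. g z * koranyi_kernel a z w \<partial>m)\<^sup>2 \<partial>\<nu>"

lemma term_le_suminf: "f i \<le> (\<Sum>i. f i :: ennreal)"
  using sum_le_suminf[of f "{i}"] by (simp add: summableI)

lemma half_power_powr:
  fixes \<delta> b :: real
  assumes "0 \<le> \<delta>"
  shows "(\<delta> / 2 ^ k) powr b = \<delta> powr b * (2 powr - b) ^ k"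
proof -
  have "(2 powr - b) ^ k = 2 powr - (b * real k)" by (simp add: powr_power mult.commute)
  also have "\<dots> = 1 / (2 ^ k) powr b"
    by (simp add: powr_realpow[symmetric] powr_powr powr_minus_divide mult.commute)
  finally show ?thesis using assms by (simp add: powr_divide)
qed

lemma ennreal_geometric_suminf:
  assumes "0 \<le> r" "r < 1" "0 \<le> C"
  shows "(\<Sum>k. ennreal (C * r ^ k)) = ennreal (C / (1 - r))"
proof -
  have "(\<lambda>k. C * r ^ k) sums (C * (1 / (1 - r)))"
    using assms by (intro sums_mult geometric_sums) auto
  then show ?thesis using assms by (intro suminf_ennreal_eq) auto
qed

text \<open>
  The annulus where \<open>|1 - cdot z w|\<close> is about \<open>2^-k \<delta>\<close> contributes \<open>(2^-k \<delta>)^(\<kappa> - a)\<close>.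
\<close>
lemma nn_integral_koranyi_kernel_le:
  fixes \<nu> :: "(complex ^ 'n) measure"
  assumes \<nu>: "koranyi_regular \<kappa> \<nu>" and a: "0 < a" "a < \<kappa>"
  shows "\<exists>C>0. \<forall>z \<delta>. norm z < 1 \<longrightarrow> 0 < \<delta> \<longrightarrow>
    (\<integral>\<^sup>+w\<in>koranyi_ball z \<delta>. koranyi_kernel a z w \<partial>\<nu>) \<le> ennreal (C * \<delta> powr (\<kappa> - a))"
proof -
  have [measurable_cong, simp]: "sets \<nu> = sets borel" using \<nu> by (simp add: koranyi_regular_def)
  obtain C where C: "C > 0" "\<And>z \<delta>. norm z \<le> 1 \<Longrightarrow> 0 < \<delta> \<Longrightarrow> emeasure \<nu> (koranyi_ball z \<delta>) \<le> ennreal (C * \<delta> powr \<kappa>)"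
    using koranyi_regular_le[OF \<nu>] by blast
  define r where "r = 2 powr - (\<kappa> - a)"
  have r: "0 < r" "r < 1" using a powr_less_mono[of "- (\<kappa> - a)" 0 2] by (auto simp: r_def)
  have "(\<integral>\<^sup>+w\<in>koranyi_ball z \<delta>. koranyi_kernel a z w \<partial>\<nu>) \<le> ennreal (2 powr a * C / (1 - r) * \<delta> powr (\<kappa> - a))"
    if z: "norm z < 1" and \<delta>: "0 < \<delta>" for z \<delta>
  proof -
    have "(\<integral>\<^sup>+w\<in>koranyi_ball z \<delta>. koranyi_kernel a z w \<partial>\<nu>) \<le>
        (\<integral>\<^sup>+w. (\<Sum>k. ennreal (2 powr a * (\<delta> / 2 ^ k) powr - a) * indicator (koranyi_ball z (\<delta> / 2 ^ k)) w) \<partial>\<nu>)"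
    proof (rule nn_integral_mono)
      fix w
      show "koranyi_kernel a z w * indicator (koranyi_ball z \<delta>) w \<le>
          (\<Sum>k. ennreal (2 powr a * (\<delta> / 2 ^ k) powr - a) * indicator (koranyi_ball z (\<delta> / 2 ^ k)) w)"
      proof (cases "w \<in> koranyi_ball z \<delta>")
        case True
        then have w: "norm w \<le> 1" "(koranyi z w)\<^sup>2 \<le> \<delta>" by (auto simp: koranyi_ball_def)
        have "0 < (koranyi z w)\<^sup>2" using koranyi_pos[OF z w(1)] by simp
        then obtain k where k: "\<delta> / 2 ^ (k + 1) < (koranyi z w)\<^sup>2" "(koranyi z w)\<^sup>2 \<le> \<delta> / 2 ^ k"
          using dyadic_scale w(2) by blast
        have "(koranyi z w)\<^sup>2 powr - a \<le> (\<delta> / 2 ^ k / 2) powr - a"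
          using k(1) \<delta> a by (intro powr_mono2') auto
        also have "\<dots> = 2 powr a * (\<delta> / 2 ^ k) powr - a"
          using half_power_powr[of "\<delta> / 2 ^ k" 1 "- a"] \<delta> by (simp add: mult.commute)
        finally have "koranyi_kernel a z w * indicator (koranyi_ball z \<delta>) w \<le>
            ennreal (2 powr a * (\<delta> / 2 ^ k) powr - a) * indicator (koranyi_ball z (\<delta> / 2 ^ k)) w"
          using True w k(2) by (simp add: koranyi_kernel_def koranyi_ball_def ennreal_leI)
        also have "\<dots> \<le> (\<Sum>k. ennreal (2 powr a * (\<delta> / 2 ^ k) powr - a) * indicator (koranyi_ball z (\<delta> / 2 ^ k)) w)"
          by (rule term_le_suminf)
        finally show ?thesis .
      qed simp
    qed
    also have "\<dots> = (\<Sum>k. ennreal (2 powr a * (\<delta> / 2 ^ k) powr - a) * emeasure \<nu> (koranyi_ball z (\<delta> / 2 ^ k)))"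
      by (subst nn_integral_suminf) (auto simp: nn_integral_cmult)
    also have "\<dots> \<le> (\<Sum>k. ennreal (2 powr a * C * \<delta> powr (\<kappa> - a) * r ^ k))"
    proof (intro suminf_le summableI)
      fix k
      have "ennreal (2 powr a * (\<delta> / 2 ^ k) powr - a) * emeasure \<nu> (koranyi_ball z (\<delta> / 2 ^ k)) \<le>
          ennreal (2 powr a * (\<delta> / 2 ^ k) powr - a) * ennreal (C * (\<delta> / 2 ^ k) powr \<kappa>)"
        using z \<delta> by (intro mult_left_mono C(2)) auto
      also have "\<dots> = ennreal (2 powr a * C * ((\<delta> / 2 ^ k) powr - a * (\<delta> / 2 ^ k) powr \<kappa>))"
        by (subst ennreal_mult'[symmetric]) (auto simp: mult_ac)
      also have "(\<delta> / 2 ^ k) powr - a * (\<delta> / 2 ^ k) powr \<kappa> = (\<delta> / 2 ^ k) powr (\<kappa> - a)"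
        by (simp add: powr_add[symmetric])
      also have "\<dots> = \<delta> powr (\<kappa> - a) * r ^ k"
        unfolding r_def using \<delta> by (intro half_power_powr) simp
      finally show "ennreal (2 powr a * (\<delta> / 2 ^ k) powr - a) * emeasure \<nu> (koranyi_ball z (\<delta> / 2 ^ k)) \<le>
          ennreal (2 powr a * C * \<delta> powr (\<kappa> - a) * r ^ k)" by (simp add: mult.assoc)
    qed
    also have "\<dots> = ennreal (2 powr a * C * \<delta> powr (\<kappa> - a) / (1 - r))"
      using r C(1) by (intro ennreal_geometric_suminf) auto
    finally show ?thesis by (simp add: mult_ac)
  qed
  moreover have "0 < 2 powr a * C / (1 - r)" using r C(1) by simp
  ultimately show ?thesis by blast
qed

text \<open>
  If the larger of \<open>|1 - cdot z w|\<close> and \<open>|1 - cdot z' w|\<close> is about \<open>2^-i\<close>, then the corresponding kernel is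
  bounded by \<open>2^(a i)\<close>, and \<open>|1 - cdot z z'| \<le> 8 / 2^i\<close> by the triangle inequality.
\<close>
lemma koranyi_kernel_mult_le:
  fixes z z' w :: "complex ^ 'n"
  assumes z: "norm z < 1" and z': "norm z' < 1" and w: "norm w \<le> 1" and a: "0 < a"
  shows "koranyi_kernel a z w * koranyi_kernel a z' w \<le>
    (\<Sum>i. ennreal (2 powr (a * real i)) * near_pair i z z' *
       (koranyi_kernel a z w * indicator (koranyi_ball z (2 / 2 ^ i)) w +
        koranyi_kernel a z' w * indicator (koranyi_ball z' (2 / 2 ^ i)) w))"
proof -
  have main: "koranyi_kernel a x w * koranyi_kernel a y w \<le>
    (\<Sum>i. ennreal (2 powr (a * real i)) * near_pair i x y *
       (koranyi_kernel a x w * indicator (koranyi_ball x (2 / 2 ^ i)) w +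
        koranyi_kernel a y w * indicator (koranyi_ball y (2 / 2 ^ i)) w))"
    if x: "norm x < 1" and y: "norm y < 1" and xy: "koranyi x w \<le> koranyi y w" for x y :: "complex ^ 'n"
  proof -
    have "0 < (koranyi y w)\<^sup>2" "(koranyi y w)\<^sup>2 \<le> 2" using koranyi_pos[OF y w] koranyi_le_2[of y w] y w by auto
    then obtain i where i: "2 / 2 ^ (i + 1) < (koranyi y w)\<^sup>2" "(koranyi y w)\<^sup>2 \<le> 2 / 2 ^ i"
      by (rule dyadic_scale)
    have "koranyi_kernel a y w \<le> ennreal (2 powr (a * real i))"
      unfolding koranyi_kernel_def
    proof (rule ennreal_leI)
      have "(koranyi y w)\<^sup>2 powr - a \<le> (1 / 2 ^ i) powr - a" using i(1) a by (intro powr_mono2') auto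
      also have "\<dots> = 2 powr (a * real i)"
        by (simp add: powr_divide powr_minus_divide powr_realpow[symmetric] powr_powr mult.commute)
      finally show "(koranyi y w)\<^sup>2 powr - a \<le> 2 powr (a * real i)" .
    qed
    moreover have "(koranyi x w)\<^sup>2 \<le> 2 / 2 ^ i" using power_mono[OF xy koranyi_nonneg, of 2] i(2) by linarith
    then have "w \<in> koranyi_ball x (2 / 2 ^ i)" using w by (simp add: koranyi_ball_def)
    moreover have "(koranyi x y)\<^sup>2 \<le> 8 / 2 ^ i"
    proof -
      have "koranyi x y \<le> 2 * koranyi y w"
        using koranyi_triangle[of x y w] x y w xy by (simp add: koranyi_commute[of w])
      then have "(koranyi x y)\<^sup>2 \<le> (2 * koranyi y w)\<^sup>2" by (rule power_mono) simp
      then show ?thesis using i(2) by (simp add: power_mult_distrib)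
    qed
    ultimately have "koranyi_kernel a x w * koranyi_kernel a y w \<le>
      ennreal (2 powr (a * real i)) * near_pair i x y *
       (koranyi_kernel a x w * indicator (koranyi_ball x (2 / 2 ^ i)) w +
        koranyi_kernel a y w * indicator (koranyi_ball y (2 / 2 ^ i)) w)"
      by (simp add: mult.commute[of "koranyi_kernel a x w"] distrib_left)
        (meson add_increasing2 mult_right_mono zero_le)
    then show ?thesis by (rule order_trans) (rule term_le_suminf)
  qed
  show ?thesis
  proof (cases "koranyi z w \<le> koranyi z' w")
    case True
    then show ?thesis by (rule main[OF z z'])
  next
    case False
    then have "koranyi z' w \<le> koranyi z w" by simp
    have sym: "near_pair i z' z =
        (near_pair i z z' :: ennreal)" for i
      by (simp add: indicator_def koranyi_commute)
    from main[OF z' z \<open>koranyi z' w \<le> koranyi z w\<close>] show ?thesis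
      unfolding sym mult.commute[of "koranyi_kernel a z' w" "koranyi_kernel a z w"]
      by (simp only: add.commute)
  qed
qed

text \<open>
  The exponents combine to \<open>a - (\<kappa> - a) = 2 a - \<kappa> = 2 \<sigma>\<close>, so that the bound depends on \<open>\<nu>\<close> only through
  the constant.
\<close>
lemma nn_integral_kernel_product_le:
  fixes \<nu> :: "(complex ^ 'n) measure"
  assumes \<nu>: "koranyi_regular \<kappa> \<nu>" and \<sigma>: "0 \<le> \<sigma>" "\<sigma> < \<kappa> / 2" and a: "a = \<kappa> / 2 + \<sigma>"
  shows "\<exists>C>0. \<forall>z z'. norm z < 1 \<longrightarrow> norm z' < 1 \<longrightarrow>
    (\<integral>\<^sup>+w. koranyi_kernel a z w * koranyi_kernel a z' w \<partial>\<nu>) \<le>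
    ennreal C * (\<Sum>i. ennreal (2 powr (2 * \<sigma> * real i)) * near_pair i z z')"
proof -
  have [measurable_cong, simp]: "sets \<nu> = sets borel" and AE: "AE w in \<nu>. norm w \<le> 1"
    using \<nu> by (auto simp: koranyi_regular_def elim: AE_mp)
  have a': "0 < a" "a < \<kappa>" using \<sigma> a by auto
  obtain C where C: "C > 0" "\<And>z \<delta>. norm z < 1 \<Longrightarrow> 0 < \<delta> \<Longrightarrow>
    (\<integral>\<^sup>+w\<in>koranyi_ball z \<delta>. koranyi_kernel a z w \<partial>\<nu>) \<le> ennreal (C * \<delta> powr (\<kappa> - a))"
    using nn_integral_koranyi_kernel_le[OF \<nu> a'] by blast
  define D where "D = 2 * C * 2 powr (\<kappa> - a)"
  have "(\<integral>\<^sup>+w. koranyi_kernel a z w * koranyi_kernel a z' w \<partial>\<nu>) \<le>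
    ennreal D * (\<Sum>i. ennreal (2 powr (2 * \<sigma> * real i)) * near_pair i z z')"
    if z: "norm z < 1" "norm z' < 1" for z z'
  proof -
    let ?I = "\<lambda>i. near_pair i z z' :: ennreal"
    have "(\<integral>\<^sup>+w. koranyi_kernel a z w * koranyi_kernel a z' w \<partial>\<nu>) \<le>
      (\<integral>\<^sup>+w. (\<Sum>i. ennreal (2 powr (a * real i)) * ?I i *
       (koranyi_kernel a z w * indicator (koranyi_ball z (2 / 2 ^ i)) w +
        koranyi_kernel a z' w * indicator (koranyi_ball z' (2 / 2 ^ i)) w)) \<partial>\<nu>)"
      using AE koranyi_kernel_mult_le[OF z _ a'(1)] by (intro nn_integral_mono_AE) auto
    also have "\<dots> = (\<Sum>i. ennreal (2 powr (a * real i)) * ?I i *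
       ((\<integral>\<^sup>+w\<in>koranyi_ball z (2 / 2 ^ i). koranyi_kernel a z w \<partial>\<nu>) +
        (\<integral>\<^sup>+w\<in>koranyi_ball z' (2 / 2 ^ i). koranyi_kernel a z' w \<partial>\<nu>)))"
      by (subst nn_integral_suminf) (simp_all add: nn_integral_cmult nn_integral_add)
    also have "\<dots> \<le> (\<Sum>i. ennreal D * (ennreal (2 powr (2 * \<sigma> * real i)) * ?I i))"
    proof (intro suminf_le summableI)
      fix i
      have "(\<integral>\<^sup>+w\<in>koranyi_ball z (2 / 2 ^ i). koranyi_kernel a z w \<partial>\<nu>) +
          (\<integral>\<^sup>+w\<in>koranyi_ball z' (2 / 2 ^ i). koranyi_kernel a z' w \<partial>\<nu>) \<le>
          ennreal (C * (2 / 2 ^ i) powr (\<kappa> - a)) + ennreal (C * (2 / 2 ^ i) powr (\<kappa> - a))"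
        using z by (intro add_mono C(2)) auto
      also have "\<dots> = ennreal (D * (2 powr - (\<kappa> - a)) ^ i)"
        using C(1) by (subst ennreal_plus[symmetric]) (auto simp: D_def half_power_powr)
      finally have "ennreal (2 powr (a * real i)) * ((\<integral>\<^sup>+w\<in>koranyi_ball z (2 / 2 ^ i). koranyi_kernel a z w \<partial>\<nu>) +
          (\<integral>\<^sup>+w\<in>koranyi_ball z' (2 / 2 ^ i). koranyi_kernel a z' w \<partial>\<nu>)) \<le>
          ennreal (2 powr (a * real i)) * ennreal (D * (2 powr - (\<kappa> - a)) ^ i)"
        by (rule mult_left_mono) simp
      also have "\<dots> = ennreal (D * (2 powr (a * real i) * (2 powr - (\<kappa> - a)) ^ i))"
        by (subst ennreal_mult'[symmetric]) (auto simp: mult_ac)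
      also have "2 powr (a * real i) * (2 powr - (\<kappa> - a)) ^ i = 2 powr (2 * \<sigma> * real i)"
        by (simp add: powr_power powr_add[symmetric] a algebra_simps)
      also have "ennreal (D * 2 powr (2 * \<sigma> * real i)) = ennreal D * ennreal (2 powr (2 * \<sigma> * real i))"
        using C(1) by (intro ennreal_mult) (auto simp: D_def)
      finally show "ennreal (2 powr (a * real i)) * ?I i *
       ((\<integral>\<^sup>+w\<in>koranyi_ball z (2 / 2 ^ i). koranyi_kernel a z w \<partial>\<nu>) +
        (\<integral>\<^sup>+w\<in>koranyi_ball z' (2 / 2 ^ i). koranyi_kernel a z' w \<partial>\<nu>)) \<le> ennreal D * (ennreal (2 powr (2 * \<sigma> * real i)) * ?I i)"
        by (auto simp: indicator_def)
    qed
    finally show ?thesis by simp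
  qed
  moreover have "0 < D" using C(1) by (simp add: D_def)
  ultimately show ?thesis by blast
qed

lemma nn_integral_square_kernel:
  fixes m \<nu> :: "(complex ^ 'n) measure"
  assumes m [measurable_cong]: "sets m = sets borel" "sigma_finite_measure m"
    and \<nu> [measurable_cong]: "sets \<nu> = sets borel" "sigma_finite_measure \<nu>"
    and g [measurable]: "g \<in> borel_measurable borel"
  shows "kernel_energy a m \<nu> g =
    (\<integral>\<^sup>+z. \<integral>\<^sup>+z'. g z * g z' * (\<integral>\<^sup>+w. koranyi_kernel a z w * koranyi_kernel a z' w \<partial>\<nu>) \<partial>m \<partial>m)"
proof -
  interpret m: sigma_finite_measure m by fact
  interpret \<nu>: sigma_finite_measure \<nu> by fact
  interpret P: pair_sigma_finite m \<nu> ..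
  have "kernel_energy a m \<nu> g =
      (\<integral>\<^sup>+w. \<integral>\<^sup>+z. \<integral>\<^sup>+z'. g z * koranyi_kernel a z w * (g z' * koranyi_kernel a z' w) \<partial>m \<partial>m \<partial>\<nu>)"
    by (simp add: power2_eq_square nn_integral_cmult nn_integral_multc)
  also have "\<dots> = (\<integral>\<^sup>+z. \<integral>\<^sup>+w. \<integral>\<^sup>+z'. g z * koranyi_kernel a z w * (g z' * koranyi_kernel a z' w) \<partial>m \<partial>\<nu> \<partial>m)"
    by (rule P.Fubini') measurable
  also have "\<dots> = (\<integral>\<^sup>+z. \<integral>\<^sup>+z'. \<integral>\<^sup>+w. g z * koranyi_kernel a z w * (g z' * koranyi_kernel a z' w) \<partial>\<nu> \<partial>m \<partial>m)"
    by (intro nn_integral_cong P.Fubini') measurable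
  also have "\<dots> = (\<integral>\<^sup>+z. \<integral>\<^sup>+z'. g z * g z' * (\<integral>\<^sup>+w. koranyi_kernel a z w * koranyi_kernel a z' w \<partial>\<nu>) \<partial>m \<partial>m)"
    by (simp add: nn_integral_cmult[symmetric] mult_ac)
  finally show ?thesis .
qed

lemma koranyi_regular_sigma_finite:
  fixes \<nu> :: "(complex ^ 'n) measure"
  assumes \<nu>: "koranyi_regular \<kappa> \<nu>"
  shows "finite_measure \<nu>"
proof -
  have s: "sets \<nu> = sets borel" and AE: "AE w in \<nu>. norm w \<le> 1"
    using \<nu> by (auto simp: koranyi_regular_def elim: AE_mp)
  obtain C where C: "\<And>z \<delta>. norm (z :: complex ^ 'n) \<le> 1 \<Longrightarrow> 0 < \<delta> \<Longrightarrow> emeasure \<nu> (koranyi_ball z \<delta>) \<le> ennreal (C * \<delta> powr \<kappa>)"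
    using koranyi_regular_le[OF \<nu>] by blast
  have "emeasure \<nu> (space \<nu>) \<le> emeasure \<nu> (koranyi_ball 0 1)"
    using AE s by (intro emeasure_mono_AE) (auto simp: koranyi_ball_def)
  also have "\<dots> \<le> ennreal (C * 1 powr \<kappa>)" by (rule C) auto
  finally show ?thesis by (intro finite_measureI) (auto simp: top_unique)
qed

lemma nn_integral_square_kernel_le:
  fixes \<nu> :: "(complex ^ 'n) measure"
  assumes \<nu>: "koranyi_regular \<kappa> \<nu>" and \<sigma>: "0 \<le> \<sigma>" "\<sigma> < \<kappa> / 2" and a: "a = \<kappa> / 2 + \<sigma>"
    and m: "sets m = sets borel" "sigma_finite_measure m" "AE z in m. norm z < 1"
  shows "\<exists>C>0. \<forall>g \<in> borel_measurable borel.
    kernel_energy a m \<nu> g \<le> ennreal C * (\<Sum>i. ennreal (2 powr (2 * \<sigma> * real i)) *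
      near_energy i m g)"
proof -
  note [measurable_cong] = m(1)
  interpret m: sigma_finite_measure m by fact
  interpret \<nu>: finite_measure \<nu> using \<nu> by (rule koranyi_regular_sigma_finite)
  have \<nu>s: "sets \<nu> = sets borel" using \<nu> by (simp add: koranyi_regular_def)
  obtain C where C: "C > 0" "\<And>z z'. norm z < 1 \<Longrightarrow> norm z' < 1 \<Longrightarrow>
    (\<integral>\<^sup>+w. koranyi_kernel a z w * koranyi_kernel a z' w \<partial>\<nu>) \<le>
    ennreal C * (\<Sum>i. ennreal (2 powr (2 * \<sigma> * real i)) * near_pair i z z')"
    using nn_integral_kernel_product_le[OF \<nu> \<sigma> a] by blast
  have "kernel_energy a m \<nu> g \<le> ennreal C * (\<Sum>i. ennreal (2 powr (2 * \<sigma> * real i)) *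
      near_energy i m g)"
    if g [measurable]: "g \<in> borel_measurable borel" for g
  proof -
    let ?I = "near_pair"
    have [measurable]: "(\<lambda>x. ?I i (f x) (h x)) \<in> borel_measurable M"
      if [measurable]: "f \<in> borel_measurable M" "h \<in> borel_measurable M" for f h i and M :: "'b measure"
    proof -
      have "?I i (f x) (h x) = (if (koranyi (f x) (h x))\<^sup>2 \<le> 8 / 2 ^ i then 1 else 0)" for x by (simp add: indicator_def)
      then show ?thesis by simp
    qed
    have "kernel_energy a m \<nu> g =
      (\<integral>\<^sup>+z. \<integral>\<^sup>+z'. g z * g z' * (\<integral>\<^sup>+w. koranyi_kernel a z w * koranyi_kernel a z' w \<partial>\<nu>) \<partial>m \<partial>m)"
      by (rule nn_integral_square_kernel) (use m \<nu>s g \<nu>.sigma_finite_measure_axioms in auto)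
    also have "\<dots> \<le> (\<integral>\<^sup>+z. \<integral>\<^sup>+z'. (\<Sum>i. ennreal C * (ennreal (2 powr (2 * \<sigma> * real i)) * (g z * g z' * ?I i z z'))) \<partial>m \<partial>m)"
    proof (rule nn_integral_mono_AE, rule AE_mp[OF m(3)], rule AE_I2, rule impI, rule nn_integral_mono_AE, rule AE_mp[OF m(3)], rule AE_I2, rule impI)
      fix z z' :: "complex ^ 'n" assume z: "norm z < 1" "norm z' < 1"
      have "g z * g z' * (\<integral>\<^sup>+w. koranyi_kernel a z w * koranyi_kernel a z' w \<partial>\<nu>) \<le>
        g z * g z' * (ennreal C * (\<Sum>i. ennreal (2 powr (2 * \<sigma> * real i)) * ?I i z z'))"
        by (rule mult_left_mono[OF C(2)[OF z]]) simp
      then show "g z * g z' * (\<integral>\<^sup>+w. koranyi_kernel a z w * koranyi_kernel a z' w \<partial>\<nu>) \<le>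
        (\<Sum>i. ennreal C * (ennreal (2 powr (2 * \<sigma> * real i)) * (g z * g z' * ?I i z z')))"
        unfolding ennreal_suminf_cmult[symmetric] by (simp only: mult_ac)
    qed
    also have "\<dots> = (\<Sum>i. ennreal C * (ennreal (2 powr (2 * \<sigma> * real i)) * (\<integral>\<^sup>+z. \<integral>\<^sup>+z'. g z * g z' * ?I i z z' \<partial>m \<partial>m)))"
      by (simp add: nn_integral_suminf nn_integral_cmult del: ennreal_suminf_cmult)
    finally show ?thesis by simp
  qed
  then show ?thesis using C(1) by blast
qed

section \<open>The energy of the operator and the energy on the tree\<close>

lemma ennreal_sum_squares_le: "(\<Sum>i\<in>A. (f i :: ennreal)\<^sup>2) \<le> (\<Sum>i\<in>A. f i)\<^sup>2"
proof (cases "finite A")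
  case True
  have "(\<Sum>i\<in>A. (f i)\<^sup>2) \<le> (\<Sum>i\<in>A. f i * (\<Sum>i\<in>A. f i))"
    using True by (intro sum_mono) (auto simp: power2_eq_square intro!: mult_left_mono member_le_sum)
  then show ?thesis by (simp add: power2_eq_square sum_distrib_right)
qed simp

lemma ennreal_suminf_squares_le: "(\<Sum>i. (f i :: ennreal)\<^sup>2) \<le> (\<Sum>i. f i)\<^sup>2"
proof -
  have "(\<Sum>i. (f i)\<^sup>2) \<le> (\<Sum>i. f i * (\<Sum>i. f i))"
    by (intro suminf_le summableI) (auto simp: power2_eq_square intro!: mult_left_mono term_le_suminf)
  then show ?thesis by (simp add: power2_eq_square)
qed

lemma ennreal_mult_le_add_squares: "(x :: ennreal) * y \<le> x\<^sup>2 + y\<^sup>2"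
proof (cases "x \<le> y")
  case True
  then have "x * y \<le> y * y" by (rule mult_right_mono) simp
  then show ?thesis by (simp add: power2_eq_square add_increasing)
next
  case False
  then have "x * y \<le> x * x" by (intro mult_left_mono) auto
  then show ?thesis by (simp add: power2_eq_square add_increasing2)
qed

text \<open>
  Used to pass from pairs of points at dyadic distance \<open>2^-i\<close> to tents of level \<open>i - k\<close>. Truncated subtraction
  repeats the term of level \<open>0\<close>, which accounts for the factor \<open>k + 1\<close>.
\<close>
lemma suminf_dyadic_weight_shift_le:
  fixes f :: "nat \<Rightarrow> ennreal" and \<sigma> :: real
  assumes "0 \<le> \<sigma>"
  shows "(\<Sum>i. ennreal (2 powr (2 * \<sigma> * real i)) * f (i - k)) \<le>
    ennreal (real (Suc k) * 2 powr (2 * \<sigma> * real k)) * (\<Sum>i. ennreal (2 powr (2 * \<sigma> * real i)) * f i)"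
proof -
  define h where "h i = ennreal (2 powr (2 * \<sigma> * real i)) * f i" for i
  have "(\<Sum>i. ennreal (2 powr (2 * \<sigma> * real i)) * f (i - k)) \<le> (\<Sum>i. ennreal (2 powr (2 * \<sigma> * real k)) * h (i - k))"
  proof (intro suminf_le summableI)
    fix i
    have "2 * \<sigma> * real i \<le> 2 * \<sigma> * (real k + real (i - k))" using assms by (intro mult_left_mono) auto
    then have "2 powr (2 * \<sigma> * real i) \<le> 2 powr (2 * \<sigma> * real k) * 2 powr (2 * \<sigma> * real (i - k))"
      by (simp add: powr_add[symmetric] distrib_left)
    then have "ennreal (2 powr (2 * \<sigma> * real i)) \<le> ennreal (2 powr (2 * \<sigma> * real k)) * ennreal (2 powr (2 * \<sigma> * real (i - k)))"
      by (simp add: ennreal_leI ennreal_mult'[symmetric])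
    then show "ennreal (2 powr (2 * \<sigma> * real i)) * f (i - k) \<le> ennreal (2 powr (2 * \<sigma> * real k)) * h (i - k)"
      unfolding h_def mult.assoc[symmetric] by (rule mult_right_mono) simp
  qed
  also have "\<dots> = ennreal (2 powr (2 * \<sigma> * real k)) * (\<Sum>i. h (i - k))" by simp
  also have "\<dots> \<le> ennreal (2 powr (2 * \<sigma> * real k)) * (ennreal (real (Suc k)) * (\<Sum>i. h i))"
  proof (rule mult_left_mono)
    have "(\<Sum>i. h (i - k)) = (\<Sum>i. h i) + of_nat k * h 0"
      using suminf_offset[of "\<lambda>i. h (i - k)" k] by (simp add: summableI)
    also have "\<dots> \<le> (\<Sum>i. h i) + of_nat k * (\<Sum>i. h i)"
      by (intro add_left_mono mult_left_mono term_le_suminf) simp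
    also have "\<dots> = ennreal (real (Suc k)) * (\<Sum>i. h i)"
      by (simp add: ennreal_of_nat_eq_real_of_nat[symmetric] distrib_right)
    finally show "(\<Sum>i. h (i - k)) \<le> ennreal (real (Suc k)) * (\<Sum>i. h i)" .
  qed simp
  also have "\<dots> = ennreal (real (Suc k) * 2 powr (2 * \<sigma> * real k)) * (\<Sum>i. h i)"
    unfolding mult.assoc[symmetric] by (subst ennreal_mult'[symmetric]) (simp_all add: mult.commute)
  finally show ?thesis unfolding h_def .
qed

text \<open>
  A truncated geometric series is dominated by its last term; the induction compares the partial sum
  with the next power that could be reached.
\<close>
lemma suminf_geometric_truncated_le:
  fixes a X :: real
  assumes a: "0 < a" and X: "0 < X"
  shows "(\<Sum>N. ennreal (2 powr (a * real N)) * indicator {N. 2 ^ N \<le> X} N) \<le> ennreal (X powr a / (1 - 2 powr - a))"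
proof (rule suminf_le_const[OF summableI])
  fix n
  define r where "r = 2 powr - a"
  have r: "0 < r" "r < 1" using a powr_less_mono[of "- a" 0 2] by (auto simp: r_def)
  have "(\<Sum>N<n. 2 powr (a * real N) * indicator {N. 2 ^ N \<le> X} N) \<le> (min X (2 ^ n / 2)) powr a / (1 - r)"
  proof (induction n)
    case (Suc n)
    show ?case
    proof (cases "2 ^ n \<le> X")
      case True
      have "(min X (2 ^ n / 2)) powr a \<le> (2 ^ n / 2) powr a" using a X by (intro powr_mono2) auto
      also have "\<dots> = 2 powr (a * real n) * r"
        by (simp add: r_def powr_divide powr_minus_divide powr_realpow[symmetric] powr_powr mult.commute)
      finally have "(min X (2 ^ n / 2)) powr a / (1 - r) \<le> 2 powr (a * real n) * r / (1 - r)"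
        using r by (intro divide_right_mono) auto
      then have "(\<Sum>N<Suc n. 2 powr (a * real N) * indicator {N. 2 ^ N \<le> X} N) \<le>
          2 powr (a * real n) * r / (1 - r) + 2 powr (a * real n)"
        using Suc True by simp
      also have "\<dots> = 2 powr (a * real n) / (1 - r)" using r by (simp add: field_simps)
      also have "2 powr (a * real n) = (min X (2 ^ Suc n / 2)) powr a"
        using True by (simp add: powr_realpow[symmetric] powr_powr mult.commute min_def)
      finally show ?thesis .
    next
      case False
      then have "(min X (2 ^ n / 2)) powr a \<le> (min X (2 ^ Suc n / 2)) powr a"
        using a X by (intro powr_mono2) auto
      then have "(min X (2 ^ n / 2)) powr a / (1 - r) \<le> (min X (2 ^ Suc n / 2)) powr a / (1 - r)"
        using r by (intro divide_right_mono) auto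
      then show ?thesis using Suc False by simp
    qed
  qed (use r in simp)
  also have "\<dots> \<le> X powr a / (1 - r)" using r a X by (intro divide_right_mono powr_mono2) auto
  finally have "ennreal (\<Sum>N<n. 2 powr (a * real N) * indicator {N. 2 ^ N \<le> X} N) \<le> ennreal (X powr a / (1 - r))"
    by (rule ennreal_leI)
  moreover have "(\<Sum>N<n. ennreal (2 powr (a * real N)) * indicator {N. 2 ^ N \<le> X} N) =
      ennreal (\<Sum>N<n. 2 powr (a * real N) * indicator {N. 2 ^ N \<le> X} N)"
    by (subst sum_ennreal[symmetric]) (auto simp: ennreal_mult' ennreal_indicator)
  ultimately show "(\<Sum>N<n. ennreal (2 powr (a * real N)) * indicator {N. 2 ^ N \<le> X} N) \<le> ennreal (X powr a / (1 - 2 powr - a))"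
    by (simp add: r_def)
qed

context bergman_tree
begin

definition level :: "nat \<Rightarrow> vertex set" where
  "level N = {\<eta> \<in> vertices J. fst \<eta> = N}"

lemma finite_level: "finite (level N)"
proof -
  have "level N \<subseteq> Pair N ` index N" by (auto simp: level_def vertices_iff image_iff prod_eq_iff)
  then show ?thesis using finite_index finite_surj by blast
qed

lemma levelD: "\<eta> \<in> level N \<Longrightarrow> \<eta> \<in> vertices J" "\<eta> \<in> level N \<Longrightarrow> fst \<eta> = N"
  by (auto simp: level_def)

lemma disjoint_tents: "disjoint_family_on tent (level N)"
  unfolding disjoint_family_on_def level_def using tent_disjoint by blast

definition tent_integral :: "(complex ^ 'n) measure \<Rightarrow> (complex ^ 'n \<Rightarrow> ennreal) \<Rightarrow> vertex \<Rightarrow> ennreal" where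
  "tent_integral m g \<eta> = (\<integral>\<^sup>+z\<in>tent \<eta>. g z \<partial>m)"

text \<open>
  The quadratic form of the kernel on the tree which is the sum of \<open>2^(2 \<sigma> d(\<eta>))\<close> over the common ancestors \<open>\<eta>\<close> of
  two points.
\<close>
definition tree_energy :: "real \<Rightarrow> (complex ^ 'n) measure \<Rightarrow> (complex ^ 'n \<Rightarrow> ennreal) \<Rightarrow> ennreal" where
  "tree_energy \<sigma> m g = (\<Sum>N. ennreal (2 powr (2 * \<sigma> * real N)) * (\<Sum>\<eta>\<in>level N. (tent_integral m g \<eta>)\<^sup>2))"

text \<open>
  Two points at Koranyi distance about \<open>2^-(i/2)\<close> need not lie in a common tent of that size, but they lie
  in two tents of comparable size with nearby centres, and each tent has boundedly many such neighbours.
\<close>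
lemma near_pairs_integral_le:
  assumes m [measurable_cong]: "sets m = sets borel" "AE z in m. norm z < 1"
  shows "\<exists>M::nat. \<forall>i. \<forall>g\<in>borel_measurable borel.
    near_energy i m g \<le>
    of_nat M * (\<Sum>\<eta>\<in>level (i - 5). (tent_integral m g \<eta>)\<^sup>2)"
proof -
  define q where "q = sqrt (1 / 2 :: real)"
  have q: "0 < q" "q < 1" "q\<^sup>2 = 1 / 2" by (simp_all add: q_def)
  (* Each centre is within 2 tent_const q^N of its point, and the points are within 3 q^N. *)
  define B where "B = 4 * tent_const + 3"
  have B: "0 \<le> B" using tent_const_ge(1) by (simp add: B_def)
  define near where "near \<eta> \<xi> \<longleftrightarrow> koranyi (centre \<eta>) (centre \<xi>) \<le> B * q ^ fst \<eta>" for \<eta> \<xi>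
  obtain M where M: "\<forall>\<eta>\<in>vertices J. card {\<xi> \<in> vertices J. fst \<xi> = fst \<eta> \<and> near \<eta> \<xi>} \<le> M"
    using neighbours_bounded[OF B] unfolding near_def q_def by blast
  have card: "card {\<xi> \<in> level N. near \<eta> \<xi>} \<le> M" if "\<eta> \<in> level N" for \<eta> N
  proof -
    have "{\<xi> \<in> level N. near \<eta> \<xi>} = {\<xi> \<in> vertices J. fst \<xi> = fst \<eta> \<and> near \<eta> \<xi>}"
      using that by (auto simp: level_def)
    then show ?thesis using M levelD(1)[OF that] by simp
  qed
  have near_sym: "near \<eta> \<xi> \<longleftrightarrow> near \<xi> \<eta>" if "\<eta> \<in> level N" "\<xi> \<in> level N" for \<eta> \<xi> N
    using levelD(2)[OF that(1)] levelD(2)[OF that(2)] by (simp add: near_def koranyi_commute)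
  have cover: "\<exists>\<eta>\<in>level (i - 5). \<exists>\<xi>\<in>level (i - 5). near \<eta> \<xi> \<and> z \<in> tent \<eta> \<and> z' \<in> tent \<xi>"
    if z: "norm z < 1" "norm z' < 1" and zz: "(koranyi z z')\<^sup>2 \<le> 8 / 2 ^ i" for z z' i
  proof -
    let ?N = "i - 5"
    (* The offset 5 in the level comes from 16 / 2^i < 1 / 2^(i - 5). *)
    have small: "?N = 0 \<or> 1 - (norm x)\<^sup>2 < 1 / 2 ^ ?N" if "1 - (norm x)\<^sup>2 \<le> 16 / 2 ^ i" for x :: "complex ^ 'n"
    proof (cases "i \<le> 5")
      case False
      then have "(2::real) ^ i = 2 ^ ?N * 2 ^ 5" by (simp only: power_add[symmetric]) simp
      then have "16 / 2 ^ i < 1 / (2::real) ^ ?N" by (simp add: divide_simps)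
      then show ?thesis using that by linarith
    qed simp
    have "1 - (norm z')\<^sup>2 \<le> 16 / 2 ^ i" using defect_le_koranyi[of z z'] z zz by simp
    from tent_cover[OF z(2) small[OF this]] obtain \<xi> where \<xi>: "\<xi> \<in> level ?N" "z' \<in> tent \<xi>" by (auto simp: level_def)
    have "1 - (norm z)\<^sup>2 \<le> 16 / 2 ^ i" using defect_le_koranyi[of z' z] z zz by (simp add: koranyi_commute)
    from tent_cover[OF z(1) small[OF this]] obtain \<eta> where \<eta>: "\<eta> \<in> level ?N" "z \<in> tent \<eta>" by (auto simp: level_def)
    have n: "norm (centre \<eta>) \<le> 1" "norm (centre \<xi>) \<le> 1"
      using centre_ball[OF levelD(1)[OF \<eta>(1)]] centre_ball[OF levelD(1)[OF \<xi>(1)]] by simp_all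
    have "(koranyi z z')\<^sup>2 \<le> (3 * q ^ i)\<^sup>2"
    proof -
      have "(q ^ i)\<^sup>2 = (q\<^sup>2) ^ i" by (simp only: power_mult[symmetric] mult.commute)
      then have "(3 * q ^ i)\<^sup>2 = 9 / 2 ^ i" by (simp add: power_mult_distrib q(3) power_divide)
      moreover have "8 / 2 ^ i \<le> 9 / (2::real) ^ i" by (simp add: divide_right_mono)
      ultimately show ?thesis using zz by simp
    qed
    then have "koranyi z z' \<le> 3 * q ^ i" by (rule power2_le_imp_le) (use q in simp)
    also have "\<dots> \<le> 3 * q ^ ?N" using q by (intro mult_left_mono power_decreasing) auto
    finally have zz': "koranyi z z' \<le> 3 * q ^ ?N" .
    have "koranyi (centre \<eta>) (centre \<xi>) \<le> koranyi (centre \<eta>) z + (koranyi z z' + koranyi z' (centre \<xi>))"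
      using koranyi_triangle[of "centre \<eta>" "centre \<xi>" z] koranyi_triangle[of z "centre \<xi>" z'] n z by simp
    also have "\<dots> \<le> 2 * tent_const * q ^ ?N + (3 * q ^ ?N + 2 * tent_const * q ^ ?N)"
      using koranyi_tent[OF levelD(1)[OF \<eta>(1)] \<eta>(2)] koranyi_tent[OF levelD(1)[OF \<xi>(1)] \<xi>(2)] zz'
        levelD(2)[OF \<eta>(1)] levelD(2)[OF \<xi>(1)]
      by (intro add_mono) (auto simp: q_def koranyi_commute)
    also have "\<dots> = B * q ^ ?N" by (simp add: B_def algebra_simps)
    finally have "near \<eta> \<xi>" using levelD(2)[OF \<eta>(1)] by (simp add: near_def)
    then show ?thesis using \<eta> \<xi> by blast
  qed
  have "near_energy i m g \<le>
    of_nat (2 * M) * (\<Sum>\<eta>\<in>level (i - 5). (tent_integral m g \<eta>)\<^sup>2)"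
    if g [measurable]: "g \<in> borel_measurable borel" for g i
  proof -
    let ?L = "level (i - 5)" and ?G = "tent_integral m g"
    have fin: "finite {\<xi> \<in> ?L. near \<eta> \<xi>}" for \<eta> using finite_level by simp
    have "near_energy i m g \<le>
        (\<integral>\<^sup>+z. \<integral>\<^sup>+z'. (\<Sum>\<eta>\<in>?L. \<Sum>\<xi>\<in>{\<xi> \<in> ?L. near \<eta> \<xi>}. (g z * indicator (tent \<eta>) z) * (g z' * indicator (tent \<xi>) z')) \<partial>m \<partial>m)"
    proof (rule nn_integral_mono_AE, rule AE_mp[OF m(2)], rule AE_I2, rule impI, rule nn_integral_mono_AE, rule AE_mp[OF m(2)], rule AE_I2, rule impI)
      fix z z' :: "complex ^ 'n" assume z: "norm z < 1" "norm z' < 1"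
      show "g z * g z' * near_pair i z z' \<le>
        (\<Sum>\<eta>\<in>?L. \<Sum>\<xi>\<in>{\<xi> \<in> ?L. near \<eta> \<xi>}. (g z * indicator (tent \<eta>) z) * (g z' * indicator (tent \<xi>) z'))"
      proof (cases "(koranyi z z')\<^sup>2 \<le> 8 / 2 ^ i")
        case True
        then obtain \<eta> \<xi> where p: "\<eta> \<in> ?L" "\<xi> \<in> ?L" "near \<eta> \<xi>" "z \<in> tent \<eta>" "z' \<in> tent \<xi>"
          using cover[OF z] by blast
        let ?t = "\<lambda>\<eta> \<xi>. (g z * indicator (tent \<eta>) z) * (g z' * indicator (tent \<xi>) z')"
        have "g z * g z' * near_pair i z z' \<le> ?t \<eta> \<xi>"
          using p by (simp add: indicator_def)
        also have "\<dots> \<le> (\<Sum>\<xi>\<in>{\<xi> \<in> ?L. near \<eta> \<xi>}. ?t \<eta> \<xi>)"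
          using p fin by (intro member_le_sum) auto
        also have "\<dots> \<le> (\<Sum>\<eta>\<in>?L. \<Sum>\<xi>\<in>{\<xi> \<in> ?L. near \<eta> \<xi>}. ?t \<eta> \<xi>)"
          using p finite_level by (intro member_le_sum[of \<eta> ?L "\<lambda>\<eta>. \<Sum>\<xi>\<in>{\<xi> \<in> ?L. near \<eta> \<xi>}. ?t \<eta> \<xi>"]) auto
        finally show ?thesis .
      qed simp
    qed
    also have "\<dots> = (\<Sum>\<eta>\<in>?L. \<Sum>\<xi>\<in>{\<xi> \<in> ?L. near \<eta> \<xi>}. ?G \<eta> * ?G \<xi>)"
      by (simp add: nn_integral_sum nn_integral_cmult nn_integral_multc tent_integral_def)
    also have "\<dots> \<le> (\<Sum>\<eta>\<in>?L. \<Sum>\<xi>\<in>{\<xi> \<in> ?L. near \<eta> \<xi>}. (?G \<eta>)\<^sup>2 + (?G \<xi>)\<^sup>2)"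
      by (intro sum_mono ennreal_mult_le_add_squares)
    also have "\<dots> = (\<Sum>\<eta>\<in>?L. \<Sum>\<xi>\<in>{\<xi> \<in> ?L. near \<eta> \<xi>}. (?G \<eta>)\<^sup>2) + (\<Sum>\<eta>\<in>?L. \<Sum>\<xi>\<in>{\<xi> \<in> ?L. near \<eta> \<xi>}. (?G \<xi>)\<^sup>2)"
      by (simp add: sum.distrib)
    also have "(\<Sum>\<eta>\<in>?L. \<Sum>\<xi>\<in>{\<xi> \<in> ?L. near \<eta> \<xi>}. (?G \<xi>)\<^sup>2) = (\<Sum>\<xi>\<in>?L. \<Sum>\<eta>\<in>{\<eta> \<in> ?L. near \<eta> \<xi>}. (?G \<xi>)\<^sup>2)"
      by (rule sum.swap_restrict) (rule finite_level)+
    also have "\<dots> = (\<Sum>\<xi>\<in>?L. \<Sum>\<eta>\<in>{\<eta> \<in> ?L. near \<xi> \<eta>}. (?G \<xi>)\<^sup>2)"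
      using near_sym by (intro sum.cong refl) blast
    also have "(\<Sum>\<eta>\<in>?L. \<Sum>\<xi>\<in>{\<xi> \<in> ?L. near \<eta> \<xi>}. (?G \<eta>)\<^sup>2) + \<dots> \<le> (\<Sum>\<eta>\<in>?L. of_nat M * (?G \<eta>)\<^sup>2) + (\<Sum>\<eta>\<in>?L. of_nat M * (?G \<eta>)\<^sup>2)"
      using card by (intro add_mono sum_mono) (auto intro!: mult_right_mono)
    also have "\<dots> = of_nat (2 * M) * (\<Sum>\<eta>\<in>?L. (?G \<eta>)\<^sup>2)"
      by (simp add: sum_distrib_left[symmetric] mult_2 distrib_right)
    finally show ?thesis .
  qed
  then show ?thesis by blast
qed

text \<open>
  Each pair integral at dyadic distance \<open>2^-i\<close> is bounded by the tents five levels closer to the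
  root; the weights change only by a constant factor.
\<close>
lemma square_kernel_le_tree_energy:
  assumes \<nu>: "koranyi_regular \<kappa> \<nu>" and \<sigma>: "0 \<le> \<sigma>" "\<sigma> < \<kappa> / 2" and a: "a = \<kappa> / 2 + \<sigma>"
    and m: "sets m = sets borel" "sigma_finite_measure m" "AE z in m. norm z < 1"
  shows "\<exists>C. \<forall>g \<in> borel_measurable borel.
    kernel_energy a m \<nu> g \<le> ennreal C * tree_energy \<sigma> m g"
proof -
  obtain C where C: "C > 0" "\<And>g. g \<in> borel_measurable borel \<Longrightarrow>
    kernel_energy a m \<nu> g \<le> ennreal C * (\<Sum>i. ennreal (2 powr (2 * \<sigma> * real i)) *
      near_energy i m g)"
    using nn_integral_square_kernel_le[OF \<nu> \<sigma> a m] by blast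
  obtain M :: nat where M: "\<And>i g. g \<in> borel_measurable borel \<Longrightarrow>
    near_energy i m g \<le>
    of_nat M * (\<Sum>\<eta>\<in>level (i - 5). (tent_integral m g \<eta>)\<^sup>2)"
    using near_pairs_integral_le[OF m(1,3)] by blast
  define K where "K = real (Suc 5) * 2 powr (2 * \<sigma> * real 5)"
  have "kernel_energy a m \<nu> g \<le> ennreal (C * (real M * K)) * tree_energy \<sigma> m g"
    if g: "g \<in> borel_measurable borel" for g
  proof -
    let ?f = "\<lambda>N. \<Sum>\<eta>\<in>level N. (tent_integral m g \<eta>)\<^sup>2"
    have "(\<Sum>i. ennreal (2 powr (2 * \<sigma> * real i)) *
      near_energy i m g) \<le>
      (\<Sum>i. ennreal (2 powr (2 * \<sigma> * real i)) * (of_nat M * ?f (i - 5)))"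
      by (intro suminf_le summableI mult_left_mono M g) simp
    also have "\<dots> = of_nat M * (\<Sum>i. ennreal (2 powr (2 * \<sigma> * real i)) * ?f (i - 5))"
      unfolding ennreal_suminf_cmult[symmetric] by (simp only: mult_ac)
    also have "\<dots> \<le> of_nat M * (ennreal K * (\<Sum>i. ennreal (2 powr (2 * \<sigma> * real i)) * ?f i))"
      unfolding K_def by (intro mult_left_mono suminf_dyadic_weight_shift_le \<sigma>) simp
    finally have "kernel_energy a m \<nu> g \<le>
        ennreal C * (of_nat M * (ennreal K * tree_energy \<sigma> m g))"
      unfolding tree_energy_def by (intro order_trans[OF C(2)[OF g]] mult_left_mono) simp_all
    also have "\<dots> = ennreal (C * (real M * K)) * tree_energy \<sigma> m g"
      using C(1) by (simp add: ennreal_mult K_def ennreal_of_nat_eq_real_of_nat mult.assoc)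
    finally show ?thesis .
  qed
  then show ?thesis by blast
qed

lemma centre_ball_measure_ge:
  fixes \<nu> :: "(complex ^ 'n) measure"
  assumes \<nu>: "koranyi_regular \<kappa> \<nu>" and \<kappa>: "0 \<le> \<kappa>"
  shows "\<exists>c>0. \<forall>\<eta>\<in>vertices J.
    ennreal (c * (1 / 2 ^ fst \<eta>) powr \<kappa>) \<le> emeasure \<nu> (koranyi_ball (centre \<eta>) (36 / 2 ^ fst \<eta>))"
proof -
  have \<nu>s: "sets \<nu> = sets borel" using \<nu> by (simp add: koranyi_regular_def)
  obtain c where c: "c > 0" "\<And>z \<delta>. norm (z :: complex ^ 'n) \<le> 1 \<Longrightarrow> 0 < \<delta> \<Longrightarrow> \<delta> \<le> 1 \<Longrightarrow> 1 - norm z \<le> \<delta> \<Longrightarrow>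
    ennreal (c * \<delta> powr \<kappa>) \<le> emeasure \<nu> (koranyi_ball z (9 * \<delta>))"
    using koranyi_regular_ge[OF \<nu>] by blast
  have "ennreal (c * (1 / 2 ^ fst \<eta>) powr \<kappa>) \<le> emeasure \<nu> (koranyi_ball (centre \<eta>) (36 / 2 ^ fst \<eta>))"
    if \<eta>: "\<eta> \<in> vertices J" for \<eta>
  proof -
    let ?N = "fst \<eta>" and ?z = "centre \<eta>"
    (* The cap size must be at least 1 - |centre|, which is bounded by 4 / 2^N, and at most 1. *)
    define d where "d = min 1 (4 / (2::real) ^ ?N)"
    have d: "0 < d" "d \<le> 1" "1 / 2 ^ ?N \<le> d" "d \<le> 4 / 2 ^ ?N" by (auto simp: d_def divide_right_mono)
    have z: "norm ?z \<le> 1" using centre_ball[OF \<eta>] by simp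
    have "(norm ?z)\<^sup>2 \<le> norm ?z" using z by (simp add: power2_eq_square mult_left_le)
    then have "1 - norm ?z \<le> 4 / 2 ^ ?N" using level_radius_defect(2)[of ?N] by (simp add: norm_centre[OF \<eta>])
    then have zd: "1 - norm ?z \<le> d" by (simp add: d_def)
    have "ennreal (c * (1 / 2 ^ ?N) powr \<kappa>) \<le> ennreal (c * d powr \<kappa>)"
      using c(1) d(3) \<kappa> by (intro ennreal_leI mult_left_mono powr_mono2) auto
    also have "\<dots> \<le> emeasure \<nu> (koranyi_ball ?z (9 * d))" using z d zd by (intro c(2)) auto
    also have "\<dots> \<le> emeasure \<nu> (koranyi_ball ?z (36 / 2 ^ ?N))"
      using d(4) \<nu>s by (intro emeasure_mono) (auto simp: koranyi_ball_def)
    finally show ?thesis .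
  qed
  then show ?thesis using c(1) by blast
qed

text \<open>
  The tents of one level are disjoint, so only one term of each level survives, and the level is bounded
  by the distance of \<open>z\<close> and \<open>w\<close>; the sum is dominated by its last term.
\<close>
lemma tent_sum_le_kernel:
  assumes a: "0 < a"
  shows "\<exists>C. \<forall>z w. norm z < 1 \<longrightarrow> norm w \<le> 1 \<longrightarrow>
    (\<Sum>N. \<Sum>\<eta>\<in>level N. ennreal (2 powr (a * real N)) * indicator (koranyi_ball (centre \<eta>) (36 / 2 ^ N)) w * indicator (tent \<eta>) z)
      \<le> ennreal C * koranyi_kernel a z w"
proof -
  define q where "q = sqrt (1 / 2 :: real)"
  have q: "0 < q" "q\<^sup>2 = 1 / 2" by (simp_all add: q_def)
  define B where "B = 2 * tent_const + 6"
  have B: "0 < B" using tent_const_ge(1) by (simp add: B_def)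
  have "(\<Sum>N. \<Sum>\<eta>\<in>level N. ennreal (2 powr (a * real N)) * indicator (koranyi_ball (centre \<eta>) (36 / 2 ^ N)) w * indicator (tent \<eta>) z)
      \<le> ennreal ((B\<^sup>2) powr a / (1 - 2 powr - a)) * koranyi_kernel a z w"
    if z: "norm z < 1" and w: "norm w \<le> 1" for z w
  proof -
    define X where "X = B\<^sup>2 / (koranyi z w)\<^sup>2"
    have k: "0 < (koranyi z w)\<^sup>2" using koranyi_pos[OF z w] by simp
    have X: "0 < X" using k B by (simp add: X_def)
    have q2: "(q ^ N)\<^sup>2 = 1 / 2 ^ N" for N
    proof -
      have "(q ^ N)\<^sup>2 = (q\<^sup>2) ^ N" by (simp only: power_mult[symmetric] mult.commute)
      then show ?thesis by (simp add: q(2) power_divide)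
    qed
    have close: "2 ^ N \<le> X"
      if \<eta>: "\<eta> \<in> level N" and wV: "w \<in> koranyi_ball (centre \<eta>) (36 / 2 ^ N)" and zt: "z \<in> tent \<eta>" for \<eta> N
    proof -
      have "(koranyi (centre \<eta>) w)\<^sup>2 \<le> (6 * q ^ N)\<^sup>2" using wV by (simp add: koranyi_ball_def power_mult_distrib q2)
      then have "koranyi (centre \<eta>) w \<le> 6 * q ^ N" by (rule power2_le_imp_le) (use q in simp)
      moreover have "koranyi (centre \<eta>) z \<le> 2 * tent_const * q ^ N"
        using koranyi_tent[OF levelD(1)[OF \<eta>] zt] levelD(2)[OF \<eta>] by (simp add: q_def)
      moreover have "norm (centre \<eta>) \<le> 1" using centre_ball[OF levelD(1)[OF \<eta>]] by simp
      ultimately have "koranyi z w \<le> B * q ^ N"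
        using koranyi_triangle[of z w "centre \<eta>"] z w by (simp add: koranyi_commute[of z] B_def algebra_simps)
      then have "(koranyi z w)\<^sup>2 \<le> (B * q ^ N)\<^sup>2" by (rule power_mono) simp
      then have "(koranyi z w)\<^sup>2 \<le> B\<^sup>2 / 2 ^ N" by (simp add: power_mult_distrib q2)
      then show ?thesis using k by (simp add: X_def pos_le_divide_eq mult.commute)
    qed
    have "(\<Sum>N. \<Sum>\<eta>\<in>level N. ennreal (2 powr (a * real N)) * indicator (koranyi_ball (centre \<eta>) (36 / 2 ^ N)) w * indicator (tent \<eta>) z)
        \<le> (\<Sum>N. ennreal (2 powr (a * real N)) * indicator {N. 2 ^ N \<le> X} N)"
    proof (intro suminf_le summableI)
      fix N
      have "(\<Sum>\<eta>\<in>level N. ennreal (2 powr (a * real N)) * indicator (koranyi_ball (centre \<eta>) (36 / 2 ^ N)) w * indicator (tent \<eta>) z)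
          \<le> (\<Sum>\<eta>\<in>level N. ennreal (2 powr (a * real N)) * indicator {N. 2 ^ N \<le> X} N * indicator (tent \<eta>) z)"
        using close by (intro sum_mono) (auto simp: indicator_def)
      also have "\<dots> = ennreal (2 powr (a * real N)) * indicator {N. 2 ^ N \<le> X} N * indicator (\<Union>\<eta>\<in>level N. tent \<eta>) z"
        using finite_level disjoint_tents by (simp add: sum_distrib_left[symmetric] indicator_UN_disjoint)
      also have "\<dots> \<le> ennreal (2 powr (a * real N)) * indicator {N. 2 ^ N \<le> X} N"
        by (simp add: indicator_def)
      finally show "(\<Sum>\<eta>\<in>level N. ennreal (2 powr (a * real N)) * indicator (koranyi_ball (centre \<eta>) (36 / 2 ^ N)) w * indicator (tent \<eta>) z)
          \<le> ennreal (2 powr (a * real N)) * indicator {N. 2 ^ N \<le> X} N" .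
    qed
    also have "\<dots> \<le> ennreal (X powr a / (1 - 2 powr - a))"
      by (rule suminf_geometric_truncated_le[OF a X])
    also have "X powr a / (1 - 2 powr - a) = ((B\<^sup>2) powr a / (1 - 2 powr - a)) * (koranyi z w)\<^sup>2 powr - a"
      unfolding X_def using B k by (simp add: powr_divide powr_minus_divide)
    also have "ennreal \<dots> = ennreal ((B\<^sup>2) powr a / (1 - 2 powr - a)) * koranyi_kernel a z w"
      unfolding koranyi_kernel_def by (rule ennreal_mult'') simp
    finally show ?thesis .
  qed
  then show ?thesis by blast
qed

text \<open>
  By the previous lemma the integral against the kernel dominates the sum over all \<open>\<eta>\<close> of \<open>2^(a d(\<eta>))\<close> times
  the tent integral of \<open>g\<close> times the indicator in \<open>w\<close> of a Koranyi ball of \<open>\<nu>\<close>-mass about \<open>2^(-\<kappa> d(\<eta>))\<close>.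
  Dropping the mixed terms of its square leaves the tree energy, since \<open>2 a - \<kappa> = 2 \<sigma>\<close>.
\<close>
lemma tree_energy_le_square_kernel:
  assumes \<nu>: "koranyi_regular \<kappa> \<nu>" and \<sigma>: "0 \<le> \<sigma>" "0 < \<kappa>" and a: "a = \<kappa> / 2 + \<sigma>"
    and m: "sets m = sets borel" "sigma_finite_measure m" "AE z in m. norm z < 1"
  shows "\<exists>C. \<forall>g \<in> borel_measurable borel.
    tree_energy \<sigma> m g \<le> ennreal C * kernel_energy a m \<nu> g"
proof -
  note [measurable_cong] = m(1)
  interpret m: sigma_finite_measure m by fact
  have [measurable_cong, simp]: "sets \<nu> = sets borel" and AE: "AE w in \<nu>. norm w \<le> 1"
    using \<nu> by (auto simp: koranyi_regular_def elim: AE_mp)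
  have a0: "0 < a" using \<sigma> a by simp
  let ?V = "\<lambda>N \<eta>. koranyi_ball (centre \<eta>) (36 / 2 ^ N)"
  obtain c where c: "c > 0" "\<And>\<eta>. \<eta> \<in> vertices J \<Longrightarrow> ennreal (c * (1 / 2 ^ fst \<eta>) powr \<kappa>) \<le> emeasure \<nu> (?V (fst \<eta>) \<eta>)"
    using centre_ball_measure_ge[OF \<nu>] \<sigma>(2) by (auto simp: less_imp_le)
  obtain C where C: "\<And>z w. norm z < 1 \<Longrightarrow> norm w \<le> 1 \<Longrightarrow>
    (\<Sum>N. \<Sum>\<eta>\<in>level N. ennreal (2 powr (a * real N)) * indicator (?V N \<eta>) w * indicator (tent \<eta>) z)
      \<le> ennreal C * koranyi_kernel a z w"
    using tent_sum_le_kernel[OF a0] by blast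
  have "ennreal c * tree_energy \<sigma> m g \<le> (ennreal C)\<^sup>2 * kernel_energy a m \<nu> g"
    if g [measurable]: "g \<in> borel_measurable borel" for g
  proof -
    let ?G = "tent_integral m g" and ?F = "\<lambda>w. \<integral>\<^sup>+z. g z * koranyi_kernel a z w \<partial>m"
    have pointwise: "(\<Sum>N. \<Sum>\<eta>\<in>level N. (ennreal (2 powr (a * real N)) * indicator (?V N \<eta>) w * ?G \<eta>)\<^sup>2) \<le> (ennreal C * ?F w)\<^sup>2"
      if w: "norm w \<le> 1" for w
    proof -
      have "(\<Sum>N. \<Sum>\<eta>\<in>level N. ennreal (2 powr (a * real N)) * indicator (?V N \<eta>) w * ?G \<eta>) =
          (\<integral>\<^sup>+z. (\<Sum>N. \<Sum>\<eta>\<in>level N. ennreal (2 powr (a * real N)) * indicator (?V N \<eta>) w * (g z * indicator (tent \<eta>) z)) \<partial>m)"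
        by (simp add: nn_integral_suminf nn_integral_sum nn_integral_cmult tent_integral_def)
      also have "\<dots> = (\<integral>\<^sup>+z. g z * (\<Sum>N. \<Sum>\<eta>\<in>level N. ennreal (2 powr (a * real N)) * indicator (?V N \<eta>) w * indicator (tent \<eta>) z) \<partial>m)"
        unfolding ennreal_suminf_cmult[symmetric] sum_distrib_left by (simp only: mult_ac)
      also have "\<dots> \<le> (\<integral>\<^sup>+z. ennreal C * (g z * koranyi_kernel a z w) \<partial>m)"
      proof (rule nn_integral_mono_AE, rule AE_mp[OF m(3)], rule AE_I2, rule impI)
        fix z :: "complex ^ 'n" assume "norm z < 1"
        from mult_left_mono[OF C[OF this w], of "g z"]
        show "g z * (\<Sum>N. \<Sum>\<eta>\<in>level N. ennreal (2 powr (a * real N)) * indicator (?V N \<eta>) w * indicator (tent \<eta>) z)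
            \<le> ennreal C * (g z * koranyi_kernel a z w)"
          by (simp add: mult.left_commute)
      qed
      also have "\<dots> = ennreal C * ?F w" by (simp add: nn_integral_cmult)
      finally have le: "(\<Sum>N. \<Sum>\<eta>\<in>level N. ennreal (2 powr (a * real N)) * indicator (?V N \<eta>) w * ?G \<eta>) \<le> ennreal C * ?F w" .
      have "(\<Sum>N. \<Sum>\<eta>\<in>level N. (ennreal (2 powr (a * real N)) * indicator (?V N \<eta>) w * ?G \<eta>)\<^sup>2) \<le>
          (\<Sum>N. (\<Sum>\<eta>\<in>level N. ennreal (2 powr (a * real N)) * indicator (?V N \<eta>) w * ?G \<eta>)\<^sup>2)"
        by (intro suminf_le summableI ennreal_sum_squares_le)
      also have "\<dots> \<le> (\<Sum>N. \<Sum>\<eta>\<in>level N. ennreal (2 powr (a * real N)) * indicator (?V N \<eta>) w * ?G \<eta>)\<^sup>2"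
        by (rule ennreal_suminf_squares_le)
      also have "\<dots> \<le> (ennreal C * ?F w)\<^sup>2" using le by (rule power_mono) simp
      finally show ?thesis .
    qed
    have "ennreal c * tree_energy \<sigma> m g = (\<Sum>N. \<Sum>\<eta>\<in>level N. ennreal c * (ennreal (2 powr (2 * \<sigma> * real N)) * (?G \<eta>)\<^sup>2))"
      unfolding tree_energy_def ennreal_suminf_cmult[symmetric] sum_distrib_left ..
    also have "\<dots> \<le> (\<Sum>N. \<Sum>\<eta>\<in>level N. (ennreal (2 powr (a * real N)))\<^sup>2 * emeasure \<nu> (?V N \<eta>) * (?G \<eta>)\<^sup>2)"
    proof (intro suminf_le summableI sum_mono)
      fix N \<eta> assume \<eta>: "\<eta> \<in> level N"
      have "ennreal c * ennreal (2 powr (2 * \<sigma> * real N)) =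
          (ennreal (2 powr (a * real N)))\<^sup>2 * ennreal (c * (1 / 2 ^ N) powr \<kappa>)"
      proof -
        have "2 powr (2 * \<sigma> * real N) = (2 powr (a * real N))\<^sup>2 * (1 / 2 ^ N) powr \<kappa>"
          by (simp add: half_power_powr powr_power powr_add[symmetric] a algebra_simps)
        then show ?thesis
          using c(1) by (simp add: ennreal_power ennreal_mult'[symmetric] mult_ac)
      qed
      also have "\<dots> \<le> (ennreal (2 powr (a * real N)))\<^sup>2 * emeasure \<nu> (?V N \<eta>)"
        using c(2)[OF levelD(1)[OF \<eta>]] levelD(2)[OF \<eta>] by (intro mult_left_mono) auto
      finally show "ennreal c * (ennreal (2 powr (2 * \<sigma> * real N)) * (?G \<eta>)\<^sup>2) \<le>
          (ennreal (2 powr (a * real N)))\<^sup>2 * emeasure \<nu> (?V N \<eta>) * (?G \<eta>)\<^sup>2"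
        unfolding mult.assoc[symmetric] by (rule mult_right_mono) simp
    qed
    also have "\<dots> = (\<integral>\<^sup>+w. (\<Sum>N. \<Sum>\<eta>\<in>level N. (ennreal (2 powr (a * real N)))\<^sup>2 * (?G \<eta>)\<^sup>2 * indicator (?V N \<eta>) w) \<partial>\<nu>)"
      by (simp add: nn_integral_suminf nn_integral_sum nn_integral_cmult mult_ac)
    also have "\<dots> = (\<integral>\<^sup>+w. (\<Sum>N. \<Sum>\<eta>\<in>level N. (ennreal (2 powr (a * real N)) * indicator (?V N \<eta>) w * ?G \<eta>)\<^sup>2) \<partial>\<nu>)"
      by (intro nn_integral_cong suminf_cong sum.cong refl) (simp add: indicator_def power_mult_distrib)
    also have "\<dots> \<le> (\<integral>\<^sup>+w. (ennreal C * ?F w)\<^sup>2 \<partial>\<nu>)"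
      using AE pointwise by (intro nn_integral_mono_AE) auto
    also have "\<dots> = (ennreal C)\<^sup>2 * (\<integral>\<^sup>+w. (?F w)\<^sup>2 \<partial>\<nu>)"
      unfolding power_mult_distrib by (rule nn_integral_cmult) measurable
    finally show ?thesis .
  qed
  note main = this
  show ?thesis
  proof (intro exI[of _ "1 / c * C\<^sup>2"] ballI)
    fix g :: "complex ^ 'n \<Rightarrow> ennreal" assume g: "g \<in> borel_measurable borel"
    have "tree_energy \<sigma> m g = ennreal (1 / c) * (ennreal c * tree_energy \<sigma> m g)"
      using c(1) by (simp add: mult.assoc[symmetric] ennreal_mult'[symmetric])
    also have "\<dots> \<le> ennreal (1 / c) * ((ennreal C)\<^sup>2 * kernel_energy a m \<nu> g)"
      by (intro mult_left_mono main g) simp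
    also have "\<dots> \<le> ennreal (1 / c) * (ennreal (C\<^sup>2) * kernel_energy a m \<nu> g)"
    proof -
      have "(ennreal C)\<^sup>2 \<le> ennreal (C\<^sup>2)" by (cases "0 \<le> C") (auto simp: ennreal_power ennreal_neg)
      then show ?thesis by (intro mult_left_mono mult_right_mono) auto
    qed
    also have "\<dots> = ennreal (1 / c * C\<^sup>2) * kernel_energy a m \<nu> g"
      using c(1) by (simp add: ennreal_mult'[symmetric] mult.assoc[symmetric])
    finally show "tree_energy \<sigma> m g \<le> \<dots>" .
  qed
qed

end

section \<open>The Carleson embedding theorem on a tree\<close>

lemma power2_divide_add_le:
  fixes x y p q :: real
  assumes "0 \<le> p" "0 \<le> q" "p = 0 \<Longrightarrow> x = 0" "q = 0 \<Longrightarrow> y = 0"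
  shows "(x + y)\<^sup>2 / (p + q) \<le> x\<^sup>2 / p + y\<^sup>2 / q"
proof (cases "p = 0 \<or> q = 0")
  case True
  then show ?thesis using assms by auto
next
  case False
  then have pq: "0 < p" "0 < q" using assms by auto
  have "0 \<le> (x * q - y * p)\<^sup>2" by simp
  then have "(x + y)\<^sup>2 * (p * q) \<le> (x\<^sup>2 * q + y\<^sup>2 * p) * (p + q)"
    by (simp add: power2_eq_square algebra_simps)
  then have "(x + y)\<^sup>2 / (p + q) \<le> (x\<^sup>2 * q + y\<^sup>2 * p) / (p * q)"
    using pq by (simp add: frac_le_eq pos_divide_le_eq pos_le_divide_eq)
  also have "\<dots> = x\<^sup>2 / p + y\<^sup>2 / q"
    using pq by (simp add: field_simps)
  finally show ?thesis .
qed

lemma power2_sum_divide_le: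
  fixes x y :: "'i \<Rightarrow> real"
  assumes "finite I" "\<And>i. i \<in> I \<Longrightarrow> 0 \<le> y i" "\<And>i. i \<in> I \<Longrightarrow> y i = 0 \<Longrightarrow> x i = 0"
  shows "(\<Sum>i\<in>I. x i)\<^sup>2 / (\<Sum>i\<in>I. y i) \<le> (\<Sum>i\<in>I. (x i)\<^sup>2 / y i)"
  using assms
proof (induction I rule: finite_induct)
  case (insert k I)
  have "(x k + (\<Sum>i\<in>I. x i))\<^sup>2 / (y k + (\<Sum>i\<in>I. y i)) \<le> (x k)\<^sup>2 / y k + (\<Sum>i\<in>I. x i)\<^sup>2 / (\<Sum>i\<in>I. y i)"
    using insert by (intro power2_divide_add_le) (auto simp: sum_nonneg sum_nonneg_eq_0_iff)
  also have "\<dots> \<le> (x k)\<^sup>2 / y k + (\<Sum>i\<in>I. (x i)\<^sup>2 / y i)"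
    using insert by simp
  finally show ?case using insert(1,2) by simp
qed simp

text \<open>
  The quantity \<open>F - G^2 / (m + A)\<close> is a Bellman function for the embedding: here \<open>m\<close>, \<open>G\<close>, \<open>F\<close> are
  the integrals of \<open>1\<close>, \<open>g\<close>, \<open>g^2\<close> over a node and \<open>A \<le> m\<close> is the part of the Carleson sum
  below it. Passing from a node to its children decreases the total by at least a quarter of the
  term \<open>a * G^2\<close> of the node, since the mass \<open>a * m^2\<close> of the node is then missing from the
  denominator.
\<close>
lemma bellman_step:
  fixes m G F A :: "'i \<Rightarrow> real"
  assumes fin: "finite C" and nn: "\<And>i. i \<in> C \<Longrightarrow> 0 \<le> m i \<and> 0 \<le> A i \<and> (m i = 0 \<longrightarrow> G i = 0)"
    and a: "0 \<le> a" and M: "0 \<le> M" "M = 0 \<Longrightarrow> g = 0" and B: "a * M\<^sup>2 + (\<Sum>i\<in>C. A i) \<le> B" "B \<le> M"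
    and leftover: "(g - (\<Sum>i\<in>C. G i))\<^sup>2 \<le> (f - (\<Sum>i\<in>C. F i)) * (M - (\<Sum>i\<in>C. m i))"
      "0 \<le> f - (\<Sum>i\<in>C. F i)" "0 \<le> M - (\<Sum>i\<in>C. m i)"
  shows "a * g\<^sup>2 \<le> 4 * ((f - g\<^sup>2 / (M + B)) - (\<Sum>i\<in>C. F i - (G i)\<^sup>2 / (m i + A i)))"
proof -
  let ?g = "g - (\<Sum>i\<in>C. G i)" and ?f = "f - (\<Sum>i\<in>C. F i)" and ?m = "M - (\<Sum>i\<in>C. m i)"
  let ?A = "\<Sum>i\<in>C. A i"
  have A0: "0 \<le> ?A" and m0: "0 \<le> (\<Sum>i\<in>C. m i)" using nn by (auto intro: sum_nonneg)
  have zero: "?m = 0 \<Longrightarrow> ?g = 0" using leftover(1) by simp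
  have "?g\<^sup>2 / ?m \<le> ?f"
    using leftover by (cases "?m = 0") (auto simp: divide_le_eq)
  moreover have "(\<Sum>i\<in>C. G i)\<^sup>2 / (\<Sum>i\<in>C. m i + A i) \<le> (\<Sum>i\<in>C. (G i)\<^sup>2 / (m i + A i))"
    using fin nn by (intro power2_sum_divide_le) (auto simp: add_nonneg_eq_0_iff)
  moreover have "(?g + (\<Sum>i\<in>C. G i))\<^sup>2 / (?m + (\<Sum>i\<in>C. m i + A i)) \<le>
      ?g\<^sup>2 / ?m + (\<Sum>i\<in>C. G i)\<^sup>2 / (\<Sum>i\<in>C. m i + A i)"
  proof (rule power2_divide_add_le)
    show "(\<Sum>i\<in>C. G i) = 0" if "(\<Sum>i\<in>C. m i + A i) = 0"
      using that fin nn by (subst (asm) sum_nonneg_eq_0_iff) (auto simp: add_nonneg_eq_0_iff)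
  qed (use leftover zero nn in \<open>auto intro: sum_nonneg\<close>)
  ultimately have "g\<^sup>2 / (M + ?A) \<le> ?f + (\<Sum>i\<in>C. (G i)\<^sup>2 / (m i + A i))"
    by (simp add: sum.distrib)
  then have step: "g\<^sup>2 / (M + ?A) - g\<^sup>2 / (M + B) \<le>
      (f - g\<^sup>2 / (M + B)) - (\<Sum>i\<in>C. F i - (G i)\<^sup>2 / (m i + A i))"
    by (simp add: sum_subtractf)
  have "a * g\<^sup>2 \<le> 4 * (g\<^sup>2 / (M + ?A) - g\<^sup>2 / (M + B))"
  proof (cases "M = 0")
    case False
    then have M: "0 < M" using M by simp
    have am: "0 \<le> a * M\<^sup>2" using a by simp
    have BA: "a * M\<^sup>2 \<le> B - ?A" "0 \<le> B" using B A0 am by linarith+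
    have den: "(M + ?A) * (M + B) \<le> (2 * M) * (2 * M)"
      using M B A0 BA am by (intro mult_mono) auto
    have "a * g\<^sup>2 * ((M + ?A) * (M + B)) \<le> a * g\<^sup>2 * ((2 * M) * (2 * M))"
      using den a by (intro mult_left_mono) auto
    also have "\<dots> = 4 * (a * M\<^sup>2) * g\<^sup>2" by (simp add: power2_eq_square)
    also have "\<dots> \<le> 4 * (B - ?A) * g\<^sup>2" using BA by (intro mult_right_mono) auto
    finally have "a * g\<^sup>2 \<le> 4 * (B - ?A) * g\<^sup>2 / ((M + ?A) * (M + B))"
      using M A0 BA by (subst pos_le_divide_eq) auto
    also have "\<dots> = 4 * (g\<^sup>2 / (M + ?A) - g\<^sup>2 / (M + B))"
      using M A0 BA by (simp add: divide_simps) (simp add: algebra_simps)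
    finally show ?thesis .
  qed (use M in simp)
  then show ?thesis using step by simp
qed

text \<open>
  The decreases of the Bellman sums from level to level add up to at most the first of these sums.
\<close>
lemma bellman_telescope:
  fixes m G F A a :: "nat \<Rightarrow> 'i \<Rightarrow> real" and par :: "nat \<Rightarrow> 'i \<Rightarrow> 'i"
  defines "C \<equiv> \<lambda>N i I. {k \<in> I (Suc N). par N k = i}"
  assumes fin: "\<And>N. finite (I N)" and par: "\<And>N k. k \<in> I (Suc N) \<Longrightarrow> par N k \<in> I N"
    and nn: "\<And>N i. i \<in> I N \<Longrightarrow> 0 \<le> m N i \<and> 0 \<le> A N i \<and> 0 \<le> a N i"
    and CS: "\<And>N i. i \<in> I N \<Longrightarrow> (G N i)\<^sup>2 \<le> F N i * m N i \<and> 0 \<le> F N i"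
    and carleson: "\<And>N i. i \<in> I N \<Longrightarrow> a N i * (m N i)\<^sup>2 + (\<Sum>k\<in>C N i I. A (Suc N) k) \<le> A N i \<and> A N i \<le> m N i"
    and leftover: "\<And>N i. i \<in> I N \<Longrightarrow>
        (G N i - (\<Sum>k\<in>C N i I. G (Suc N) k))\<^sup>2 \<le>
        (F N i - (\<Sum>k\<in>C N i I. F (Suc N) k)) * (m N i - (\<Sum>k\<in>C N i I. m (Suc N) k)) \<and>
        0 \<le> F N i - (\<Sum>k\<in>C N i I. F (Suc N) k) \<and> 0 \<le> m N i - (\<Sum>k\<in>C N i I. m (Suc N) k)"
  shows "(\<Sum>N<L. \<Sum>i\<in>I N. a N i * (G N i)\<^sup>2) \<le> 4 * (\<Sum>i\<in>I 0. F 0 i)"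
proof -
  define \<Phi> where "\<Phi> N = (\<Sum>i\<in>I N. F N i - (G N i)\<^sup>2 / (m N i + A N i))" for N
  have G0: "G N i = 0" if "i \<in> I N" "m N i = 0" for N i using CS[OF that(1)] that(2) by simp
  have step: "(\<Sum>i\<in>I N. a N i * (G N i)\<^sup>2) \<le> 4 * (\<Phi> N - \<Phi> (Suc N))" for N
  proof -
    have "\<Phi> (Suc N) = (\<Sum>i\<in>I N. \<Sum>k\<in>C N i I. F (Suc N) k - (G (Suc N) k)\<^sup>2 / (m (Suc N) k + A (Suc N) k))"
      unfolding \<Phi>_def C_def using par by (intro sum.group[symmetric] fin) auto
    then have "4 * (\<Phi> N - \<Phi> (Suc N)) = (\<Sum>i\<in>I N. 4 * ((F N i - (G N i)\<^sup>2 / (m N i + A N i))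
        - (\<Sum>k\<in>C N i I. F (Suc N) k - (G (Suc N) k)\<^sup>2 / (m (Suc N) k + A (Suc N) k))))"
      unfolding \<Phi>_def by (simp only: sum_distrib_left[symmetric] sum_subtractf)
    moreover have "a N i * (G N i)\<^sup>2 \<le> 4 * ((F N i - (G N i)\<^sup>2 / (m N i + A N i))
        - (\<Sum>k\<in>C N i I. F (Suc N) k - (G (Suc N) k)\<^sup>2 / (m (Suc N) k + A (Suc N) k)))"
      if i: "i \<in> I N" for i
      using carleson[OF i] leftover[OF i] nn[OF i] nn[of _ "Suc N"] G0[OF i] G0[of _ "Suc N"] fin[of "Suc N"]
      by (intro bellman_step) (auto simp: C_def)
    ultimately show ?thesis by (simp add: sum_mono)
  qed
  have "(\<Sum>N<L. \<Sum>i\<in>I N. a N i * (G N i)\<^sup>2) \<le> (\<Sum>N<L. 4 * (\<Phi> N - \<Phi> (Suc N)))"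
    by (intro sum_mono step)
  also have "\<dots> = 4 * (\<Phi> 0 - \<Phi> L)"
    by (simp only: sum_distrib_left[symmetric] sum_lessThan_telescope')
  also have "\<dots> \<le> 4 * (\<Sum>i\<in>I 0. F 0 i)"
  proof -
    have "0 \<le> \<Phi> L"
      unfolding \<Phi>_def
    proof (rule sum_nonneg)
      fix i assume i: "i \<in> I L"
      have "(G L i)\<^sup>2 \<le> F L i * (m L i + A L i)"
        using CS[OF i] nn[OF i] by (smt (verit) mult_nonneg_nonneg distrib_left)
      then have "(G L i)\<^sup>2 / (m L i + A L i) \<le> F L i"
        using nn[OF i] CS[OF i] by (cases "m L i + A L i = 0") (auto simp: divide_le_eq)
      then show "0 \<le> F L i - (G L i)\<^sup>2 / (m L i + A L i)" by simp
    qed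
    moreover have "\<Phi> 0 \<le> (\<Sum>i\<in>I 0. F 0 i)"
      unfolding \<Phi>_def using nn[of _ 0] by (intro sum_mono) (simp add: divide_nonneg_nonneg)
    ultimately show ?thesis by simp
  qed
  finally show ?thesis .
qed

text \<open>
  A dyadic embedding for the averages of \<open>g\<close>: with \<open>w = a * m^2\<close> the hypothesis says that the \<open>w\<close>-mass below each
  node is at most its measure \<open>m\<close>, where \<open>A\<close> may be any majorant of that mass which is superadditive along
  the tree. The part of a node outside its children is handled by the Cauchy-Schwarz inequality, as if it were a
  further child with no mass below it.
\<close>
theorem carleson_embedding:
  fixes M :: "'a measure" and g :: "'a \<Rightarrow> ennreal" and A a :: "nat \<Rightarrow> 'i \<Rightarrow> real"
  assumes "finite_measure M" and g [measurable]: "g \<in> borel_measurable M"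
    and fin: "\<And>N. finite (I N)" and par: "\<And>N k. k \<in> I (Suc N) \<Longrightarrow> par N k \<in> I N"
    and S [measurable]: "\<And>N i. i \<in> I N \<Longrightarrow> S N i \<in> sets M"
    and disj: "\<And>N. disjoint_family_on (S N) (I N)"
    and sub: "\<And>N k. k \<in> I (Suc N) \<Longrightarrow> S (Suc N) k \<subseteq> S N (par N k)"
    and nn: "\<And>N i. i \<in> I N \<Longrightarrow> 0 \<le> A N i \<and> 0 \<le> a N i"
    and carleson: "\<And>N i. i \<in> I N \<Longrightarrow>
      a N i * (measure M (S N i))\<^sup>2 + (\<Sum>k | k \<in> I (Suc N) \<and> par N k = i. A (Suc N) k) \<le> A N i \<and>
      A N i \<le> measure M (S N i)"
  shows "(\<Sum>N. \<Sum>i\<in>I N. ennreal (a N i) * (\<integral>\<^sup>+x\<in>S N i. g x \<partial>M)\<^sup>2) \<le> 4 * (\<integral>\<^sup>+x. (g x)\<^sup>2 \<partial>M)"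
proof (cases "(\<integral>\<^sup>+x. (g x)\<^sup>2 \<partial>M) = \<infinity>")
  case False
  interpret finite_measure M by fact
  let ?M1 = "density M g" and ?M2 = "density M (\<lambda>x. (g x)\<^sup>2)"
  have CS: "(emeasure ?M1 K)\<^sup>2 \<le> emeasure ?M2 K * emeasure M K" if [measurable]: "K \<in> sets M" for K
  proof -
    have "(\<integral>\<^sup>+x. (g x * indicator K x) * indicator K x \<partial>M)\<^sup>2 \<le>
        (\<integral>\<^sup>+x. (g x * indicator K x)\<^sup>2 \<partial>M) * (\<integral>\<^sup>+x. (indicator K x)\<^sup>2 \<partial>M)"
      by (rule Cauchy_Schwarz_nn_integral) measurable
    moreover have "(g x * indicator K x)\<^sup>2 = (g x)\<^sup>2 * indicator K x" "(indicator K x :: ennreal)\<^sup>2 = indicator K x"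
      "g x * indicator K x * indicator K x = g x * indicator K x" for x
      by (auto simp: indicator_def)
    ultimately show ?thesis by (simp add: emeasure_density)
  qed
  have dens: "emeasure (density M h) (space M) = (\<integral>\<^sup>+x. h x \<partial>M)" if "h \<in> borel_measurable M" for h
    using that by (subst emeasure_density) (auto intro!: nn_integral_cong)
  interpret M2: finite_measure ?M2
    using False by (intro finite_measureI) (simp add: dens)
  have "emeasure ?M2 (space M) * emeasure M (space M) < \<infinity>"
    unfolding less_top[symmetric] infinity_ennreal_def ennreal_mult_eq_top_iff by simp
  then have "(emeasure ?M1 (space M))\<^sup>2 < \<infinity>"
    using CS[OF sets.top] by (rule le_less_trans[rotated])
  then have "emeasure ?M1 (space M) \<noteq> \<infinity>" by (auto simp: power2_eq_square)
  then interpret M1: finite_measure ?M1 by (intro finite_measureI) simp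
  have CSr: "(measure ?M1 K)\<^sup>2 \<le> measure ?M2 K * measure M K" if "K \<in> sets M" for K
  proof -
    have "ennreal ((measure ?M1 K)\<^sup>2) \<le> ennreal (measure ?M2 K * measure M K)"
      using CS[OF that] by (simp only: emeasure_eq_measure M1.emeasure_eq_measure
        M2.emeasure_eq_measure ennreal_power measure_nonneg ennreal_mult[OF measure_nonneg measure_nonneg])
    then show ?thesis by (subst (asm) ennreal_le_iff) simp_all
  qed
  let ?C = "\<lambda>N i. {k \<in> I (Suc N). par N k = i}" and ?U = "\<lambda>N i. \<Union>k\<in>{k \<in> I (Suc N). par N k = i}. S (Suc N) k"
  have finC: "finite (?C N i)" for N i using fin by simp
  have U [measurable]: "?U N i \<in> sets M" for N i
    using finC by (intro sets.finite_UN) auto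
  have US: "?U N i \<subseteq> S N i" for N i using sub by auto
  have disjC: "disjoint_family_on (S (Suc N)) (?C N i)" for N i
    by (rule disjoint_family_on_mono[OF _ disj]) auto
  have diff: "measure P (S N i) - (\<Sum>k\<in>?C N i. measure P (S (Suc N) k)) = measure P (S N i - ?U N i)"
    if "finite_measure P" "sets P = sets M" "i \<in> I N" for P :: "'a measure" and N i
  proof -
    interpret P: finite_measure P by fact
    have sets: "S N i \<in> sets P" "?U N i \<in> sets P" "(\<lambda>k. S (Suc N) k) ` ?C N i \<subseteq> sets P"
      unfolding that(2) using S[OF that(3)] U[of N i] S by blast+
    have "measure P (S N i - ?U N i) = measure P (S N i) - measure P (?U N i)"
      by (rule P.finite_measure_Diff[OF sets(1,2) US])
    also have "measure P (?U N i) = (\<Sum>k\<in>?C N i. measure P (S (Suc N) k))"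
      by (rule P.finite_measure_finite_Union[OF finC sets(3) disjC])
    finally show ?thesis by simp
  qed
  have main: "(\<Sum>N<L. \<Sum>i\<in>I N. a N i * (measure ?M1 (S N i))\<^sup>2) \<le> 4 * (\<Sum>i\<in>I 0. measure ?M2 (S 0 i))" for L
  proof (rule bellman_telescope[where m = "\<lambda>N i. measure M (S N i)" and A = A and par = par])
    fix N i assume i: "i \<in> I N"
    show "(measure ?M1 (S N i) - (\<Sum>k\<in>?C N i. measure ?M1 (S (Suc N) k)))\<^sup>2 \<le>
      (measure ?M2 (S N i) - (\<Sum>k\<in>?C N i. measure ?M2 (S (Suc N) k))) *
      (measure M (S N i) - (\<Sum>k\<in>?C N i. measure M (S (Suc N) k))) \<and>
      0 \<le> measure ?M2 (S N i) - (\<Sum>k\<in>?C N i. measure ?M2 (S (Suc N) k)) \<and>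
      0 \<le> measure M (S N i) - (\<Sum>k\<in>?C N i. measure M (S (Suc N) k))"
      unfolding diff[OF M1.finite_measure_axioms _ i, simplified] diff[OF M2.finite_measure_axioms _ i, simplified]
        diff[OF finite_measure_axioms refl i]
      using CSr S[OF i] U by simp
  qed (use fin par nn carleson CSr S in auto)
  have "(\<Sum>N<L. \<Sum>i\<in>I N. ennreal (a N i) * (\<integral>\<^sup>+x\<in>S N i. g x \<partial>M)\<^sup>2) \<le> 4 * (\<integral>\<^sup>+x. (g x)\<^sup>2 \<partial>M)" for L
  proof -
    have "(\<Sum>N<L. \<Sum>i\<in>I N. ennreal (a N i) * (\<integral>\<^sup>+x\<in>S N i. g x \<partial>M)\<^sup>2) =
        (\<Sum>N<L. \<Sum>i\<in>I N. ennreal (a N i * (measure ?M1 (S N i))\<^sup>2))"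
      using nn by (intro sum.cong refl)
        (simp add: emeasure_density[symmetric] M1.emeasure_eq_measure ennreal_mult' ennreal_power)
    also have "\<dots> = ennreal (\<Sum>N<L. \<Sum>i\<in>I N. a N i * (measure ?M1 (S N i))\<^sup>2)"
      using nn by (simp add: sum_ennreal sum_nonneg)
    also have "\<dots> \<le> ennreal (4 * (\<Sum>i\<in>I 0. measure ?M2 (S 0 i)))"
      using main by (rule ennreal_leI)
    also have "(\<Sum>i\<in>I 0. measure ?M2 (S 0 i)) = measure ?M2 (\<Union>i\<in>I 0. S 0 i)"
      using fin disj S by (intro M2.finite_measure_finite_Union[symmetric]) auto
    also have "ennreal (4 * \<dots>) \<le> ennreal (4 * measure ?M2 (space M))"
      using M2.bounded_measure by (intro ennreal_leI mult_left_mono) simp_all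
    also have "\<dots> = 4 * emeasure ?M2 (space M)"
      by (simp add: M2.emeasure_eq_measure ennreal_mult')
    finally show ?thesis by (simp add: dens)
  qed
  then show ?thesis by (intro suminf_le_const summableI)
qed simp

section \<open>The tree condition as a Carleson condition\<close>

context bergman_tree
begin

lemma nn_integral_count_vertices:
  fixes h :: "vertex \<Rightarrow> ennreal"
  shows "(\<integral>\<^sup>+\<eta>. h \<eta> \<partial>count_space (vertices J)) = (\<Sum>N. \<Sum>\<eta>\<in>level N. h \<eta>)"
proof -
  have "(\<Sum>N. \<Sum>\<eta>\<in>level N. h \<eta>) = (\<Sum>N. \<integral>\<^sup>+\<eta>. h \<eta> * indicator (level N) \<eta> \<partial>count_space UNIV)"
    using finite_level by (simp add: nn_integral_count_space_finite[symmetric] nn_integral_count_space_indicator)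
  also have "\<dots> = (\<integral>\<^sup>+\<eta>. (\<Sum>N. h \<eta> * indicator (level N) \<eta>) \<partial>count_space UNIV)"
    by (subst nn_integral_suminf) auto
  also have "\<dots> = (\<integral>\<^sup>+\<eta>. h \<eta> * indicator (vertices J) \<eta> \<partial>count_space UNIV)"
  proof (rule nn_integral_cong)
    fix \<eta>
    have "(\<Sum>N. h \<eta> * indicator (level N) \<eta>) = (\<Sum>N\<in>{fst \<eta>}. h \<eta> * indicator (level N) \<eta>)"
      by (rule suminf_finite) (auto simp: level_def indicator_def)
    then show "(\<Sum>N. h \<eta> * indicator (level N) \<eta>) = h \<eta> * indicator (vertices J) \<eta>"
      by (simp add: level_def indicator_def)
  qed
  also have "\<dots> = (\<integral>\<^sup>+\<eta>. h \<eta> \<partial>count_space (vertices J))"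
    by (simp add: nn_integral_count_space_indicator)
  finally show ?thesis ..
qed

text \<open>
  The sets above the children of \<open>\<eta>\<close> are disjoint and do not contain \<open>\<eta>\<close>; this gives the superadditivity
  needed for the embedding theorem.
\<close>
lemma nn_integral_above_ge:
  fixes h :: "vertex \<Rightarrow> ennreal"
  assumes \<eta>: "\<eta> \<in> level N"
  shows "h \<eta> + (\<Sum>\<xi> | \<xi> \<in> level (Suc N) \<and> parent \<xi> = \<eta>. \<integral>\<^sup>+\<beta>. h \<beta> \<partial>count_space (above J c Q \<xi>))
    \<le> (\<integral>\<^sup>+\<beta>. h \<beta> \<partial>count_space (above J c Q \<eta>))"
proof -
  let ?C = "{\<xi> \<in> level (Suc N). parent \<xi> = \<eta>}" and ?A = "above J c Q"
  have fin: "finite ?C" using finite_level by simp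
  have disj: "disjoint_family_on ?A ?C"
    unfolding disjoint_family_on_def using above_same_level by (fastforce simp: level_def)
  have sub: "(\<Union>\<xi>\<in>?C. ?A \<xi>) \<subseteq> ?A \<eta>"
  proof (rule UN_least)
    fix \<xi> assume "\<xi> \<in> ?C"
    then have "\<xi> \<in> ?A \<eta>" using child_above[of \<xi> N] by (auto simp: level_def)
    then show "?A \<xi> \<subseteq> ?A \<eta>" by (rule above_mono)
  qed
  have out: "\<eta> \<notin> (\<Union>\<xi>\<in>?C. ?A \<xi>)"
    using above_level[of \<eta>] \<eta> by (fastforce simp: level_def)
  have "h \<eta> + (\<Sum>\<xi>\<in>?C. \<integral>\<^sup>+\<beta>. h \<beta> \<partial>count_space (?A \<xi>)) =
      (\<integral>\<^sup>+\<beta>. h \<beta> * indicator {\<eta>} \<beta> \<partial>count_space UNIV) + (\<Sum>\<xi>\<in>?C. \<integral>\<^sup>+\<beta>. h \<beta> * indicator (?A \<xi>) \<beta> \<partial>count_space UNIV)"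
    by (simp add: nn_integral_count_space_indicator[symmetric] nn_integral_count_space_finite)
  also have "\<dots> = (\<integral>\<^sup>+\<beta>. h \<beta> * indicator {\<eta>} \<beta> + (\<Sum>\<xi>\<in>?C. h \<beta> * indicator (?A \<xi>) \<beta>) \<partial>count_space UNIV)"
    by (simp add: nn_integral_add nn_integral_sum)
  also have "\<dots> = (\<integral>\<^sup>+\<beta>. h \<beta> * (indicator {\<eta>} \<beta> + indicator (\<Union>\<xi>\<in>?C. ?A \<xi>) \<beta>) \<partial>count_space UNIV)"
    by (simp add: sum_distrib_left[symmetric] indicator_UN_disjoint[OF fin disj] distrib_left)
  also have "\<dots> \<le> (\<integral>\<^sup>+\<beta>. h \<beta> * indicator (?A \<eta>) \<beta> \<partial>count_space UNIV)"
  proof (intro nn_integral_mono mult_left_mono)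
    fix \<beta>
    show "indicator {\<eta>} \<beta> + indicator (\<Union>\<xi>\<in>?C. ?A \<xi>) \<beta> \<le> (indicator (?A \<eta>) \<beta> :: ennreal)"
    proof (cases "\<beta> = \<eta>")
      case True
      then show ?thesis using out self_above[OF levelD(1)[OF \<eta>]] by (simp add: indicator_def)
    next
      case False
      then show ?thesis using sub by (auto simp: indicator_def)
    qed
  qed simp
  also have "\<dots> = (\<integral>\<^sup>+\<beta>. h \<beta> \<partial>count_space (?A \<eta>))"
    by (simp add: nn_integral_count_space_indicator)
  finally show ?thesis by simp
qed

definition tree_weight :: "real \<Rightarrow> (complex ^ 'n) measure \<Rightarrow> vertex \<Rightarrow> ennreal" where
  "tree_weight \<sigma> m \<beta> = (ennreal (2 powr (\<sigma> * real (fst \<beta>))) * emeasure m (tent \<beta>))\<^sup>2"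

abbreviation tree_sum :: "real \<Rightarrow> (complex ^ 'n) measure \<Rightarrow> vertex \<Rightarrow> ennreal" where
  "tree_sum \<sigma> m \<eta> \<equiv> \<integral>\<^sup>+\<beta>. tree_weight \<sigma> m \<beta> \<partial>count_space (above J c Q \<eta>)"

text \<open>
  The tree condition for measures on the whole space carried by the ball. Here the constant is real and the
  finiteness of the tents is stated separately, since a product with the constant \<open>0\<close> says nothing about it.
\<close>
definition tree_test :: "real \<Rightarrow> (complex ^ 'n) measure \<Rightarrow> bool" where
  "tree_test \<sigma> m \<longleftrightarrow> (\<exists>C>0. \<forall>\<eta>\<in>vertices J.
     tree_sum \<sigma> m \<eta> \<le> ennreal C * emeasure m (tent \<eta>) \<and>
     emeasure m (tent \<eta>) < \<infinity>)"

lemma tree_condition_iff_test: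
  assumes \<mu>: "sets \<mu> = sets (restrict_space borel (ball 0 1))"
    and m: "\<And>A. A \<in> sets borel \<Longrightarrow> A \<subseteq> ball 0 1 \<Longrightarrow> emeasure m A = emeasure \<mu> A"
  shows "tree_condition J c Q \<sigma> \<mu> \<longleftrightarrow> tree_test \<sigma> m"
proof -
  let ?A = "above J c Q"
  have I: "I_star J c Q \<mu> \<eta> = emeasure m (tent \<eta>)" for \<eta>
    using I_star_eq[OF \<mu>] m[OF tent_sets tent_ball] by simp
  have W: "(\<integral>\<^sup>+\<beta>. (ennreal (2 powr (\<sigma> * real (depth J c Q \<beta>))) * emeasure m (tent \<beta>))\<^sup>2 \<partial>count_space (?A \<eta>)) =
      tree_sum \<sigma> m \<eta>" for \<eta>
  proof (rule nn_integral_cong)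
    fix \<beta> assume "\<beta> \<in> space (count_space (?A \<eta>))"
    then have "\<beta> \<in> ?A \<eta>" by simp
    from depth_eq[OF aboveD[OF this]]
    show "(ennreal (2 powr (\<sigma> * real (depth J c Q \<beta>))) * emeasure m (tent \<beta>))\<^sup>2 = tree_weight \<sigma> m \<beta>"
      by (simp add: tree_weight_def)
  qed
  show ?thesis
  proof
    assume "tree_condition J c Q \<sigma> \<mu>"
    then obtain C :: ennreal where C0: "C < \<infinity> \<and> (\<forall>\<eta>\<in>vertices J.
        tree_sum \<sigma> m \<eta> \<le> C * emeasure m (tent \<eta>) \<and> C * emeasure m (tent \<eta>) < \<infinity>)"
      unfolding tree_condition_def I W ..
    note C = conjunct1[OF C0] conjunct2[OF C0, rule_format]
    obtain r where r: "C = ennreal r" "0 \<le> r" using C(1) by (cases C) auto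
    have fin: "emeasure m (tent \<eta>) < \<infinity>" if \<eta>: "\<eta> \<in> vertices J" for \<eta>
    proof (rule ccontr)
      assume "\<not> emeasure m (tent \<eta>) < \<infinity>"
      then have top: "emeasure m (tent \<eta>) = \<infinity>" by (simp add: not_less top_unique)
      have "tree_weight \<sigma> m \<eta> \<le> tree_sum \<sigma> m \<eta>"
        using self_above[OF \<eta>] by (rule nn_integral_ge_point)
      also have "\<dots> < \<infinity>" using C(2)[OF \<eta>] by (elim conjE) (rule le_less_trans)
      finally show False by (simp add: tree_weight_def top ennreal_mult_top power2_eq_square)
    qed
    show "tree_test \<sigma> m"
      unfolding tree_test_def
    (* The constant in the tree condition may be 0. *)
    proof (intro exI[of _ "r + 1"] conjI ballI)
      fix \<eta> assume \<eta>: "\<eta> \<in> vertices J"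
      have "C * emeasure m (tent \<eta>) \<le> ennreal (r + 1) * emeasure m (tent \<eta>)"
        using r by (intro mult_right_mono) auto
      then show "tree_sum \<sigma> m \<eta> \<le> ennreal (r + 1) * emeasure m (tent \<eta>)"
        using conjunct1[OF C(2)[OF \<eta>]] by (rule order_trans[rotated])
    qed (use r fin in simp_all)
  next
    assume "tree_test \<sigma> m"
    then obtain C where C0: "C > 0 \<and> (\<forall>\<eta>\<in>vertices J.
       tree_sum \<sigma> m \<eta> \<le> ennreal C * emeasure m (tent \<eta>) \<and>
       emeasure m (tent \<eta>) < \<infinity>)" unfolding tree_test_def ..
    note C = conjunct1[OF C0] conjunct2[OF C0, rule_format]
    show "tree_condition J c Q \<sigma> \<mu>"
      unfolding tree_condition_def I W
    proof (intro exI[of _ "ennreal C"] conjI ballI)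
      fix \<eta> assume \<eta>: "\<eta> \<in> vertices J"
      show "ennreal C * emeasure m (tent \<eta>) < \<infinity>"
        using C(2)[OF \<eta>] by (simp add: ennreal_mult_less_top)
    qed (use C(2) in simp_all)
  qed
qed

text \<open>
  The embedding theorem for the tents, with the coefficients of the tree energy divided by the testing
  constant; the majorant at \<open>\<eta>\<close> is the sum in the tree condition.
\<close>
lemma tree_test_imp_tree_energy_le:
  assumes m: "sets m = sets borel" "AE z in m. norm z < 1" and test: "tree_test \<sigma> m"
  shows "\<exists>C. \<forall>g \<in> borel_measurable borel. tree_energy \<sigma> m g \<le> ennreal C * (\<integral>\<^sup>+z. (g z)\<^sup>2 \<partial>m)"
proof -
  let ?A = "above J c Q"
  obtain C where C0: "C > 0 \<and> (\<forall>\<eta>\<in>vertices J.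
     tree_sum \<sigma> m \<eta> \<le> ennreal C * emeasure m (tent \<eta>) \<and>
     emeasure m (tent \<eta>) < \<infinity>)"
    using test unfolding tree_test_def ..
  note C = conjunct1[OF C0] conjunct2[OF C0, rule_format]
  have "emeasure m (space m) \<le> emeasure m (tent root)"
    using m by (intro emeasure_mono_AE) (auto simp: tent_root)
  also have "\<dots> < \<infinity>" using C(2)[OF root_vertex] by simp
  finally have fm: "finite_measure m" by (intro finite_measureI) simp
  then interpret finite_measure m .
  define T where "T \<eta> = tree_sum \<sigma> m \<eta>" for \<eta>
  have T: "T \<eta> \<le> ennreal (C * measure m (tent \<eta>))" if "\<eta> \<in> vertices J" for \<eta>
    using C(2)[OF that] C(1) by (simp add: T_def emeasure_eq_measure ennreal_mult)
  have Tfin: "T \<eta> = ennreal (enn2real (T \<eta>))" if "\<eta> \<in> vertices J" for \<eta>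
    using T[OF that] by (cases "T \<eta>") (auto simp: top_unique)
  define a where "a N (\<eta> :: vertex) = 2 powr (2 * \<sigma> * real N) / C" for N \<eta>
  define A where "A N \<eta> = enn2real (T \<eta>) / C" for N :: nat and \<eta>
  have carleson: "(\<Sum>N. \<Sum>\<eta>\<in>level N. ennreal (a N \<eta>) * (\<integral>\<^sup>+z\<in>tent \<eta>. g z \<partial>m)\<^sup>2) \<le> 4 * (\<integral>\<^sup>+z. (g z)\<^sup>2 \<partial>m)"
    if g: "g \<in> borel_measurable borel" for g
  proof (rule carleson_embedding[where par = "\<lambda>N. parent" and A = A, OF fm])
    show "g \<in> borel_measurable m" using g m(1) by (simp cong: measurable_cong_sets)
    show "finite (level N)" for N by (rule finite_level)
    show "parent \<eta> \<in> level N" if "\<eta> \<in> level (Suc N)" for N \<eta>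
      using parent(1,2)[of \<eta> N] that by (simp add: level_def)
    show "tent \<eta> \<in> sets m" for \<eta> using m(1) by simp
    show "disjoint_family_on tent (level N)" for N by (rule disjoint_tents)
    show "tent \<eta> \<subseteq> tent (parent \<eta>)" if "\<eta> \<in> level (Suc N)" for N \<eta>
      using tent_parent[of \<eta> N] that by (simp add: level_def)
    show "0 \<le> A N \<eta> \<and> 0 \<le> a N \<eta>" for N \<eta> using C(1) by (simp add: A_def a_def)
    fix N \<eta> assume \<eta>: "\<eta> \<in> level N"
    let ?ch = "{\<xi>. \<xi> \<in> level (Suc N) \<and> parent \<xi> = \<eta>}"
    have ch: "\<xi> \<in> vertices J" if "\<xi> \<in> ?ch" for \<xi> using that by (auto simp: level_def)
    have w: "tree_weight \<sigma> m \<eta> = ennreal (2 powr (2 * \<sigma> * real N) * (measure m (tent \<eta>))\<^sup>2)"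
    proof -
      have "2 powr (2 * \<sigma> * real N) = (2 powr (\<sigma> * real N))\<^sup>2" by (simp add: powr_power algebra_simps)
      then show ?thesis using levelD(2)[OF \<eta>]
        by (simp add: tree_weight_def emeasure_eq_measure ennreal_power ennreal_mult'[symmetric] power_mult_distrib)
    qed
    have "tree_weight \<sigma> m \<eta> + (\<Sum>\<xi>\<in>?ch. T \<xi>) \<le> T \<eta>"
      unfolding T_def by (rule nn_integral_above_ge[OF \<eta>])
    also have "(\<Sum>\<xi>\<in>?ch. T \<xi>) = ennreal (\<Sum>\<xi>\<in>?ch. enn2real (T \<xi>))"
      using Tfin[OF ch] by (subst sum_ennreal[symmetric]) (auto intro!: sum.cong)
    also have "tree_weight \<sigma> m \<eta> + \<dots> = ennreal (2 powr (2 * \<sigma> * real N) * (measure m (tent \<eta>))\<^sup>2 + (\<Sum>\<xi>\<in>?ch. enn2real (T \<xi>)))"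
      unfolding w by (rule ennreal_plus[symmetric]) (auto intro: sum_nonneg)
    finally have "2 powr (2 * \<sigma> * real N) * (measure m (tent \<eta>))\<^sup>2 + (\<Sum>\<xi>\<in>?ch. enn2real (T \<xi>)) \<le> enn2real (T \<eta>)"
      by (subst (asm) Tfin[OF levelD(1)[OF \<eta>]]) (simp add: ennreal_le_iff)
    then have "(2 powr (2 * \<sigma> * real N) * (measure m (tent \<eta>))\<^sup>2 + (\<Sum>\<xi>\<in>?ch. enn2real (T \<xi>))) / C \<le> enn2real (T \<eta>) / C"
      using C(1) by (intro divide_right_mono) auto
    moreover have "enn2real (T \<eta>) \<le> C * measure m (tent \<eta>)"
      using T[OF levelD(1)[OF \<eta>]] C(1) by (intro enn2real_leI) auto
    ultimately show "a N \<eta> * (measure m (tent \<eta>))\<^sup>2 + (\<Sum>\<xi>\<in>?ch. A (Suc N) \<xi>) \<le> A N \<eta> \<and> A N \<eta> \<le> measure m (tent \<eta>)"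
      using C(1) by (simp add: a_def A_def add_divide_distrib sum_divide_distrib divide_le_eq mult.commute)
  qed
  show ?thesis
  proof (intro exI[of _ "C * 4"] ballI)
    fix g :: "complex ^ 'n \<Rightarrow> ennreal" assume g: "g \<in> borel_measurable borel"
    have "tree_energy \<sigma> m g = ennreal C * (\<Sum>N. \<Sum>\<eta>\<in>level N. ennreal (a N \<eta>) * (\<integral>\<^sup>+z\<in>tent \<eta>. g z \<partial>m)\<^sup>2)"
    proof -
      have "ennreal (2 powr (2 * \<sigma> * real N)) = ennreal C * ennreal (a N \<eta>)" for N \<eta>
        using C(1) by (simp add: a_def ennreal_mult'[symmetric])
      then have "ennreal (2 powr (2 * \<sigma> * real N)) * x = ennreal C * (ennreal (a N \<eta>) * x)" for N \<eta> x
        by (metis mult.assoc)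
      then show ?thesis
        unfolding tree_energy_def tent_integral_def ennreal_suminf_cmult[symmetric] sum_distrib_left
        by (intro suminf_cong sum.cong refl)
    qed
    also have "\<dots> \<le> ennreal C * (4 * (\<integral>\<^sup>+z. (g z)\<^sup>2 \<partial>m))"
      by (intro mult_left_mono carleson g) simp
    also have "\<dots> = ennreal (C * 4) * (\<integral>\<^sup>+z. (g z)\<^sup>2 \<partial>m)"
      using C(1) by (simp add: ennreal_mult mult.assoc)
    finally show "tree_energy \<sigma> m g \<le> ennreal (C * 4) * (\<integral>\<^sup>+z. (g z)\<^sup>2 \<partial>m)" .
  qed
qed

lemma tree_energy_indicator:
  assumes "sets m = sets borel" "X \<in> sets borel"
  shows "tree_energy \<sigma> m (indicator X) =
    (\<Sum>N. \<Sum>\<eta>\<in>level N. (ennreal (2 powr (\<sigma> * real N)) * emeasure m (X \<inter> tent \<eta>))\<^sup>2)"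
proof -
  have "tent_integral m (indicator X) \<eta> = emeasure m (X \<inter> tent \<eta>)" for \<eta>
  proof -
    have "tent_integral m (indicator X) \<eta> = (\<integral>\<^sup>+z. indicator (X \<inter> tent \<eta>) z \<partial>m)"
      unfolding tent_integral_def by (intro nn_integral_cong) (simp add: indicator_def)
    then show ?thesis using assms by simp
  qed
  moreover have "ennreal (2 powr (2 * \<sigma> * real N)) = (ennreal (2 powr (\<sigma> * real N)))\<^sup>2" for N
    by (simp add: ennreal_power powr_power algebra_simps)
  ultimately show ?thesis
    unfolding tree_energy_def sum_distrib_left by (simp add: power_mult_distrib)
qed

text \<open>
  Testing on a set of finite measure and keeping only the root bounds the measure of that set by the
  constant; thus a sigma-finite measure satisfying the energy inequality is finite.
\<close>
lemma tree_energy_le_imp_finite: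
  assumes m: "sets m = sets borel" "sigma_finite_measure m" "AE z in m. norm z < 1"
    and C: "\<And>g. g \<in> borel_measurable borel \<Longrightarrow> tree_energy \<sigma> m g \<le> ennreal C * (\<integral>\<^sup>+z. (g z)\<^sup>2 \<partial>m)"
  shows "emeasure m (space m) \<le> ennreal C"
proof -
  interpret sigma_finite_measure m by fact
  have le: "emeasure m X \<le> ennreal C" if X: "X \<in> sets m" "emeasure m X \<noteq> \<infinity>" for X
  proof -
    have X' [measurable]: "X \<in> sets borel" using X m(1) by simp
    have "emeasure m X \<le> emeasure m (X \<inter> tent root)"
      using m X' by (intro emeasure_mono_AE) (auto simp: tent_root)
    then have "(emeasure m X)\<^sup>2 \<le> (emeasure m (X \<inter> tent root))\<^sup>2" by (intro power_mono) auto
    also have "\<dots> = (\<Sum>\<eta>\<in>level 0. (ennreal (2 powr (\<sigma> * real 0)) * emeasure m (X \<inter> tent \<eta>))\<^sup>2)"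
    proof -
      have "level 0 = {root}"
      proof (intro subset_antisym subsetI)
        fix \<eta> assume "\<eta> \<in> level 0"
        then show "\<eta> \<in> {root}" using vertex_level_0[of \<eta>] by (simp add: level_def)
      qed (use root_vertex in \<open>simp add: level_def root_def\<close>)
      then show ?thesis by simp
    qed
    also have "\<dots> \<le> tree_energy \<sigma> m (indicator X)"
      unfolding tree_energy_indicator[OF m(1) X'] by (rule term_le_suminf)
    also have "\<dots> \<le> ennreal C * (\<integral>\<^sup>+z. (indicator X z)\<^sup>2 \<partial>m)" by (rule C) simp
    also have "(\<integral>\<^sup>+z. (indicator X z)\<^sup>2 \<partial>m) = (\<integral>\<^sup>+z. indicator X z \<partial>m)"
      by (intro nn_integral_cong) (simp add: indicator_def)
    also have "\<dots> = emeasure m X" using X by simp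
    finally have sq: "emeasure m X * emeasure m X \<le> ennreal C * emeasure m X" by (simp add: power2_eq_square)
    obtain r where r: "emeasure m X = ennreal r" "0 \<le> r" using X(2) by (cases "emeasure m X") auto
    show ?thesis
    proof (cases "r = 0")
      case False
      then have "0 < r" using r by simp
      have "0 < C"
      proof (rule ccontr)
        assume "\<not> 0 < C"
        then have "ennreal r * ennreal r = 0" using sq by (simp add: r ennreal_neg)
        then show False using \<open>0 < r\<close> by simp
      qed
      then have "r * r \<le> C * r" using sq r by (simp add: ennreal_mult'[symmetric])
      then show ?thesis using \<open>0 < r\<close> r by (simp add: ennreal_leI)
    qed (use r in simp)
  qed
  obtain B :: "nat \<Rightarrow> (complex ^ 'n) set" where B: "range B \<subseteq> sets m" "(\<Union>i. B i) = space m"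
    "\<And>i. emeasure m (B i) \<noteq> \<infinity>" "incseq B"
    using sigma_finite_incseq by blast
  have "emeasure m (space m) = (SUP i. emeasure m (B i))"
    using SUP_emeasure_incseq[OF B(1,4)] B(2) by simp
  also have "\<dots> \<le> ennreal C" using B by (intro SUP_least le) auto
  finally show ?thesis .
qed

text \<open>
  Test with the indicator of the tent of \<open>\<eta>\<close> and keep the terms \<open>\<beta> \<ge> \<eta>\<close>, for which the tent of \<open>\<beta>\<close> is
  contained in that of \<open>\<eta>\<close>.
\<close>
lemma tree_energy_le_imp_tree_test:
  assumes m: "sets m = sets borel" "sigma_finite_measure m" "AE z in m. norm z < 1"
    and C: "\<And>g. g \<in> borel_measurable borel \<Longrightarrow> tree_energy \<sigma> m g \<le> ennreal C * (\<integral>\<^sup>+z. (g z)\<^sup>2 \<partial>m)"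
  shows "tree_test \<sigma> m"
  unfolding tree_test_def
proof (intro exI[of _ "max C 1"] conjI ballI)
  fix \<eta> assume \<eta>: "\<eta> \<in> vertices J"
  have "emeasure m (tent \<eta>) \<le> emeasure m (space m)" by (rule emeasure_space)
  also have "\<dots> \<le> ennreal C" by (rule tree_energy_le_imp_finite[OF m C])
  finally show "emeasure m (tent \<eta>) < \<infinity>" by (simp add: le_less_trans)
  let ?X = "tent \<eta>" and ?A = "above J c Q \<eta>"
  have "tree_sum \<sigma> m \<eta> = (\<integral>\<^sup>+\<beta>. tree_weight \<sigma> m \<beta> * indicator ?A \<beta> \<partial>count_space (vertices J))"
  proof -
    have "tree_sum \<sigma> m \<eta> = (\<integral>\<^sup>+\<beta>. tree_weight \<sigma> m \<beta> * indicator ?A \<beta> \<partial>count_space ?A)"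
      by (rule nn_integral_cong) simp
    also have "\<dots> = (\<integral>\<^sup>+\<beta>. tree_weight \<sigma> m \<beta> * indicator ?A \<beta> \<partial>count_space (vertices J))"
    proof (rule nn_integral_count_space_eq)
      fix \<beta> assume "\<beta> \<in> ?A - vertices J"
      then show "tree_weight \<sigma> m \<beta> * indicator ?A \<beta> = 0" using above_subset by blast
    qed simp
    finally show ?thesis .
  qed
  also have "\<dots> \<le> (\<integral>\<^sup>+\<beta>. (ennreal (2 powr (\<sigma> * real (fst \<beta>))) * emeasure m (?X \<inter> tent \<beta>))\<^sup>2 \<partial>count_space (vertices J))"
  proof (rule nn_integral_mono)
    fix \<beta>
    show "tree_weight \<sigma> m \<beta> * indicator ?A \<beta> \<le> (ennreal (2 powr (\<sigma> * real (fst \<beta>))) * emeasure m (?X \<inter> tent \<beta>))\<^sup>2"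
    proof (cases "\<beta> \<in> ?A")
      case True
      then have "?X \<inter> tent \<beta> = tent \<beta>" using tent_above by blast
      then show ?thesis using True by (simp add: tree_weight_def)
    qed simp
  qed
  also have "\<dots> = tree_energy \<sigma> m (indicator ?X)"
    unfolding nn_integral_count_vertices tree_energy_indicator[OF m(1) tent_sets]
    by (intro suminf_cong sum.cong refl) (simp add: level_def)
  also have "\<dots> \<le> ennreal C * (\<integral>\<^sup>+z. (indicator ?X z)\<^sup>2 \<partial>m)" by (rule C) simp
  also have "(\<integral>\<^sup>+z. (indicator ?X z)\<^sup>2 \<partial>m) = (\<integral>\<^sup>+z. indicator ?X z \<partial>m)"
    by (intro nn_integral_cong) (simp add: indicator_def)
  also have "\<dots> = emeasure m ?X" using m(1) by simp
  also have "ennreal C * emeasure m ?X \<le> ennreal (max C 1) * emeasure m ?X"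
    by (intro mult_right_mono ennreal_leI) auto
  finally show "tree_sum \<sigma> m \<eta> \<le> ennreal (max C 1) * emeasure m ?X" .
qed simp

end

section \<open>The equivalence\<close>

text \<open>
  Passing to the image measure on the whole space makes all functions Borel functions of one space and
  carries the ball only as a null set condition.
\<close>

lemma extended_measure:
  fixes \<mu> :: "(complex ^ 'n) measure"
  assumes \<mu>: "sets \<mu> = sets (restrict_space borel (ball 0 1))" "sigma_finite_measure \<mu>"
  defines "m \<equiv> distr \<mu> borel (\<lambda>z. z)"
  shows "(\<lambda>z. z) \<in> measurable \<mu> borel" and "space \<mu> = ball 0 1" and "sets m = sets borel"
    and "sigma_finite_measure m" and "AE z in m. norm z < 1"
    and "\<And>A. A \<in> sets borel \<Longrightarrow> A \<subseteq> ball 0 1 \<Longrightarrow> emeasure m A = emeasure \<mu> A"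
    and "\<And>f. f \<in> borel_measurable borel \<Longrightarrow> (\<integral>\<^sup>+z. f z \<partial>m) = (\<integral>\<^sup>+z. f z \<partial>\<mu>)"
proof -
  show id: "(\<lambda>z. z) \<in> measurable \<mu> borel"
    unfolding measurable_cong_sets[OF \<mu>(1) refl] by (rule measurable_restrict_space1) simp
  show sp: "space \<mu> = ball 0 1" using sets_eq_imp_space_eq[OF \<mu>(1)] by (simp add: space_restrict_space)
  show "sets m = sets borel" by (simp add: m_def)
  show "AE z in m. norm z < 1" unfolding m_def by (subst AE_distr_iff[OF id]) (auto simp: sp intro!: AE_I2)
  show em: "emeasure m A = emeasure \<mu> A" if "A \<in> sets borel" "A \<subseteq> ball 0 1" for A
    unfolding m_def using that by (subst emeasure_distr[OF id]) (auto simp: sp intro!: arg_cong[of _ _ "emeasure \<mu>"])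
  show "(\<integral>\<^sup>+z. f z \<partial>m) = (\<integral>\<^sup>+z. f z \<partial>\<mu>)" if "f \<in> borel_measurable borel" for f
    unfolding m_def using that by (intro nn_integral_distr[OF id]) simp
  interpret sigma_finite_measure \<mu> by fact
  obtain B :: "nat \<Rightarrow> (complex ^ 'n) set" where B: "range B \<subseteq> sets \<mu>" "(\<Union>i. B i) = space \<mu>"
    "\<And>i. emeasure \<mu> (B i) \<noteq> \<infinity>" using sigma_finite by metis
  have BB: "B i \<in> sets borel \<and> B i \<subseteq> ball 0 1" for i
  proof -
    have "B i \<in> sets (restrict_space borel (ball 0 1))" using B(1) \<mu>(1) by auto
    then show ?thesis by (auto simp: sets_restrict_space)
  qed
  show "sigma_finite_measure m"
  proof
    let ?B = "insert (- ball 0 1) (range B)"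
    have "emeasure m (- ball 0 1) = 0"
      unfolding m_def by (subst emeasure_distr[OF id]) (auto simp: sp)
    then have "\<forall>a\<in>?B. emeasure m a \<noteq> \<infinity>" using B(3) em BB by auto
    moreover have "\<Union> ?B = space m" using B(2) by (auto simp: sp m_def)
    moreover have "?B \<subseteq> sets m" using BB by (auto simp: m_def)
    ultimately show "\<exists>A. countable A \<and> A \<subseteq> sets m \<and> \<Union> A = space m \<and> (\<forall>a\<in>A. emeasure m a \<noteq> \<infinity>)"
      by (intro exI[of _ ?B]) auto
  qed
qed

definition energy_bounded :: "real \<Rightarrow> (complex ^ 'n) measure \<Rightarrow> (complex ^ 'n) measure \<Rightarrow> bool" where
  "energy_bounded a m \<nu> \<longleftrightarrow> (\<exists>C. \<forall>g\<in>borel_measurable borel.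
     kernel_energy a m \<nu> g \<le> ennreal C * (\<integral>\<^sup>+z. (g z)\<^sup>2 \<partial>m))"

context bergman_tree
begin

text \<open>
  The two energies are comparable for every \<open>g\<close>, so the choice of \<open>\<nu>\<close> does not matter.
\<close>
lemma energy_bounded_iff_tree_test:
  assumes \<nu>: "koranyi_regular \<kappa> \<nu>" and \<sigma>: "0 \<le> \<sigma>" "\<sigma> < \<kappa> / 2" and a: "a = \<kappa> / 2 + \<sigma>"
    and m: "sets m = sets borel" "sigma_finite_measure m" "AE z in m. norm z < 1"
  shows "energy_bounded a m \<nu> \<longleftrightarrow> tree_test \<sigma> m"
proof
  assume "energy_bounded a m \<nu>"
  then obtain C where C: "\<And>g. g \<in> borel_measurable borel \<Longrightarrow>
      kernel_energy a m \<nu> g \<le> ennreal C * (\<integral>\<^sup>+z. (g z)\<^sup>2 \<partial>m)"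
    unfolding energy_bounded_def by blast
  have "0 < \<kappa>" using \<sigma> by simp
  from tree_energy_le_square_kernel[OF \<nu> \<sigma>(1) this a m]
  obtain D where D: "\<And>g. g \<in> borel_measurable borel \<Longrightarrow> tree_energy \<sigma> m g \<le>
      ennreal D * kernel_energy a m \<nu> g" by blast
  show "tree_test \<sigma> m"
  proof (rule tree_energy_le_imp_tree_test[OF m])
    fix g :: "complex ^ 'n \<Rightarrow> ennreal" assume g: "g \<in> borel_measurable borel"
    have "tree_energy \<sigma> m g \<le> ennreal (max 0 D) * (ennreal (max 0 C) * (\<integral>\<^sup>+z. (g z)\<^sup>2 \<partial>m))"
      by (rule order_trans[OF D[OF g] mult_mono[OF _ order_trans[OF C[OF g]]]]) (auto intro!: mult_right_mono ennreal_leI)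
    then show "tree_energy \<sigma> m g \<le> ennreal (max 0 D * max 0 C) * (\<integral>\<^sup>+z. (g z)\<^sup>2 \<partial>m)"
      by (simp add: ennreal_mult mult.assoc)
  qed
next
  assume "tree_test \<sigma> m"
  from tree_test_imp_tree_energy_le[OF m(1,3) this]
  obtain C where C: "\<And>g. g \<in> borel_measurable borel \<Longrightarrow> tree_energy \<sigma> m g \<le> ennreal C * (\<integral>\<^sup>+z. (g z)\<^sup>2 \<partial>m)" by blast
  obtain D where D: "\<And>g. g \<in> borel_measurable borel \<Longrightarrow>
      kernel_energy a m \<nu> g \<le> ennreal D * tree_energy \<sigma> m g"
    using square_kernel_le_tree_energy[OF \<nu> \<sigma> a m] by blast
  show "energy_bounded a m \<nu>"
    unfolding energy_bounded_def
  proof (intro exI[of _ "max 0 D * max 0 C"] ballI)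
    fix g :: "complex ^ 'n \<Rightarrow> ennreal" assume g: "g \<in> borel_measurable borel"
    have "kernel_energy a m \<nu> g \<le> ennreal (max 0 D) * (ennreal (max 0 C) * (\<integral>\<^sup>+z. (g z)\<^sup>2 \<partial>m))"
      by (rule order_trans[OF D[OF g] mult_mono[OF _ order_trans[OF C[OF g]]]]) (auto intro!: mult_right_mono ennreal_leI)
    then show "kernel_energy a m \<nu> g \<le> ennreal (max 0 D * max 0 C) * (\<integral>\<^sup>+z. (g z)\<^sup>2 \<partial>m)"
      by (simp add: ennreal_mult mult.assoc)
  qed
qed

end

lemma koranyi_kernel_eq:
  assumes "norm z < 1" "norm w \<le> 1"
  shows "g / ennreal (cmod (1 - cdot z w) powr a) = g * koranyi_kernel a z w"
proof -
  have "0 < (koranyi z w)\<^sup>2" using koranyi_pos[OF assms] by simp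
  then show ?thesis
    unfolding divide_ennreal_def koranyi_kernel_def koranyi_power2[symmetric]
    by (simp add: inverse_ennreal powr_minus)
qed

lemma T_kernel_eq: "T_kernel \<sigma> w z = (koranyi z w)\<^sup>2 powr - (real CARD('n) / 2 + \<sigma>)"
  for z w :: "complex ^ 'n"
  unfolding T_kernel_def koranyi_power2 powr_minus_divide ..

lemma R_ineq_iff_energy_bounded:
  fixes \<mu> :: "(complex ^ 'n) measure"
  assumes \<mu>: "sets \<mu> = sets (restrict_space borel (ball 0 1))" "sigma_finite_measure \<mu>" and \<alpha>: "-1 < \<alpha>"
  shows "R_ineq \<sigma> \<mu> \<alpha> \<longleftrightarrow>
    energy_bounded ((real CARD('n) + 1 + \<alpha>) / 2 + \<sigma>) (distr \<mu> borel (\<lambda>z. z)) (bergman_measure \<alpha>)"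
proof -
  let ?a = "(real CARD('n) + 1 + \<alpha>) / 2 + \<sigma>" and ?m = "distr \<mu> borel (\<lambda>z. z)"
  note m = extended_measure[OF \<mu>]
  interpret \<mu>: sigma_finite_measure \<mu> by fact
  note [measurable] = m(1)
  have lhs: "(\<integral>\<^sup>+ w \<in> ball 0 1. (\<integral>\<^sup>+ z. g z / ennreal (cmod (1 - cdot z w) powr ?a) \<partial>\<mu>)\<^sup>2 *
           ennreal (bergman_density \<alpha> w) \<partial>lborel) =
      kernel_energy ?a ?m (bergman_measure \<alpha>) h"
    if [measurable]: "h \<in> borel_measurable borel" and hg: "\<forall>z. norm z < 1 \<longrightarrow> h z = g z" for g h
  proof -
    have "kernel_energy ?a ?m (bergman_measure \<alpha>) h =
        (\<integral>\<^sup>+w. (\<integral>\<^sup>+z. h z * koranyi_kernel ?a z w \<partial>\<mu>)\<^sup>2 \<partial>bergman_measure \<alpha>)"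
      by (subst m(7)) auto
    also have "\<dots> = (\<integral>\<^sup>+w. ennreal (bergman_density \<alpha> w) * indicator (ball 0 1) w *
        (\<integral>\<^sup>+z. h z * koranyi_kernel ?a z w \<partial>\<mu>)\<^sup>2 \<partial>lborel)"
    proof -
      have "(\<lambda>w. (\<integral>\<^sup>+z. h z * koranyi_kernel ?a z w \<partial>\<mu>)\<^sup>2) \<in> borel_measurable borel" by measurable
      then show ?thesis
        unfolding bergman_measure_def using borel_measurable_bergman_weight[of \<alpha>]
        by (intro nn_integral_density) simp_all
    qed
    also have "\<dots> = (\<integral>\<^sup>+ w \<in> ball 0 1. (\<integral>\<^sup>+ z. g z / ennreal (cmod (1 - cdot z w) powr ?a) \<partial>\<mu>)\<^sup>2 *
           ennreal (bergman_density \<alpha> w) \<partial>lborel)"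
    proof (rule nn_integral_cong)
      fix w :: "complex ^ 'n"
      have "(\<integral>\<^sup>+z. h z * koranyi_kernel ?a z w \<partial>\<mu>) = (\<integral>\<^sup>+ z. g z / ennreal (cmod (1 - cdot z w) powr ?a) \<partial>\<mu>)" if "norm w < 1"
        using that by (intro nn_integral_cong) (simp add: m(2) koranyi_kernel_eq hg)
      then show "ennreal (bergman_density \<alpha> w) * indicator (ball 0 1) w * (\<integral>\<^sup>+z. h z * koranyi_kernel ?a z w \<partial>\<mu>)\<^sup>2 =
          (\<integral>\<^sup>+ z. g z / ennreal (cmod (1 - cdot z w) powr ?a) \<partial>\<mu>)\<^sup>2 *
           ennreal (bergman_density \<alpha> w) * indicator (ball 0 1) w"
        by (simp add: indicator_def mult.commute)
    qed
    finally show ?thesis ..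
  qed
  have rhs: "(\<integral>\<^sup>+z. (h z)\<^sup>2 \<partial>?m) = (\<integral>\<^sup>+z. (g z)\<^sup>2 \<partial>\<mu>)"
    if [measurable]: "h \<in> borel_measurable borel" and hg: "\<forall>z. norm z < 1 \<longrightarrow> h z = g z" for g h
    using hg by (subst m(7)) (auto simp: m(2) intro!: nn_integral_cong)
  show ?thesis
  proof
    assume "R_ineq \<sigma> \<mu> \<alpha>"
    then obtain C :: ennreal where C: "C < \<infinity>" "\<And>g. g \<in> borel_measurable \<mu> \<Longrightarrow>
        (\<integral>\<^sup>+ w \<in> ball 0 1. (\<integral>\<^sup>+ z. g z / ennreal (cmod (1 - cdot z w) powr ?a) \<partial>\<mu>)\<^sup>2 *
           ennreal (bergman_density \<alpha> w) \<partial>lborel) \<le> C * (\<integral>\<^sup>+z. (g z)\<^sup>2 \<partial>\<mu>)"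
      unfolding R_ineq_def by blast
    obtain r where r: "C = ennreal r" using C(1) by (cases C) auto
    show "energy_bounded ?a ?m (bergman_measure \<alpha>)"
      unfolding energy_bounded_def
    proof (intro exI[of _ r] ballI)
      fix g :: "complex ^ 'n \<Rightarrow> ennreal" assume g [measurable]: "g \<in> borel_measurable borel"
      have gg: "\<forall>z. norm z < 1 \<longrightarrow> g z = g z" by simp
      show "kernel_energy ?a ?m (bergman_measure \<alpha>) g \<le> ennreal r * (\<integral>\<^sup>+z. (g z)\<^sup>2 \<partial>?m)"
        unfolding lhs[OF g gg, symmetric] rhs[OF g gg] r[symmetric] by (rule C(2)) measurable
    qed
  next
    assume "energy_bounded ?a ?m (bergman_measure \<alpha>)"
    then obtain C where C: "\<And>g. g \<in> borel_measurable borel \<Longrightarrow>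
      kernel_energy ?a ?m (bergman_measure \<alpha>) g \<le> ennreal C * (\<integral>\<^sup>+z. (g z)\<^sup>2 \<partial>?m)"
      unfolding energy_bounded_def by blast
    show "R_ineq \<sigma> \<mu> \<alpha>"
      unfolding R_ineq_def
    proof (intro exI[of _ "ennreal C"] conjI ballI)
      fix g :: "complex ^ 'n \<Rightarrow> ennreal" assume "g \<in> borel_measurable \<mu>"
      then have "g \<in> borel_measurable (restrict_space borel (ball 0 1))"
        by (simp cong: measurable_cong_sets add: measurable_cong_sets[OF \<mu>(1) refl])
      then have h: "(\<lambda>z. g z * indicator (ball 0 1) z) \<in> borel_measurable borel"
        by (subst (asm) borel_measurable_restrict_space_iff_ennreal) auto
      have hg: "\<forall>z. norm z < 1 \<longrightarrow> g z * indicator (ball 0 1) z = g z" by simp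
      show "(\<integral>\<^sup>+ w \<in> ball 0 1. (\<integral>\<^sup>+ z. g z / ennreal (cmod (1 - cdot z w) powr ?a) \<partial>\<mu>)\<^sup>2 *
           ennreal (bergman_density \<alpha> w) \<partial>lborel) \<le> ennreal C * (\<integral>\<^sup>+z. (g z)\<^sup>2 \<partial>\<mu>)"
        unfolding lhs[OF h hg] rhs[OF h hg, symmetric] by (rule C[OF h])
    qed simp
  qed
qed

lemma nn_integral_sphere_measure:
  "f \<in> borel_measurable borel \<Longrightarrow> (\<integral>\<^sup>+w. f w \<partial>sphere_measure) = (\<integral>\<^sup>+w. f w \<partial>surface_measure)"
  unfolding sphere_measure_def by (intro nn_integral_distr[OF measurable_ident_surface]) simp

lemma L2_norm_power2:
  assumes "in_L2 M f"
  shows "ennreal ((L2_norm M f)\<^sup>2) = (\<integral>\<^sup>+x. ennreal ((cmod (f x))\<^sup>2) \<partial>M)"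
  using assms unfolding in_L2_def L2_norm_def by (subst nn_integral_eq_integral) auto

lemma square_kernel_surface_eq:
  fixes \<mu> :: "(complex ^ 'n) measure"
  assumes \<mu>: "sets \<mu> = sets (restrict_space borel (ball 0 1))" "sigma_finite_measure \<mu>"
    and h: "h \<in> borel_measurable borel"
  shows "kernel_energy (real CARD('n) / 2 + \<sigma>) (distr \<mu> borel (\<lambda>z. z)) sphere_measure h =
    (\<integral>\<^sup>+w. (\<integral>\<^sup>+z. h z * ennreal (T_kernel \<sigma> w z) \<partial>\<mu>)\<^sup>2 \<partial>surface_measure)"
    and "(\<lambda>w. \<integral>\<^sup>+z. h z * ennreal (T_kernel \<sigma> w z) \<partial>\<mu>) \<in> borel_measurable borel"
proof -
  note m = extended_measure[OF \<mu>]
  interpret sigma_finite_measure \<mu> by fact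
  note [measurable] = m(1) h
  have eq: "(\<integral>\<^sup>+z. h z * koranyi_kernel (real CARD('n) / 2 + \<sigma>) z w \<partial>distr \<mu> borel (\<lambda>z. z)) =
      (\<integral>\<^sup>+z. h z * ennreal (T_kernel \<sigma> w z) \<partial>\<mu>)" for w
    unfolding T_kernel_eq koranyi_kernel_def[symmetric] by (rule m(7)) measurable
  show meas: "(\<lambda>w. \<integral>\<^sup>+z. h z * ennreal (T_kernel \<sigma> w z) \<partial>\<mu>) \<in> borel_measurable borel"
    unfolding T_kernel_eq koranyi_kernel_def[symmetric] by measurable
  show "kernel_energy (real CARD('n) / 2 + \<sigma>) (distr \<mu> borel (\<lambda>z. z)) sphere_measure h =
    (\<integral>\<^sup>+w. (\<integral>\<^sup>+z. h z * ennreal (T_kernel \<sigma> w z) \<partial>\<mu>)\<^sup>2 \<partial>surface_measure)"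
    unfolding eq by (rule nn_integral_sphere_measure) (use meas in measurable)
qed

lemma T_kernel_nonneg: "0 \<le> T_kernel \<sigma> w z"
  by (simp add: T_kernel_def)

text \<open>
  If \<open>g \<ge> 0\<close> is square integrable, it is finite almost everywhere, and wherever the Bochner integral
  defining \<open>T_op\<close> converges it agrees with the nonnegative integral.
\<close>
lemma T_bounded_imp_energy_bounded:
  fixes \<mu> :: "(complex ^ 'n) measure"
  assumes \<mu>: "sets \<mu> = sets (restrict_space borel (ball 0 1))" "sigma_finite_measure \<mu>" and T: "T_bounded \<sigma> \<mu>"
  shows "energy_bounded (real CARD('n) / 2 + \<sigma>) (distr \<mu> borel (\<lambda>z. z)) sphere_measure"
proof -
  note m = extended_measure[OF \<mu>]
  note [measurable] = m(1)
  obtain C :: real where C: "\<And>f. in_L2 \<mu> f \<Longrightarrow>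
        (AE w in surface_measure. integrable \<mu> (\<lambda>z. T_kernel \<sigma> w z *\<^sub>R f z)) \<and>
        in_L2 surface_measure (T_op \<sigma> \<mu> f) \<and>
        L2_norm surface_measure (T_op \<sigma> \<mu> f) \<le> C * L2_norm \<mu> f"
    using T unfolding T_bounded_def by blast
  (* A positive constant makes the right-hand side infinite when g is not square integrable. *)
  have "(\<integral>\<^sup>+w. (\<integral>\<^sup>+z. g z * ennreal (T_kernel \<sigma> w z) \<partial>\<mu>)\<^sup>2 \<partial>surface_measure) \<le> ennreal (C\<^sup>2 + 1) * (\<integral>\<^sup>+z. (g z)\<^sup>2 \<partial>\<mu>)"
    if g [measurable]: "g \<in> borel_measurable borel" for g
  proof (cases "(\<integral>\<^sup>+z. (g z)\<^sup>2 \<partial>\<mu>) = \<infinity>")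
    case True
    then show ?thesis by (simp add: ennreal_mult_top add_pos_nonneg less_imp_neq[THEN not_sym] sum_power2_gt_zero_iff)
  next
    case False
    have "AE z in \<mu>. (g z)\<^sup>2 \<noteq> \<infinity>" using False by (intro nn_integral_PInf_AE) auto
    then have fin: "AE z in \<mu>. g z = ennreal (enn2real (g z))"
      by (rule AE_mp) (auto intro!: AE_I2 simp: power2_eq_square ennreal_mult_eq_top_iff less_top)
    define f where "f z = complex_of_real (enn2real (g z))" for z
    have f [measurable]: "f \<in> borel_measurable \<mu>" unfolding f_def by measurable
    have sq: "(\<integral>\<^sup>+z. ennreal ((cmod (f z))\<^sup>2) \<partial>\<mu>) = (\<integral>\<^sup>+z. (g z)\<^sup>2 \<partial>\<mu>)"
      using fin by (intro nn_integral_cong_AE) (auto simp: f_def ennreal_power[symmetric])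
    have L2: "in_L2 \<mu> f"
      unfolding in_L2_def using False sq by (auto intro!: integrableI_bounded simp: less_top)
    have AEw: "AE w in surface_measure. (\<integral>\<^sup>+z. g z * ennreal (T_kernel \<sigma> w z) \<partial>\<mu>) = ennreal (cmod (T_op \<sigma> \<mu> f w))"
    proof (rule AE_mp[OF conjunct1[OF C[OF L2]]], rule AE_I2, rule impI)
      fix w assume int: "integrable \<mu> (\<lambda>z. T_kernel \<sigma> w z *\<^sub>R f z)"
      have fc: "T_kernel \<sigma> w z *\<^sub>R f z = complex_of_real (T_kernel \<sigma> w z * enn2real (g z))" for z
        by (simp add: f_def scaleR_conv_of_real)
      have int': "integrable \<mu> (\<lambda>z. T_kernel \<sigma> w z * enn2real (g z))"
        using int unfolding fc complex_of_real_integrable_eq .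
      have "T_op \<sigma> \<mu> f w = complex_of_real (\<integral>z. T_kernel \<sigma> w z * enn2real (g z) \<partial>\<mu>)"
        unfolding T_op_def fc by (rule integral_complex_of_real)
      moreover have "0 \<le> (\<integral>z. T_kernel \<sigma> w z * enn2real (g z) \<partial>\<mu>)"
        by (intro integral_nonneg_AE AE_I2) (simp add: T_kernel_nonneg)
      ultimately have "ennreal (cmod (T_op \<sigma> \<mu> f w)) = (\<integral>\<^sup>+z. ennreal (T_kernel \<sigma> w z * enn2real (g z)) \<partial>\<mu>)"
        using int' by (subst nn_integral_eq_integral) (auto simp: T_kernel_nonneg)
      also have "\<dots> = (\<integral>\<^sup>+z. g z * ennreal (T_kernel \<sigma> w z) \<partial>\<mu>)"
      proof (rule nn_integral_cong_AE, rule AE_mp[OF fin], rule AE_I2, rule impI)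
        fix z assume "g z = ennreal (enn2real (g z))"
        then show "ennreal (T_kernel \<sigma> w z * enn2real (g z)) = g z * ennreal (T_kernel \<sigma> w z)"
          by (metis T_kernel_nonneg ennreal_mult' mult.commute)
      qed
      finally show "(\<integral>\<^sup>+z. g z * ennreal (T_kernel \<sigma> w z) \<partial>\<mu>) = ennreal (cmod (T_op \<sigma> \<mu> f w))" ..
    qed
    have "(\<integral>\<^sup>+w. (\<integral>\<^sup>+z. g z * ennreal (T_kernel \<sigma> w z) \<partial>\<mu>)\<^sup>2 \<partial>surface_measure) =
        (\<integral>\<^sup>+w. ennreal ((cmod (T_op \<sigma> \<mu> f w))\<^sup>2) \<partial>surface_measure)"
      using AEw by (intro nn_integral_cong_AE) (auto simp: ennreal_power)
    also have "\<dots> = ennreal ((L2_norm surface_measure (T_op \<sigma> \<mu> f))\<^sup>2)"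
      using C[OF L2] by (simp add: L2_norm_power2)
    also have "\<dots> \<le> ennreal ((C * L2_norm \<mu> f)\<^sup>2)"
    proof (intro ennreal_leI power_mono)
      show "L2_norm surface_measure (T_op \<sigma> \<mu> f) \<le> C * L2_norm \<mu> f" using C[OF L2] by simp
      show "0 \<le> L2_norm surface_measure (T_op \<sigma> \<mu> f)" by (simp add: L2_norm_def)
    qed
    also have "\<dots> = ennreal (C\<^sup>2) * (\<integral>\<^sup>+z. (g z)\<^sup>2 \<partial>\<mu>)"
      unfolding power_mult_distrib sq[symmetric] L2_norm_power2[OF L2, symmetric] by (rule ennreal_mult) auto
    also have "\<dots> \<le> ennreal (C\<^sup>2 + 1) * (\<integral>\<^sup>+z. (g z)\<^sup>2 \<partial>\<mu>)"
      by (intro mult_right_mono ennreal_leI) auto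
    finally show ?thesis .
  qed
  note main = this
  show ?thesis
    unfolding energy_bounded_def
  proof (intro exI[of _ "C\<^sup>2 + 1"] ballI)
    fix g :: "complex ^ 'n \<Rightarrow> ennreal" assume g: "g \<in> borel_measurable borel"
    then have "(\<lambda>z. (g z)\<^sup>2) \<in> borel_measurable borel" by measurable
    note eq = m(7)[OF this]
    show "kernel_energy (real CARD('n) / 2 + \<sigma>) (distr \<mu> borel (\<lambda>z. z)) sphere_measure g
        \<le> ennreal (C\<^sup>2 + 1) * (\<integral>\<^sup>+z. (g z)\<^sup>2 \<partial>distr \<mu> borel (\<lambda>z. z))"
      unfolding square_kernel_surface_eq(1)[OF \<mu> g] eq by (rule main[OF g])
  qed
qed

text \<open>
  Applied to \<open>|g|\<close>, the energy bound shows that the integral of \<open>|g|\<close> against the kernel is square integrable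
  on the sphere. Hence it is finite almost everywhere, which gives absolute convergence, and it dominates
  \<open>|T_op \<sigma> \<mu> g|\<close>.
\<close>
lemma energy_bounded_imp_T_bounded:
  fixes \<mu> :: "(complex ^ 'n) measure"
  assumes \<mu>: "sets \<mu> = sets (restrict_space borel (ball 0 1))" "sigma_finite_measure \<mu>"
    and E: "energy_bounded (real CARD('n) / 2 + \<sigma>) (distr \<mu> borel (\<lambda>z. z)) sphere_measure"
  shows "T_bounded \<sigma> \<mu>"
proof -
  note m = extended_measure[OF \<mu>]
  interpret sigma_finite_measure \<mu> by fact
  note [measurable] = m(1) measurable_ident_surface
  obtain C where C: "\<And>h. h \<in> borel_measurable borel \<Longrightarrow>
      (\<integral>\<^sup>+w. (\<integral>\<^sup>+z. h z * ennreal (T_kernel \<sigma> w z) \<partial>\<mu>)\<^sup>2 \<partial>surface_measure) \<le> ennreal C * (\<integral>\<^sup>+z. (h z)\<^sup>2 \<partial>\<mu>)"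
  proof -
    obtain C where "\<forall>g\<in>borel_measurable borel.
      kernel_energy (real CARD('n) / 2 + \<sigma>) (distr \<mu> borel (\<lambda>z. z)) sphere_measure g
        \<le> ennreal C * (\<integral>\<^sup>+z. (g z)\<^sup>2 \<partial>distr \<mu> borel (\<lambda>z. z))"
      using E unfolding energy_bounded_def ..
    note E = this
    show ?thesis
    proof (rule that)
      fix h :: "complex ^ 'n \<Rightarrow> ennreal" assume h: "h \<in> borel_measurable borel"
      then have "(\<lambda>z. (h z)\<^sup>2) \<in> borel_measurable borel" by measurable
      note eq = m(7)[OF this]
      show "(\<integral>\<^sup>+w. (\<integral>\<^sup>+z. h z * ennreal (T_kernel \<sigma> w z) \<partial>\<mu>)\<^sup>2 \<partial>surface_measure) \<le> ennreal C * (\<integral>\<^sup>+z. (h z)\<^sup>2 \<partial>\<mu>)"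
        using bspec[OF E h] unfolding square_kernel_surface_eq(1)[OF \<mu> h] eq .
    qed
  qed
  have "(AE w in surface_measure. integrable \<mu> (\<lambda>z. T_kernel \<sigma> w z *\<^sub>R g z)) \<and>
        in_L2 surface_measure (T_op \<sigma> \<mu> g) \<and>
        L2_norm surface_measure (T_op \<sigma> \<mu> g) \<le> sqrt (max 0 C) * L2_norm \<mu> g" if g: "in_L2 \<mu> g" for g
  proof -
    have gm [measurable]: "g \<in> borel_measurable \<mu>" using g by (simp add: in_L2_def)
    define h where "h z = ennreal (cmod (g z)) * indicator (ball 0 1) z" for z
    have h [measurable]: "h \<in> borel_measurable borel"
    proof -
      have "(\<lambda>z. ennreal (cmod (g z))) \<in> borel_measurable \<mu>" by measurable
      then have "(\<lambda>z. ennreal (cmod (g z))) \<in> borel_measurable (restrict_space borel (ball 0 1))"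
        by (simp cong: measurable_cong_sets add: measurable_cong_sets[OF \<mu>(1) refl])
      then show ?thesis unfolding h_def by (subst (asm) borel_measurable_restrict_space_iff_ennreal) auto
    qed
    have hg: "h z = ennreal (cmod (g z))" if "z \<in> space \<mu>" for z using that by (simp add: h_def m(2))
    let ?F = "\<lambda>w. \<integral>\<^sup>+z. h z * ennreal (T_kernel \<sigma> w z) \<partial>\<mu>"
    have F [measurable]: "?F \<in> borel_measurable borel" by (rule square_kernel_surface_eq(2)[OF \<mu> h])
    have Tm [measurable]: "(\<lambda>z. T_kernel \<sigma> w z) \<in> borel_measurable \<mu>" for w
      unfolding T_kernel_eq by measurable
    have norm_eq: "(\<integral>\<^sup>+z. ennreal (norm (T_kernel \<sigma> w z *\<^sub>R g z)) \<partial>\<mu>) = ?F w" for w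
      by (intro nn_integral_cong) (simp add: hg T_kernel_nonneg ennreal_mult mult.commute)
    have "(\<integral>\<^sup>+z. (h z)\<^sup>2 \<partial>\<mu>) = (\<integral>\<^sup>+z. ennreal ((cmod (g z))\<^sup>2) \<partial>\<mu>)"
      by (intro nn_integral_cong) (simp add: hg ennreal_power)
    then have "(\<integral>\<^sup>+w. (?F w)\<^sup>2 \<partial>surface_measure) \<le> ennreal C * ennreal ((L2_norm \<mu> g)\<^sup>2)"
      using C[OF h] unfolding L2_norm_power2[OF g] by simp
    also have "\<dots> \<le> ennreal (max 0 C) * ennreal ((L2_norm \<mu> g)\<^sup>2)"
      by (intro mult_right_mono ennreal_leI) auto
    also have "\<dots> = ennreal (max 0 C * (L2_norm \<mu> g)\<^sup>2)" by (simp add: ennreal_mult)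
    finally have bound: "(\<integral>\<^sup>+w. (?F w)\<^sup>2 \<partial>surface_measure) \<le> ennreal (max 0 C * (L2_norm \<mu> g)\<^sup>2)" .
    have "AE w in surface_measure. (?F w)\<^sup>2 \<noteq> \<infinity>"
      using bound by (intro nn_integral_PInf_AE) (auto simp: top_unique, measurable)
    then have int: "AE w in surface_measure. integrable \<mu> (\<lambda>z. T_kernel \<sigma> w z *\<^sub>R g z)"
    proof (rule AE_mp, intro AE_I2 impI)
      fix w assume "(?F w)\<^sup>2 \<noteq> \<infinity>"
      then have "?F w \<noteq> \<infinity>" by (intro notI) simp
      then have "?F w < \<infinity>" by (simp add: less_top)
      then show "integrable \<mu> (\<lambda>z. T_kernel \<sigma> w z *\<^sub>R g z)"
        unfolding norm_eq[symmetric] by (intro integrableI_bounded) measurable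
    qed
    have le: "AE w in surface_measure. ennreal (cmod (T_op \<sigma> \<mu> g w)) \<le> ?F w"
    proof (rule AE_mp[OF int], intro AE_I2 impI)
      fix w assume "integrable \<mu> (\<lambda>z. T_kernel \<sigma> w z *\<^sub>R g z)"
      then show "ennreal (cmod (T_op \<sigma> \<mu> g w)) \<le> ?F w"
        unfolding T_op_def norm_eq[symmetric] by (rule integral_norm_bound_ennreal)
    qed
    have Tom [measurable]: "T_op \<sigma> \<mu> g \<in> borel_measurable surface_measure"
      unfolding T_op_def T_kernel_eq by measurable
    have "(\<integral>\<^sup>+w. ennreal ((cmod (T_op \<sigma> \<mu> g w))\<^sup>2) \<partial>surface_measure) \<le> (\<integral>\<^sup>+w. (?F w)\<^sup>2 \<partial>surface_measure)"
    proof (rule nn_integral_mono_AE, rule AE_mp[OF le], intro AE_I2 impI)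
      fix w assume "ennreal (cmod (T_op \<sigma> \<mu> g w)) \<le> ?F w"
      then have "(ennreal (cmod (T_op \<sigma> \<mu> g w)))\<^sup>2 \<le> (?F w)\<^sup>2" by (rule power_mono) simp
      then show "ennreal ((cmod (T_op \<sigma> \<mu> g w))\<^sup>2) \<le> (?F w)\<^sup>2" by (simp add: ennreal_power)
    qed
    also note bound
    finally have sq: "(\<integral>\<^sup>+w. ennreal ((cmod (T_op \<sigma> \<mu> g w))\<^sup>2) \<partial>surface_measure) \<le> ennreal (max 0 C * (L2_norm \<mu> g)\<^sup>2)" .
    have L2: "in_L2 surface_measure (T_op \<sigma> \<mu> g)"
      unfolding in_L2_def using sq by (auto intro!: integrableI_bounded simp: le_less_trans)
    have "(L2_norm surface_measure (T_op \<sigma> \<mu> g))\<^sup>2 \<le> (sqrt (max 0 C) * L2_norm \<mu> g)\<^sup>2"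
      using sq unfolding L2_norm_power2[OF L2, symmetric]
      by (subst (asm) ennreal_le_iff) (simp_all add: power_mult_distrib)
    then have "L2_norm surface_measure (T_op \<sigma> \<mu> g) \<le> sqrt (max 0 C) * L2_norm \<mu> g"
      by (rule power2_le_imp_le) (simp add: L2_norm_def)
    then show ?thesis using int L2 by blast
  qed
  then show ?thesis unfolding T_bounded_def by blast
qed

theorem theorem41:
  fixes \<sigma> :: real
    and \<mu> :: "(complex ^ 'n) measure"
    and J :: "nat \<Rightarrow> nat"
    and c :: "nat \<Rightarrow> nat \<Rightarrow> complex ^ 'n"
    and Q :: "nat \<Rightarrow> nat \<Rightarrow> (complex ^ 'n) set"
  assumes "0 \<le> \<sigma>" and "\<sigma> < real CARD('n) / 2"
    and "sets \<mu> = sets (restrict_space borel (ball 0 1))"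
    and "sigma_finite_measure \<mu>"
    and "bergman_tree J c Q"
  shows "((\<exists>\<alpha>>-1. R_ineq \<sigma> \<mu> \<alpha>) \<longleftrightarrow> (\<forall>\<alpha>>-1. R_ineq \<sigma> \<mu> \<alpha>)) \<and>
         ((\<forall>\<alpha>>-1. R_ineq \<sigma> \<mu> \<alpha>) \<longleftrightarrow> T_bounded \<sigma> \<mu>) \<and>
         (T_bounded \<sigma> \<mu> \<longleftrightarrow> tree_condition J c Q \<sigma> \<mu>)"
proof -
  interpret bergman_tree J c Q by fact
  let ?m = "distr \<mu> borel (\<lambda>z. z)"
  note m = extended_measure[OF assms(3,4)]
  have tree: "tree_condition J c Q \<sigma> \<mu> \<longleftrightarrow> tree_test \<sigma> ?m"
    by (rule tree_condition_iff_test[OF assms(3) m(6)])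
  have R: "R_ineq \<sigma> \<mu> \<alpha> \<longleftrightarrow> tree_test \<sigma> ?m" if "-1 < \<alpha>" for \<alpha>
    unfolding R_ineq_iff_energy_bounded[OF assms(3,4) that]
    using assms(1,2) that by (intro energy_bounded_iff_tree_test[OF koranyi_regular_bergman_measure] m) auto
  have T: "T_bounded \<sigma> \<mu> \<longleftrightarrow> tree_test \<sigma> ?m"
    using T_bounded_imp_energy_bounded[OF assms(3,4)] energy_bounded_imp_T_bounded[OF assms(3,4)]
      energy_bounded_iff_tree_test[OF koranyi_regular_sphere_measure assms(1,2) refl m(3-5)] by blast
  have "(0::real) > -1" by simp
  then show ?thesis using tree R T by blast
qed

end
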